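(* Let $1\le p<\infty$ and $\omega\in\widehat{\mathcal D}$. Suppose $(\varphi_t)_{t\ge0}$ is a semigroup of analytic self-maps of $\mathbb D$ with infinitesimal generator $G$. Then the corresponding composition semigroup $(C_t)_{t\ge0}$, $C_tf=f\circ\varphi_t$, is strongly continuous on $A^p_\omega$, with infinitesimal generator $\Gamma$ given by $$\Gamma f=Gf'$$ on the domain $$D(\Gamma)=\{f\in A^p_\omega:\ Gf'\in A^p_\omega\}.$$ Moreover, $(C_t)_{t\ge0}$ is uniformly continuous on $A^p_\omega$ if and only if $(\varphi_t)_{t\ge0}$ is trivial.
   Context: $\mathbb D=\{z\in\mathbb C:|z|<1\}$, $dA=\frac{dx\,dy}{\pi}$. A radial weight is a non-negative $\omega\in L^1(\mathbb D)$ with $\omega(z)=\omega(|z|)$. Put $\widehat\omega(z)=\int_{|z|}^1\omega(s)\,ds$; throughout, $\widehat\omega(z)>0$ for all $z\in\mathbb D$. A radial weight $\omega$ belongs to $\widehat{\mathcal D}$ if there is $C\ge1$ with $\widehat\omega(r)\le C\,\widehat\omega(\frac{1+r}{2})$ for all $0\le r<1$. $A^p_\omega$ consists of the analytic functions $f$ on $\mathbb D$ with $\|f\|_{A^p_\omega}^p=\int_{\mathbb D}|f|^p\omega\,dA<\infty$. A semigroup of analytic self-maps of $\mathbb D$ is a family $(\varphi_t)_{t\ge0}$ of analytic maps $\mathbb D\to\mathbb D$ with $\varphi_0=\mathrm{id}$, $\varphi_t\circ\varphi_s=\varphi_{t+s}$, and $\varphi_t(z)\to z$ as $t\to0^+$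 for each $z\in\mathbb D$. It is trivial if every $\varphi_t$ is the identity. Its infinitesimal generator is $G(z)=\lim_{t\to0^+}\frac{\varphi_t(z)-z}{t}$ (so $G\equiv0$ for the trivial semigroup). $(C_t)$ is strongly continuous on $X$ if each $C_t$ is bounded on $X$ and $\lim_{t\to0^+}\|C_tx-x\|_X=0$ for all $x\in X$; it is uniformly continuous if $\lim_{t\to0^+}\|C_t-I\|=0$ in operator norm. The generator is $\Gamma f=\lim_{t\to0^+}\frac{C_tf-f}{t}$ on the set of $f$ for which the limit exists in norm. *)

theory Defs
  imports "HOL-Complex_Analysis.Complex_Analysis"
begin

text \<open>
  Functions on the unit disc are represented by total functions on \<^typ>\<open>complex\<close> of which only
  the values on \<^term>\<open>ball 0 1 :: complex set\<close> are relevant: two functions that agree on the disc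
  stand for the same element of a function space, and an analytic function of the disc is a
  function that is holomorphic on the open ball.
\<close>

definition radial_weight :: "(complex \<Rightarrow> real) \<Rightarrow> bool" where
  "radial_weight \<omega> \<longleftrightarrow>
     (\<forall>z\<in>ball 0 1. 0 \<le> \<omega> z \<and> \<omega> z = \<omega> (of_real (norm z))) \<and>
     set_integrable lebesgue (ball 0 1) \<omega>"

text \<open>
  The tail integral takes values in \<^typ>\<open>ennreal\<close>: integrability of a radial weight over the
  disc does not exclude that the tail is infinite at the origin.
\<close>

definition weight_tail :: "(complex \<Rightarrow> real) \<Rightarrow> complex \<Rightarrow> ennreal" where
  "weight_tail \<omega> z = (\<integral>\<^sup>+ s\<in>{norm z..<1}. ennreal (\<omega> (complex_of_real s)) \<partial>lebesgue)"

definition upper_doubling_weights :: "(complex \<Rightarrow> real) set" where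
  "upper_doubling_weights =
     {\<omega>. radial_weight \<omega> \<and>
         (\<exists>C\<ge>1. \<forall>r. 0 \<le> r \<and> r < 1 \<longrightarrow>
            weight_tail \<omega> (complex_of_real r)
              \<le> ennreal C * weight_tail \<omega> (complex_of_real ((1 + r) / 2)))}"

definition bergman_space :: "real \<Rightarrow> (complex \<Rightarrow> real) \<Rightarrow> (complex \<Rightarrow> complex) set" where
  "bergman_space p \<omega> =
     {f. f holomorphic_on ball 0 1 \<and>
         set_integrable lebesgue (ball 0 1) (\<lambda>z. norm (f z) powr p * \<omega> z)}"

text \<open>The factor \<^term>\<open>1 / pi\<close> comes from the normalised area measure on the disc.\<close>

definition bergman_norm :: "real \<Rightarrow> (complex \<Rightarrow> real) \<Rightarrow> (complex \<Rightarrow> complex) \<Rightarrow> real" where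
  "bergman_norm p \<omega> f =
     (1 / pi * (LINT z:ball 0 1|lebesgue. norm (f z) powr p * \<omega> z)) powr (1 / p)"

definition self_map_semigroup :: "(real \<Rightarrow> complex \<Rightarrow> complex) \<Rightarrow> bool" where
  "self_map_semigroup \<phi> \<longleftrightarrow>
     (\<forall>t\<ge>0. \<phi> t holomorphic_on ball 0 1 \<and> \<phi> t ` ball 0 1 \<subseteq> ball 0 1) \<and>
     (\<forall>z\<in>ball 0 1. \<phi> 0 z = z) \<and>
     (\<forall>t\<ge>0. \<forall>s\<ge>0. \<forall>z\<in>ball 0 1. \<phi> t (\<phi> s z) = \<phi> (t + s) z) \<and>
     (\<forall>z\<in>ball 0 1. ((\<lambda>t. \<phi> t z) \<longlongrightarrow> z) (at_right 0))"

definition trivial_semigroup :: "(real \<Rightarrow> complex \<Rightarrow> complex) \<Rightarrow> bool" where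
  "trivial_semigroup \<phi> \<longleftrightarrow> (\<forall>t\<ge>0. \<forall>z\<in>ball 0 1. \<phi> t z = z)"

definition infinitesimal_generator :: "(real \<Rightarrow> complex \<Rightarrow> complex) \<Rightarrow> complex \<Rightarrow> complex" where
  "infinitesimal_generator \<phi> z = Lim (at_right 0) (\<lambda>t. (\<phi> t z - z) / of_real t)"

definition composition_semigroup ::
    "(real \<Rightarrow> complex \<Rightarrow> complex) \<Rightarrow> real \<Rightarrow> (complex \<Rightarrow> complex) \<Rightarrow> complex \<Rightarrow> complex" where
  "composition_semigroup \<phi> t f = f \<circ> \<phi> t"

text \<open>
  In the following definitions \<open>X\<close> is the carrier of a space of functions on the disc and \<open>N\<close>
  its norm.
\<close>

definition bounded_operator ::
    "(complex \<Rightarrow> complex) set \<Rightarrow> ((complex \<Rightarrow> complex) \<Rightarrow> real) \<Rightarrow>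
     ((complex \<Rightarrow> complex) \<Rightarrow> complex \<Rightarrow> complex) \<Rightarrow> bool" where
  "bounded_operator X N T \<longleftrightarrow>
     T ` X \<subseteq> X \<and>
     (\<forall>f\<in>X. \<forall>g\<in>X. \<forall>a b. \<forall>z\<in>ball 0 1. T (\<lambda>w. a * f w + b * g w) z = a * T f z + b * T g z) \<and>
     (\<exists>K. \<forall>f\<in>X. N (T f) \<le> K * N f)"

definition operator_norm ::
    "(complex \<Rightarrow> complex) set \<Rightarrow> ((complex \<Rightarrow> complex) \<Rightarrow> real) \<Rightarrow>
     ((complex \<Rightarrow> complex) \<Rightarrow> complex \<Rightarrow> complex) \<Rightarrow> ennreal" where
  "operator_norm X N T = (SUP f\<in>{f \<in> X. N f \<le> 1}. ennreal (N (T f)))"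

definition strongly_continuous ::
    "(complex \<Rightarrow> complex) set \<Rightarrow> ((complex \<Rightarrow> complex) \<Rightarrow> real) \<Rightarrow>
     (real \<Rightarrow> (complex \<Rightarrow> complex) \<Rightarrow> complex \<Rightarrow> complex) \<Rightarrow> bool" where
  "strongly_continuous X N C \<longleftrightarrow>
     (\<forall>t\<ge>0. bounded_operator X N (C t)) \<and>
     (\<forall>f\<in>X. ((\<lambda>t. N (\<lambda>z. C t f z - f z)) \<longlongrightarrow> 0) (at_right 0))"

definition uniformly_continuous ::
    "(complex \<Rightarrow> complex) set \<Rightarrow> ((complex \<Rightarrow> complex) \<Rightarrow> real) \<Rightarrow>
     (real \<Rightarrow> (complex \<Rightarrow> complex) \<Rightarrow> complex \<Rightarrow> complex) \<Rightarrow> bool" where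
  "uniformly_continuous X N C \<longleftrightarrow>
     (\<forall>t\<ge>0. bounded_operator X N (C t)) \<and>
     ((\<lambda>t. operator_norm X N (\<lambda>f z. C t f z - f z)) \<longlongrightarrow> 0) (at_right 0)"

definition has_generator_value ::
    "(complex \<Rightarrow> complex) set \<Rightarrow> ((complex \<Rightarrow> complex) \<Rightarrow> real) \<Rightarrow>
     (real \<Rightarrow> (complex \<Rightarrow> complex) \<Rightarrow> complex \<Rightarrow> complex) \<Rightarrow>
     (complex \<Rightarrow> complex) \<Rightarrow> (complex \<Rightarrow> complex) \<Rightarrow> bool" where
  "has_generator_value X N C f g \<longleftrightarrow>
     g \<in> X \<and> ((\<lambda>t. N (\<lambda>z. (C t f z - f z) / of_real t - g z)) \<longlongrightarrow> 0) (at_right 0)"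

definition generator_domain ::
    "(complex \<Rightarrow> complex) set \<Rightarrow> ((complex \<Rightarrow> complex) \<Rightarrow> real) \<Rightarrow>
     (real \<Rightarrow> (complex \<Rightarrow> complex) \<Rightarrow> complex \<Rightarrow> complex) \<Rightarrow> (complex \<Rightarrow> complex) set" where
  "generator_domain X N C = {f \<in> X. \<exists>g. has_generator_value X N C f g}"

text \<open>
  The choice operator is used since the limit is determined only up to its irrelevant values
  outside the disc.
\<close>

definition generator ::
    "(complex \<Rightarrow> complex) set \<Rightarrow> ((complex \<Rightarrow> complex) \<Rightarrow> real) \<Rightarrow>
     (real \<Rightarrow> (complex \<Rightarrow> complex) \<Rightarrow> complex \<Rightarrow> complex) \<Rightarrow>
     (complex \<Rightarrow> complex) \<Rightarrow> complex \<Rightarrow> complex" where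
  "generator X N C f = (SOME g. has_generator_value X N C f g)"

end

theory Submission
  imports Defs "HOL-Probability.Probability_Measure"
begin

text \<open>
  Jensen's inequality for the Poisson kernel gives the subordination inequality
  \<open>M\<^sub>p\<^sup>p(r, f \<circ> \<phi>) \<le> K M\<^sub>p\<^sup>p(R, f)\<close> for the integral means, and by Harnack's inequality \<open>1 - R\<close> may be taken
  comparable to \<open>1 - r\<close>, uniformly as long as \<open>\<bar>\<phi> 0\<bar>\<close> stays away from 1. Integrating against a radial weight, the doubling
  condition absorbs the change from \<open>r\<close> to \<open>R\<close>. This bounds the composition operators and also
  makes the tails of \<open>\<bar>f \<circ> \<phi>\<^sub>t\<bar>\<^sup>p\<close> near the circle uniformly small for small \<open>t\<close>, whence strong continuity.

  If \<open>h = G f'\<close> lies in the space, then \<open>f \<circ> \<phi>\<^sub>t - f\<close> is the integral of \<open>h \<circ> \<phi>\<^sub>s\<close> over \<open>0 \<le> s \<le> t\<close>, and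
  strong continuity at \<open>h\<close> yields \<open>\<Gamma> f = h\<close>; the converse follows from continuity of point evaluations.

  Uniform continuity forces \<open>\<parallel>C\<^sub>t - I\<parallel> = O(t)\<close> along \<open>t = t\<^sub>0 / 2 ^ k\<close>, hence \<open>\<parallel>G f'\<parallel> \<le> K \<parallel>f\<parallel>\<close> by Fatou.
  For \<open>f = z ^ n\<close> this reads \<open>n \<parallel>G z ^ (n - 1)\<parallel> \<le> K \<parallel>z ^ n\<parallel>\<close>; as the means of \<open>G\<close> increase with the radius
  and the norms of large powers concentrate at the circle, \<open>G = 0\<close>.
\<close>

section \<open>Rotations and arc length\<close>

text \<open>Three obstacles shape the details. The weight is merely Lebesgue measurable; once it is
  traded for a Borel radial profile, everything concerns a rotation invariant Borel measure on the
  disc, and polar coordinates are replaced by averaging over rotations. The generator is defined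
  through a limit whose existence is not assumed: differentiability of the orbits is derived from
  the semigroup law and continuity alone, by averaging in time, and holomorphy of \<open>G\<close>
  is obtained only inside the argument on uniform continuity, where it is needed. Finally, about the
  norm of \<open>C_t - I\<close> only its limit at 0 is given, with no regularity in
  \<open>t\<close>; dyadic times are used because there the semigroup law alone yields a recursion.
  Uniformity is what makes the subordination estimate useful twice: its constants depend on a bound
  for the modulus of \<phi> 0 and not on the map, so one tail estimate serves all small times at
  once.\<close>

lemma measurable_Complex:
  "(\<lambda>(x, y). Complex x y) \<in> (lborel \<Otimes>\<^sub>M lborel) \<rightarrow>\<^sub>M borel"
proof -
  have "(\<lambda>x. complex_of_real (fst x) + \<i> * complex_of_real (snd x)) \<in> borel_measurable (borel :: (real \<times> real) measure)"
    by (intro borel_measurable_continuous_onI continuous_intros)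
  then show ?thesis by (simp add: lborel_prod case_prod_beta Complex_eq)
qed

lemma distr_Complex_lborel:
  "distr (lborel \<Otimes>\<^sub>M lborel) borel (\<lambda>(x, y). Complex x y) = (lborel :: complex measure)"
proof (rule lborel_eqI[symmetric])
  note m = measurable_Complex
  fix l u :: complex
  assume le: "\<And>b. b \<in> Basis \<Longrightarrow> l \<bullet> b \<le> u \<bullet> b"
  have "Re l \<le> Re u" "Im l \<le> Im u"
    using le[of 1] le[of \<i>] by (auto simp: Basis_complex_def)
  moreover have "(\<lambda>(x, y). Complex x y) -` box l u \<inter> space (lborel \<Otimes>\<^sub>M lborel)
      = {Re l<..<Re u} \<times> {Im l<..<Im u}"
    by (auto simp: box_def Basis_complex_def space_pair_measure)
  ultimately show "emeasure (distr (lborel \<Otimes>\<^sub>M lborel) borel (\<lambda>(x, y). Complex x y)) (box l u)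
      = (\<Prod>b\<in>Basis. (u - l) \<bullet> b)"
    by (simp add: emeasure_distr[OF m] lborel.emeasure_pair_measure_Times Basis_complex_def
        flip: ennreal_mult)
qed auto

lemma nn_integral_lborel_complex:
  fixes g :: "complex \<Rightarrow> ennreal"
  assumes [measurable]: "g \<in> borel_measurable borel"
  shows "(\<integral>\<^sup>+z. g z \<partial>lborel) = (\<integral>\<^sup>+y. \<integral>\<^sup>+x. g (Complex x y) \<partial>lborel \<partial>lborel)"
    and "(\<integral>\<^sup>+z. g z \<partial>lborel) = (\<integral>\<^sup>+x. \<integral>\<^sup>+y. g (Complex x y) \<partial>lborel \<partial>lborel)"
proof -
  note m[measurable] = measurable_Complex
  have m2: "(\<lambda>(x, y). g (Complex x y)) \<in> borel_measurable (lborel \<Otimes>\<^sub>M lborel)"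
    using measurable_compose[OF m assms] by (simp add: case_prod_beta)
  have "(\<integral>\<^sup>+z. g z \<partial>lborel) = (\<integral>\<^sup>+(x, y). g (Complex x y) \<partial>(lborel \<Otimes>\<^sub>M lborel))"
    by (subst distr_Complex_lborel[symmetric], subst nn_integral_distr[OF m]) (simp_all add: case_prod_unfold)
  then show "(\<integral>\<^sup>+z. g z \<partial>lborel) = (\<integral>\<^sup>+x. \<integral>\<^sup>+y. g (Complex x y) \<partial>lborel \<partial>lborel)"
    using lborel.nn_integral_fst[OF m2] by simp
  then show "(\<integral>\<^sup>+z. g z \<partial>lborel) = (\<integral>\<^sup>+y. \<integral>\<^sup>+x. g (Complex x y) \<partial>lborel \<partial>lborel)"
    using lborel_pair.Fubini'[OF m2] by simp
qed

text \<open>A shear moves every line parallel to one axis along itself by a constant, so Tonelli and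
  translation invariance in one variable suffice. Having both directions makes rotations accessible
  without a change of variables.\<close>

lemma nn_integral_shear:
  fixes g :: "complex \<Rightarrow> ennreal"
  assumes [measurable]: "g \<in> borel_measurable borel"
  shows "(\<integral>\<^sup>+z. g (Complex (Re z + a * Im z) (Im z)) \<partial>lborel) = (\<integral>\<^sup>+z. g z \<partial>lborel)"
    and "(\<integral>\<^sup>+z. g (Complex (Re z) (Im z + a * Re z)) \<partial>lborel) = (\<integral>\<^sup>+z. g z \<partial>lborel)"
proof -
  have [measurable]: "(\<lambda>x. Complex x y) \<in> borel_measurable borel" "(\<lambda>x. Complex y x) \<in> borel_measurable borel" for y
    by (simp_all add: Complex_eq)
  have "(\<integral>\<^sup>+x. g (Complex x y) \<partial>lborel) = (\<integral>\<^sup>+x. g (Complex (x + a * y) y) \<partial>lborel)" for y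
    using nn_integral_real_affine[of "\<lambda>x. g (Complex x y)" 1 "a * y"] by (simp add: add.commute)
  moreover have "(\<lambda>z. g (Complex (Re z + a * Im z) (Im z))) \<in> borel_measurable borel"
    by (simp add: Complex_eq)
  ultimately show "(\<integral>\<^sup>+z. g (Complex (Re z + a * Im z) (Im z)) \<partial>lborel) = (\<integral>\<^sup>+z. g z \<partial>lborel)"
    by (simp add: nn_integral_lborel_complex(1))
  have "(\<integral>\<^sup>+x. g (Complex y x) \<partial>lborel) = (\<integral>\<^sup>+x. g (Complex y (x + a * y)) \<partial>lborel)" for y
    using nn_integral_real_affine[of "\<lambda>x. g (Complex y x)" 1 "a * y"] by (simp add: add.commute)
  moreover have "(\<lambda>z. g (Complex (Re z) (Im z + a * Re z))) \<in> borel_measurable borel"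
    by (simp add: Complex_eq)
  ultimately show "(\<integral>\<^sup>+z. g (Complex (Re z) (Im z + a * Re z)) \<partial>lborel) = (\<integral>\<^sup>+z. g z \<partial>lborel)"
    by (simp add: nn_integral_lborel_complex(2))
qed

text \<open>A rotation other than the half turn is a composition of three shears.\<close>

lemma nn_integral_rotate:
  fixes g :: "complex \<Rightarrow> ennreal"
  assumes [measurable]: "g \<in> borel_measurable borel" and c: "norm c = 1"
  shows "(\<integral>\<^sup>+z. g (c * z) \<partial>lborel) = (\<integral>\<^sup>+z. g z \<partial>lborel)"
proof -
  have *: "(\<integral>\<^sup>+z. h (d * z) \<partial>lborel) = (\<integral>\<^sup>+z. h z \<partial>lborel)"
    if [measurable]: "h \<in> borel_measurable borel" and d: "norm d = 1" "Re d \<noteq> -1"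
    for h :: "complex \<Rightarrow> ennreal" and d
  proof -
    \<comment> \<open>\<open>t\<close> is the tangent of half the rotation angle: shearing by
      \<open>-t\<close>, by \<open>S\<close> and by \<open>-t\<close> again is multiplication by
      \<open>d\<close>. The half turn, where \<open>1 + C = 0\<close>, has no such
      \<open>t\<close>.\<close>
    define C S t where "C = Re d" and "S = Im d" and "t = S / (1 + C)"
    have CS: "C\<^sup>2 + S\<^sup>2 = 1" using d by (simp add: C_def S_def cmod_def)
    have "1 + C \<noteq> 0" using d by (auto simp: C_def)
    then have t: "t * (1 + C) = S" by (simp add: t_def)
    have "S * t * (1 + C) = 1 - C\<^sup>2" using t CS by (simp add: power2_eq_square algebra_simps)
    also have "\<dots> = (1 - C) * (1 + C)" by (simp add: power2_eq_square algebra_simps)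
    finally have St: "S * t = 1 - C" using \<open>1 + C \<noteq> 0\<close> by simp
    define h1 where "h1 = (\<lambda>z. h (Complex (Re z - t * Im z) (Im z)))"
    define h2 where "h2 = (\<lambda>z. h1 (Complex (Re z) (Im z + S * Re z)))"
    have [measurable]: "h1 \<in> borel_measurable borel"
      unfolding h1_def by (simp add: Complex_eq)
    have [measurable]: "h2 \<in> borel_measurable borel"
      unfolding h2_def by (simp add: Complex_eq)
    have dz: "d * z = Complex ((Re z - t * Im z) - t * (Im z + S * (Re z - t * Im z))) (Im z + S * (Re z - t * Im z))"
      for z
    proof (rule complex_eqI)
      have "(Re z - t * Im z) - t * (Im z + S * (Re z - t * Im z))
        = Re z * (1 - S * t) - Im z * (t * (1 + (1 - S * t)))" by (simp add: algebra_simps)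
      also have "\<dots> = Re z * C - Im z * S" by (simp add: St t)
      finally show "Re (d * z) = Re (Complex ((Re z - t * Im z) - t * (Im z + S * (Re z - t * Im z))) (Im z + S * (Re z - t * Im z)))"
        by (simp add: C_def S_def algebra_simps)
      have "Im z + S * (Re z - t * Im z) = Im z * (1 - S * t) + S * Re z" by (simp add: algebra_simps)
      then show "Im (d * z) = Im (Complex ((Re z - t * Im z) - t * (Im z + S * (Re z - t * Im z))) (Im z + S * (Re z - t * Im z)))"
        by (simp add: St) (simp add: C_def S_def algebra_simps)
    qed
    have "(\<integral>\<^sup>+z. h (d * z) \<partial>lborel) = (\<integral>\<^sup>+z. h2 (Complex (Re z + (-t) * Im z) (Im z)) \<partial>lborel)"
      by (simp add: dz h1_def h2_def)
    also have "\<dots> = (\<integral>\<^sup>+z. h2 z \<partial>lborel)" by (rule nn_integral_shear) simp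
    also have "\<dots> = (\<integral>\<^sup>+z. h1 z \<partial>lborel)" unfolding h2_def by (rule nn_integral_shear) simp
    also have "\<dots> = (\<integral>\<^sup>+z. h (Complex (Re z + (-t) * Im z) (Im z)) \<partial>lborel)" by (simp add: h1_def)
    also have "\<dots> = (\<integral>\<^sup>+z. h z \<partial>lborel)" by (rule nn_integral_shear) simp
    finally show ?thesis .
  qed
  show ?thesis
  proof (cases "Re c = -1")
    case True
    then have "(Im c)\<^sup>2 = 0" using c by (simp add: cmod_def)
    \<comment> \<open>The half turn is two quarter turns, and each of these is covered by the three
      shears.\<close>
    then have c': "c * z = \<i> * (\<i> * z)" for z
      using True by (simp add: complex_eq_iff)
    have "(\<integral>\<^sup>+z. g (\<i> * (\<i> * z)) \<partial>lborel) = (\<integral>\<^sup>+z. g (\<i> * z) \<partial>lborel)"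
      by (rule *) auto
    then show ?thesis unfolding c' by (simp add: *)
  qed (use * c in simp)
qed

text \<open>Normalised arc length. Defining it by radial projection of the disc makes its rotation
  invariance a consequence of that of the plane measure.\<close>

definition circle_measure :: "complex measure" where
  "circle_measure = distr (uniform_measure lborel (ball 0 1))
     (restrict_space borel (sphere 0 1)) (\<lambda>z. if z = 0 then 1 else sgn z)"

lemma emeasure_unit_disc: "emeasure lborel (ball 0 1 :: complex set) = ennreal pi"
  by (simp add: emeasure_ball unit_ball_vol_2)

lemma measurable_radial_projection [measurable]:
  "(\<lambda>z::complex. if z = 0 then 1 else sgn z) \<in> borel \<rightarrow>\<^sub>M restrict_space borel (sphere 0 1)"
  by (rule measurable_restrict_space2) (auto simp: norm_sgn)

lemma space_circle_measure [simp]: "space circle_measure = sphere 0 1"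
  by (simp add: circle_measure_def space_restrict_space)

lemma sets_circle_measure [measurable_cong]: "sets circle_measure = sets (restrict_space borel (sphere 0 1))"
  by (simp add: circle_measure_def)

interpretation circle: prob_space circle_measure
proof -
  interpret U: prob_space "uniform_measure lborel (ball 0 1 :: complex set)"
    by (rule prob_space_uniform_measure) (simp_all add: emeasure_unit_disc)
  show "prob_space circle_measure"
    unfolding circle_measure_def by (rule U.prob_space_distr) (simp cong: measurable_cong_sets)
qed

lemma measure_circle_sphere [simp]: "measure circle_measure (sphere 0 1) = 1"
  using circle.prob_space by simp

lemma nn_integral_circle_rotate:
  assumes g: "g \<in> borel_measurable circle_measure" and c: "norm c = 1"
  shows "(\<integral>\<^sup>+\<zeta>. g (c * \<zeta>) \<partial>circle_measure) = (\<integral>\<^sup>+\<zeta>. g \<zeta> \<partial>circle_measure)"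
proof -
  define P where "P = (\<lambda>z::complex. if z = 0 then 1 else sgn z)"
  have g'[measurable]: "g \<in> borel_measurable (restrict_space borel (sphere 0 1))"
    using g by (simp cong: measurable_cong_sets add: sets_circle_measure)
  have P[measurable]: "P \<in> borel \<rightarrow>\<^sub>M restrict_space borel (sphere 0 1)"
    unfolding P_def by measurable
  have rot[measurable]: "(\<lambda>\<zeta>. c * \<zeta>) \<in> restrict_space borel (sphere 0 1) \<rightarrow>\<^sub>M restrict_space borel (sphere 0 1)"
    by (rule measurable_restrict_space2)
       (auto simp: norm_mult c space_restrict_space intro!: measurable_restrict_space1)
  have eq: "(\<integral>\<^sup>+\<zeta>. h \<zeta> \<partial>circle_measure) = (\<integral>\<^sup>+z. h (P z) * indicator (ball 0 1) z \<partial>lborel) / ennreal pi"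
    if [measurable]: "h \<in> borel_measurable (restrict_space borel (sphere 0 1))" for h
  proof -
    have "(\<integral>\<^sup>+\<zeta>. h \<zeta> \<partial>circle_measure) = (\<integral>\<^sup>+z. h (P z) \<partial>uniform_measure lborel (ball 0 1))"
      unfolding circle_measure_def P_def[symmetric]
      by (subst nn_integral_distr) (auto cong: measurable_cong_sets)
    then show ?thesis
      by (subst (asm) nn_integral_uniform_measure) (auto simp: emeasure_unit_disc)
  qed
  have "(\<integral>\<^sup>+z. g (c * P z) * indicator (ball 0 1) z \<partial>lborel)
      = (\<integral>\<^sup>+z. g (P (c * z)) * indicator (ball 0 1) (c * z) \<partial>lborel)"
  proof (rule nn_integral_cong_AE)
    \<comment> \<open>Radial projection commutes with rotation only off the centre, where
      \<open>P\<close> was given the arbitrary value 1.\<close>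
    have "AE z in lborel. z \<noteq> (0::complex)" by (rule AE_lborel_singleton)
    then show "AE z in lborel. g (c * P z) * indicator (ball 0 1) z
        = g (P (c * z)) * indicator (ball 0 1) (c * z)"
    proof eventually_elim
      case (elim z)
      moreover have "c \<noteq> 0" using c by auto
      ultimately have "c * P z = P (c * z)" using c by (simp add: P_def sgn_eq norm_mult)
      then show ?case using c by (simp add: norm_mult indicator_def)
    qed
  qed
  also have "\<dots> = (\<integral>\<^sup>+z. g (P z) * indicator (ball 0 1) z \<partial>lborel)"
    by (rule nn_integral_rotate[of "\<lambda>z. g (P z) * indicator (ball 0 1) z"])
       (use c measurable_compose[OF P g'] in \<open>auto intro!: borel_measurable_times_ennreal borel_measurable_indicator\<close>)
  finally show ?thesis by (simp add: eq)
qed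

text \<open>Recast as an equality of measures, rotation invariance carries over from nonnegative
  integrands to Bochner integrals of complex functions.\<close>

lemma distr_circle_rotate:
  assumes c: "norm c = 1"
  shows "distr circle_measure circle_measure (\<lambda>\<zeta>. c * \<zeta>) = circle_measure"
proof (rule measure_eqI)
  have rot: "(\<lambda>\<zeta>. c * \<zeta>) \<in> circle_measure \<rightarrow>\<^sub>M circle_measure"
    unfolding measurable_cong_sets[OF sets_circle_measure sets_circle_measure]
    by (rule measurable_restrict_space2)
       (auto simp: norm_mult c space_restrict_space intro!: measurable_restrict_space1)
  fix A assume "A \<in> sets (distr circle_measure circle_measure (\<lambda>\<zeta>. c * \<zeta>))"
  then have A: "A \<in> sets circle_measure" by simp
  have "emeasure (distr circle_measure circle_measure (\<lambda>\<zeta>. c * \<zeta>)) A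
     = (\<integral>\<^sup>+\<zeta>. indicator A \<zeta> \<partial>distr circle_measure circle_measure (\<lambda>\<zeta>. c * \<zeta>))"
    using A by simp
  also have "\<dots> = (\<integral>\<^sup>+\<zeta>. indicator A (c * \<zeta>) \<partial>circle_measure)"
    by (rule nn_integral_distr[OF rot]) (use A in auto)
  also have "\<dots> = emeasure circle_measure A"
    by (subst nn_integral_circle_rotate) (use A c in auto)
  finally show "emeasure (distr circle_measure circle_measure (\<lambda>\<zeta>. c * \<zeta>)) A = emeasure circle_measure A" .
qed simp

lemma integral_circle_rotate:
  fixes g :: "complex \<Rightarrow> complex"
  assumes g: "g \<in> borel_measurable circle_measure" and c: "norm c = 1"
  shows "(\<integral>\<zeta>. g (c * \<zeta>) \<partial>circle_measure) = (\<integral>\<zeta>. g \<zeta> \<partial>circle_measure)"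
proof -
  have rot: "(\<lambda>\<zeta>. c * \<zeta>) \<in> circle_measure \<rightarrow>\<^sub>M circle_measure"
    unfolding measurable_cong_sets[OF sets_circle_measure sets_circle_measure]
    by (rule measurable_restrict_space2)
       (auto simp: norm_mult c space_restrict_space intro!: measurable_restrict_space1)
  show ?thesis
    using integral_distr[OF rot g] by (simp add: distr_circle_rotate[OF c])
qed

section \<open>Mean values over the unit circle\<close>

lemma borel_measurable_circle_continuous:
  assumes "continuous_on (sphere 0 1) f"
  shows "f \<in> borel_measurable circle_measure"
  using borel_measurable_continuous_on_restrict[OF assms]
  by (simp cong: measurable_cong_sets add: sets_circle_measure)

lemma integrable_circle_continuous:
  fixes f :: "complex \<Rightarrow> 'b::{banach, second_countable_topology}"
  assumes "continuous_on (sphere 0 1) f"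
  shows "integrable circle_measure f"
proof -
  have "compact (f ` sphere 0 1)" using assms by (intro compact_continuous_image) auto
  then obtain B where "\<forall>x\<in>f ` sphere 0 1. norm x \<le> B"
    using compact_imp_bounded bounded_iff by blast
  then show ?thesis
    by (intro circle.integrable_const_bound[where B=B] borel_measurable_circle_continuous assms AE_I2) auto
qed

text \<open>Rotating by the angle \<open>pi / n\<close> changes the sign of the integrand, so the
  integral equals its own negative.\<close>

lemma integral_circle_power:
  assumes "n > 0"
  shows "(\<integral>\<zeta>. \<zeta> ^ n \<partial>circle_measure) = 0"
proof -
  define c where "c = cis (pi / n)"
  have "c ^ n = -1" using assms by (simp add: c_def Complex.DeMoivre)
  moreover have "(\<integral>\<zeta>. (c * \<zeta>) ^ n \<partial>circle_measure) = (\<integral>\<zeta>. \<zeta> ^ n \<partial>circle_measure)"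
    by (rule integral_circle_rotate)
       (auto simp: c_def intro!: borel_measurable_circle_continuous continuous_intros)
  ultimately show ?thesis by (simp add: power_mult_distrib)
qed

text \<open>Termwise integration of the Taylor series needs no parametrisation of the circle: every
  power except the constant one averages to zero.\<close>

lemma integral_circle_mean_value:
  assumes f: "f holomorphic_on ball 0 S" and r: "0 \<le> r" "r < S"
  shows "(\<integral>\<zeta>. f (of_real r * \<zeta>) \<partial>circle_measure) = f 0"
proof -
  define a where "a = (\<lambda>n. (deriv ^^ n) f 0 / fact n)"
  have sums: "(\<lambda>n. a n * w ^ n) sums f w" if "norm w < S" for w
    using holomorphic_power_series[OF f, of w] that by (simp add: a_def)
  \<comment> \<open>Convergence of the series at a radius strictly beyond \<open>r\<close> gives
    absolute summability at \<open>r\<close>, where the terms have constant modulus on the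
    circle.\<close>
  define s where "s = (S + r) / 2"
  have s: "r < s" "s < S" "0 < s" using r by (auto simp: s_def)
  have "summable (\<lambda>n. a n * (of_real s) ^ n)"
    using sums[of "of_real s"] s by (auto simp: sums_iff)
  then have summ: "summable (\<lambda>n. norm (a n * of_real r ^ n))"
    by (rule powser_insidea) (use r s in auto)
  have int: "integrable circle_measure (\<lambda>\<zeta>. a n * (of_real r * \<zeta>) ^ n)" for n
    by (intro integrable_circle_continuous continuous_intros)
  have nrm: "norm (a n * (of_real r * \<zeta>) ^ n) = norm (a n * of_real r ^ n)" if "\<zeta> \<in> sphere 0 1" for n \<zeta>
    using that by (simp add: norm_mult norm_power)
  have "(\<integral>\<zeta>. norm (a n * (of_real r * \<zeta>) ^ n) \<partial>circle_measure) = norm (a n * of_real r ^ n)" for n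
  proof -
    have "(\<integral>\<zeta>. norm (a n * (of_real r * \<zeta>) ^ n) \<partial>circle_measure) = (\<integral>\<zeta>. norm (a n * of_real r ^ n) \<partial>circle_measure)"
      by (rule Bochner_Integration.integral_cong) (use nrm in auto)
    then show ?thesis by simp
  qed
  then have "(\<lambda>n. \<integral>\<zeta>. a n * (of_real r * \<zeta>) ^ n \<partial>circle_measure) sums
      (\<integral>\<zeta>. (\<Sum>n. a n * (of_real r * \<zeta>) ^ n) \<partial>circle_measure)"
    by (intro sums_integral int AE_I2) (use summ nrm in auto)
  moreover have "(\<integral>\<zeta>. (\<Sum>n. a n * (of_real r * \<zeta>) ^ n) \<partial>circle_measure) = (\<integral>\<zeta>. f (of_real r * \<zeta>) \<partial>circle_measure)"
    by (rule Bochner_Integration.integral_cong)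
       (use sums r in \<open>auto simp: sums_iff norm_mult\<close>)
  moreover have "(\<integral>\<zeta>. a n * (of_real r * \<zeta>) ^ n \<partial>circle_measure) = (if n = 0 then f 0 else 0)" for n
    by (auto simp: power_mult_distrib integral_circle_power a_def)
  ultimately have "(\<lambda>n. if n = 0 then f 0 else 0) sums (\<integral>\<zeta>. f (of_real r * \<zeta>) \<partial>circle_measure)"
    by simp
  moreover have "(\<lambda>n. if n = 0 then f 0 else 0) sums f 0"
    using sums_single[of 0 "\<lambda>_. f 0"] by simp
  ultimately show ?thesis by (rule sums_unique2)
qed

section \<open>The Poisson kernel\<close>

text \<open>The boundary point is \<open>R * \<zeta>\<close> with \<zeta> on the unit circle, so all
  radii share one probability measure.\<close>

definition poisson :: "real \<Rightarrow> complex \<Rightarrow> complex \<Rightarrow> real" where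
  "poisson R w \<zeta> = (R\<^sup>2 - (norm w)\<^sup>2) / (norm (of_real R * \<zeta> - w))\<^sup>2"

text \<open>This is the numerator of the real part of \<open>(u + v) / (u - v)\<close>, which
  identifies the Poisson kernel as the real part of the Herglotz kernel.\<close>

lemma Re_add_mult_cnj_diff: "Re ((u + v) * cnj (u - v)) = (norm u)\<^sup>2 - (norm v)\<^sup>2"
proof -
  have "Re ((u + v) * cnj (u - v)) = (Re u + Re v) * (Re u - Re v) + (Im u + Im v) * (Im u - Im v)"
    by (simp only: times_complex.sel plus_complex.sel complex_cnj cnj.sel minus_complex.sel)
  also have "\<dots> = (norm u)\<^sup>2 - (norm v)\<^sup>2"
    unfolding cmod_power2 by algebra
  finally show ?thesis .
qed

lemma poisson_nonneg: "norm w \<le> R \<Longrightarrow> 0 \<le> poisson R w \<zeta>"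
  by (simp add: poisson_def power_mono)

lemma norm_circle_diff:
  fixes \<zeta> w :: complex
  assumes "norm \<zeta> = 1" "0 < R" "norm w < R"
  shows "R - norm w \<le> norm (of_real R * \<zeta> - w)" "norm (of_real R * \<zeta> - w) \<le> R + norm w"
  using assms norm_triangle_ineq2[of "of_real R * \<zeta>" w] norm_triangle_ineq4[of "of_real R * \<zeta>" w]
  by (auto simp: norm_mult)

text \<open>The numerator of the kernel is fixed while its denominator lies between the squares of
  \<open>R - norm w\<close> and \<open>R + norm w\<close>. With \<open>poisson_ge\<close> this gives
  the constants in Harnack's inequality.\<close>

lemma poisson_le:
  assumes "norm \<zeta> = 1" "0 < R" "norm w < R"
  shows "poisson R w \<zeta> \<le> (R + norm w) / (R - norm w)"
proof -
  have "poisson R w \<zeta> \<le> (R\<^sup>2 - (norm w)\<^sup>2) / (R - norm w)\<^sup>2"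
    unfolding poisson_def using norm_circle_diff[OF assms] assms
    by (intro divide_left_mono power_mono mult_pos_pos zero_less_power) (auto simp: power_mono)
  also have "\<dots> = (R + norm w) / (R - norm w)"
    using assms by (simp add: power2_eq_square divide_simps square_diff_square_factored)
  finally show ?thesis .
qed

lemma poisson_ge:
  assumes "norm \<zeta> = 1" "0 < R" "norm w < R"
  shows "(R - norm w) / (R + norm w) \<le> poisson R w \<zeta>"
proof -
  have "R + norm w > 0" using assms norm_ge_zero[of w] by linarith
  then have "(R - norm w) / (R + norm w) = (R\<^sup>2 - (norm w)\<^sup>2) / (R + norm w)\<^sup>2"
    by (simp add: power2_eq_square divide_simps square_diff_square_factored)
  also have "\<dots> \<le> poisson R w \<zeta>"
    unfolding poisson_def using norm_circle_diff[OF assms] assms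
    by (intro divide_left_mono power_mono mult_pos_pos zero_less_power) (auto simp: power_mono)
  finally show ?thesis .
qed

lemma continuous_on_poisson:
  assumes "0 < R" "norm w < R"
  shows "continuous_on (sphere 0 1) (poisson R w)"
proof -
  have "norm (of_real R * \<zeta> - w) \<noteq> 0" if "\<zeta> \<in> sphere 0 1" for \<zeta>
    using norm_circle_diff(1)[of \<zeta> R w] that assms by auto
  then show ?thesis
    unfolding poisson_def[abs_def] by (intro continuous_intros) auto
qed

text \<open>Cauchy's formula with the pole at \<open>w\<close> and its reflection in the circle of radius \<open>R\<close>:
  the factor \<open>k\<close> is holomorphic, equals 1 at \<open>w\<close>, and turns the Cauchy kernel into the Poisson
  kernel on the circle.\<close>

lemma poisson_formula:
  assumes f: "f holomorphic_on ball 0 S" and R: "0 < R" "R < S" and w: "norm w < R"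
  shows "(\<integral>\<zeta>. of_real (poisson R w \<zeta>) * f (of_real R * \<zeta>) \<partial>circle_measure) = f w"
proof -
  \<comment> \<open>The reflected point of \<open>w\<close> has modulus
    \<open>R^2 / norm w > R\<close>, so the circle of radius \<open>R\<close> sits in a slightly
    larger disc that still avoids this pole. For \<open>w = 0\<close> there is no pole.\<close>
  obtain S' where S': "R < S'" "S' \<le> S" "norm w * S' < R\<^sup>2"
  proof (cases "w = 0")
    case True
    then show ?thesis using R that[of S] by auto
  next
    case False
    have "R < R\<^sup>2 / norm w" using False w R by (simp add: power2_eq_square field_simps)
    then obtain T where T: "R < T" "T < R\<^sup>2 / norm w" using dense by blast
    have "norm w * min S T \<le> norm w * T" by (intro mult_left_mono) auto
    also have "\<dots> < R\<^sup>2" using T False by (simp add: field_simps)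
    finally show ?thesis using that[of "min S T"] R T by auto
  qed
  have dn: "of_real (R\<^sup>2) - cnj w * u \<noteq> 0" if "norm u < S'" for u
  proof
    assume "of_real (R\<^sup>2) - cnj w * u = 0"
    then have "cnj w * u = of_real (R\<^sup>2)" by simp
    then have "norm (cnj w * u) = R\<^sup>2" by (simp only: norm_of_real) simp
    moreover have "norm (cnj w * u) \<le> norm w * S'" using that by (simp add: norm_mult mult_left_mono)
    ultimately show False using S' by simp
  qed
  define k where "k = (\<lambda>u. of_real (R\<^sup>2 - (norm w)\<^sup>2) / (of_real (R\<^sup>2) - cnj w * u))"
  define g where "g = (\<lambda>u. f u * k u)"
  \<comment> \<open>The difference quotient of \<open>g\<close> has a removable singularity at
    \<open>w\<close>. The product \<open>q u * u\<close> vanishes at the origin, so its mean over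
    the circle is 0.\<close>
  define q where "q = (\<lambda>u. if u = w then deriv g w else (g u - g w) / (u - w))"
  have k: "k holomorphic_on ball 0 S'"
    unfolding k_def using dn by (intro holomorphic_intros) auto
  have g: "g holomorphic_on ball 0 S'"
    unfolding g_def using f k S' by (intro holomorphic_intros) (auto elim: holomorphic_on_subset)
  have q: "(\<lambda>u. q u * u) holomorphic_on ball 0 S'"
    unfolding q_def using pole_lemma_open[OF g open_ball, of w] by (intro holomorphic_intros)
  have "k w = 1"
  proof -
    have "cnj w * w = of_real ((norm w)\<^sup>2)" by (metis complex_norm_square mult.commute of_real_power)
    moreover have "R\<^sup>2 \<noteq> (norm w)\<^sup>2" using w R by (simp add: power2_eq_iff_nonneg)
    moreover have "of_real (R\<^sup>2) - of_real ((norm w)\<^sup>2) = complex_of_real (R\<^sup>2 - (norm w)\<^sup>2)"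
      by (rule of_real_diff[symmetric])
    moreover have "complex_of_real (R\<^sup>2 - (norm w)\<^sup>2) \<noteq> 0"
      using \<open>R\<^sup>2 \<noteq> (norm w)\<^sup>2\<close> by (simp only: of_real_eq_0_iff right_minus_eq not_False_eq_True)
    ultimately show ?thesis unfolding k_def by (simp only: divide_self not_False_eq_True)
  qed
  then have gw: "g w = f w" by (simp add: g_def)
  \<comment> \<open>The Cauchy kernel \<open>u / (u - w)\<close> has its pole inside the circle, but
    on the circle it is the conjugate of \<open>d\<close>, which is holomorphic throughout the disc
    and equals 1 at the origin. Hence its mean is 1.\<close>
  define d where "d = (\<lambda>u. of_real (R\<^sup>2) / (of_real (R\<^sup>2) - cnj w * u))"
  have d: "d holomorphic_on ball 0 S'"
    unfolding d_def using dn by (intro holomorphic_intros) auto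
  have cnj_u: "of_real (R\<^sup>2) - cnj w * u = u * cnj (u - w)" if "norm u = R" for u
    using that by (simp add: algebra_simps complex_norm_square[symmetric])
  have ne: "u \<noteq> w" if "norm u = R" for u using that w by auto
  have "(\<integral>\<zeta>. d (of_real R * \<zeta>) \<partial>circle_measure) = 1"
    using integral_circle_mean_value[OF d, of R] R S' by (simp add: d_def)
  then have "(\<integral>\<zeta>. cnj (d (of_real R * \<zeta>)) \<partial>circle_measure) = 1"
    by (simp only: Bochner_Integration.integral_cnj complex_cnj_one)
  moreover have "(\<integral>\<zeta>. cnj (d (of_real R * \<zeta>)) \<partial>circle_measure)
      = (\<integral>\<zeta>. of_real R * \<zeta> / (of_real R * \<zeta> - w) \<partial>circle_measure)"
  proof (rule Bochner_Integration.integral_cong[OF refl])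
    fix \<zeta> assume "\<zeta> \<in> space circle_measure"
    then have u: "norm (of_real R * \<zeta>) = R" using R by (simp add: norm_mult)
    have R2: "complex_of_real (R\<^sup>2) = (of_real R * \<zeta>) * cnj (of_real R * \<zeta>)"
      using u by (metis complex_norm_square of_real_power)
    have nz: "of_real R * \<zeta> \<noteq> 0" using u R by auto
    show "cnj (d (of_real R * \<zeta>)) = of_real R * \<zeta> / (of_real R * \<zeta> - w)"
      unfolding d_def cnj_u[OF u] unfolding R2 using nz ne[OF u] by simp
  qed
  ultimately have one: "(\<integral>\<zeta>. of_real R * \<zeta> / (of_real R * \<zeta> - w) \<partial>circle_measure) = 1" by simp
  have "of_real (poisson R w \<zeta>) * f (of_real R * \<zeta>)
      = q (of_real R * \<zeta>) * (of_real R * \<zeta>) + f w * (of_real R * \<zeta> / (of_real R * \<zeta> - w))"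
    if "\<zeta> \<in> space circle_measure" for \<zeta>
  proof -
    define u where "u = of_real R * \<zeta>"
    have u: "norm u = R" using that R by (simp add: u_def norm_mult)
    have nz: "u \<noteq> 0" "u - w \<noteq> 0" using u R ne[OF u] by auto
    have "q u * u + f w * (u / (u - w)) = g u * u / (u - w)"
    proof -
      have "q u * u + f w * (u / (u - w)) = ((g u - g w) * u + g w * u) / (u - w)"
        using ne[OF u] by (simp add: q_def gw add_divide_distrib)
      then show ?thesis by (simp add: left_diff_distrib)
    qed
    also have "\<dots> = f u * (of_real (R\<^sup>2 - (norm w)\<^sup>2) / ((u - w) * cnj (u - w)))"
      unfolding g_def k_def cnj_u[OF u] using nz by simp
    also have "(u - w) * cnj (u - w) = of_real ((norm (u - w))\<^sup>2)"
      by (metis complex_norm_square of_real_power)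
    finally show ?thesis by (simp add: poisson_def u_def mult.commute)
  qed
  then have "(\<integral>\<zeta>. of_real (poisson R w \<zeta>) * f (of_real R * \<zeta>) \<partial>circle_measure)
     = (\<integral>\<zeta>. q (of_real R * \<zeta>) * (of_real R * \<zeta>) + f w * (of_real R * \<zeta> / (of_real R * \<zeta> - w)) \<partial>circle_measure)"
    by (intro Bochner_Integration.integral_cong) auto
  also have "\<dots> = (\<integral>\<zeta>. q (of_real R * \<zeta>) * (of_real R * \<zeta>) \<partial>circle_measure)
     + (\<integral>\<zeta>. f w * (of_real R * \<zeta> / (of_real R * \<zeta> - w)) \<partial>circle_measure)"
  proof (intro Bochner_Integration.integral_add integrable_circle_continuous)
    have "continuous_on (ball 0 S') (\<lambda>u. q u * u)" using q holomorphic_on_imp_continuous_on by blast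
    then show "continuous_on (sphere 0 1) (\<lambda>\<zeta>. q (of_real R * \<zeta>) * (of_real R * \<zeta>))"
      by (rule continuous_on_compose2) (use R S' in \<open>auto intro!: continuous_intros simp: norm_mult\<close>)
    show "continuous_on (sphere 0 1) (\<lambda>\<zeta>. f w * (of_real R * \<zeta> / (of_real R * \<zeta> - w)))"
      using norm_circle_diff(1)[OF _ R(1) w] w by (intro continuous_intros ballI) force
  qed
  also have "(\<integral>\<zeta>. q (of_real R * \<zeta>) * (of_real R * \<zeta>) \<partial>circle_measure) = 0"
    using integral_circle_mean_value[OF q, of R] R S' by simp
  also have "(\<integral>\<zeta>. f w * (of_real R * \<zeta> / (of_real R * \<zeta> - w)) \<partial>circle_measure) = f w"
    by (simp only: Bochner_Integration.integral_mult_right_zero one mult_1_right)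
  finally show ?thesis by simp
qed

lemma integral_poisson:
  assumes "0 < R" "norm w < R"
  shows "(\<integral>\<zeta>. poisson R w \<zeta> \<partial>circle_measure) = 1"
proof -
  have int: "integrable circle_measure (\<lambda>\<zeta>. complex_of_real (poisson R w \<zeta>))"
    by (intro integrable_circle_continuous continuous_intros continuous_on_poisson assms)
  have "(\<integral>\<zeta>. complex_of_real (poisson R w \<zeta>) \<partial>circle_measure) = 1"
    using poisson_formula[of "\<lambda>_. 1" "R + 1" R w] assms by simp
  then show ?thesis using integral_Re[OF int] by simp
qed

text \<open>In its first argument the Poisson kernel is the real part of a holomorphic function.\<close>

lemma poisson_mean_value:
  assumes \<phi>: "\<phi> holomorphic_on ball 0 S" and r: "0 \<le> r" "r < S"
    and R: "0 < R" and lt: "\<And>z. norm z < S \<Longrightarrow> norm (\<phi> z) < R" and \<zeta>: "norm \<zeta> = 1"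
  shows "(\<integral>\<xi>. poisson R (\<phi> (of_real r * \<xi>)) \<zeta> \<partial>circle_measure) = poisson R (\<phi> 0) \<zeta>"
    and "integrable circle_measure (\<lambda>\<xi>. poisson R (\<phi> (of_real r * \<xi>)) \<zeta>)"
proof -
  define h where "h = (\<lambda>z. (of_real R * \<zeta> + \<phi> z) / (of_real R * \<zeta> - \<phi> z))"
  have ne: "of_real R * \<zeta> - \<phi> z \<noteq> 0" if "norm z < S" for z
  proof -
    have "0 < norm (of_real R * \<zeta> - \<phi> z)"
      using norm_circle_diff(1)[OF \<zeta> R lt[OF that]] lt[OF that] by linarith
    then show ?thesis by (simp only: zero_less_norm_iff not_False_eq_True)
  qed
  have h: "h holomorphic_on ball 0 S"
    unfolding h_def using ne by (intro holomorphic_intros \<phi>) auto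
  have Re_h: "Re (h z) = poisson R (\<phi> z) \<zeta>" if "norm z < S" for z
  proof -
    define u where "u = of_real R * \<zeta>"
    have "h z = (u + \<phi> z) * cnj (u - \<phi> z) / ((u - \<phi> z) * cnj (u - \<phi> z))"
    proof -
      have "cnj (u - \<phi> z) \<noteq> 0" using ne[OF that] unfolding u_def by (simp only: complex_cnj_zero_iff not_False_eq_True)
      from nonzero_mult_divide_mult_cancel_right[OF this, of "u + \<phi> z" "u - \<phi> z"]
      show ?thesis by (simp only: h_def u_def)
    qed
    also have "(u - \<phi> z) * cnj (u - \<phi> z) = of_real ((norm (u - \<phi> z))\<^sup>2)"
      by (metis complex_norm_square of_real_power)
    finally have "Re (h z) = Re ((u + \<phi> z) * cnj (u - \<phi> z) / of_real ((norm (u - \<phi> z))\<^sup>2))"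
      by (rule arg_cong)
    also have "\<dots> = Re ((u + \<phi> z) * cnj (u - \<phi> z)) / (norm (u - \<phi> z))\<^sup>2"
      by (rule Re_divide_of_real)
    also have "Re ((u + \<phi> z) * cnj (u - \<phi> z)) = (norm u)\<^sup>2 - (norm (\<phi> z))\<^sup>2"
      by (rule Re_add_mult_cnj_diff)
    also have "norm u = R" using \<zeta> R by (simp add: u_def norm_mult)
    finally show ?thesis by (simp only: poisson_def u_def)
  qed
  have "continuous_on (sphere 0 1) (\<lambda>\<xi>. h (of_real r * \<xi>))"
    by (rule continuous_on_compose2[OF holomorphic_on_imp_continuous_on[OF h]])
       (use r in \<open>auto intro!: continuous_intros simp: norm_mult\<close>)
  then have int: "integrable circle_measure (\<lambda>\<xi>. h (of_real r * \<xi>))"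
    by (rule integrable_circle_continuous)
  have eq: "Re (h (of_real r * \<xi>)) = poisson R (\<phi> (of_real r * \<xi>)) \<zeta>" if "\<xi> \<in> space circle_measure" for \<xi>
    using that r by (intro Re_h) (auto simp: norm_mult)
  show "integrable circle_measure (\<lambda>\<xi>. poisson R (\<phi> (of_real r * \<xi>)) \<zeta>)"
    by (rule Bochner_Integration.integrable_cong[OF refl, THEN iffD1, OF eq integrable_Re[OF int]])
  have "(\<integral>\<xi>. poisson R (\<phi> (of_real r * \<xi>)) \<zeta> \<partial>circle_measure) = (\<integral>\<xi>. Re (h (of_real r * \<xi>)) \<partial>circle_measure)"
    by (rule Bochner_Integration.integral_cong) (auto simp: eq)
  also have "\<dots> = Re (h 0)"
    using integral_Re[OF int] integral_circle_mean_value[OF h, of r] r by simp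
  also have "\<dots> = poisson R (\<phi> 0) \<zeta>" by (rule Re_h) (use r in simp)
  finally show "(\<integral>\<xi>. poisson R (\<phi> (of_real r * \<xi>)) \<zeta> \<partial>circle_measure) = poisson R (\<phi> 0) \<zeta>" .
qed

text \<open>The lower kernel bound compares the Poisson integral at \<open>z\<close> with the plain
  mean, whose real part is \<open>Re (h 0)\<close>. Since \<open>h\<close> need not extend to the
  boundary, this is done on circles of radius \<open>R < 1\<close> before \<open>R\<close> tends to
  1.\<close>

lemma harnack:
  assumes h: "h holomorphic_on ball 0 1" and pos: "\<And>z. norm z < 1 \<Longrightarrow> 0 \<le> Re (h z)" and z: "norm z < 1"
  shows "(1 - norm z) / (1 + norm z) * Re (h 0) \<le> Re (h z)"
proof -
  have R: "(R - norm z) / (R + norm z) * Re (h 0) \<le> Re (h z)" if R: "norm z < R" "R < 1" for R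
  proof -
    have R0: "0 < R" using R norm_ge_zero[of z] by linarith
    have c: "continuous_on (sphere 0 1) (\<lambda>\<zeta>. h (of_real R * \<zeta>))"
      by (rule continuous_on_compose2[OF holomorphic_on_imp_continuous_on[OF h]])
         (use R0 R in \<open>auto intro!: continuous_intros simp: norm_mult\<close>)
    have int: "integrable circle_measure (\<lambda>\<zeta>. h (of_real R * \<zeta>))"
      "integrable circle_measure (\<lambda>\<zeta>. of_real (poisson R z \<zeta>) * h (of_real R * \<zeta>))"
      by (intro integrable_circle_continuous continuous_intros c continuous_on_poisson R0 R)+
    have "(R - norm z) / (R + norm z) * Re (h 0) = (\<integral>\<zeta>. (R - norm z) / (R + norm z) * Re (h (of_real R * \<zeta>)) \<partial>circle_measure)"
      using integral_Re[OF int(1)] integral_circle_mean_value[OF h, of R] R0 R by simp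
    also have "\<dots> \<le> (\<integral>\<zeta>. Re (of_real (poisson R z \<zeta>) * h (of_real R * \<zeta>)) \<partial>circle_measure)"
    proof (rule integral_mono)
      show "integrable circle_measure (\<lambda>\<zeta>. (R - norm z) / (R + norm z) * Re (h (of_real R * \<zeta>)))"
        using integrable_Re[OF int(1)] by (rule integrable_mult_right)
      show "integrable circle_measure (\<lambda>\<zeta>. Re (of_real (poisson R z \<zeta>) * h (of_real R * \<zeta>)))"
        by (rule integrable_Re[OF int(2)])
      fix \<zeta> assume "\<zeta> \<in> space circle_measure"
      then have "norm \<zeta> = 1" by simp
      then have "0 \<le> Re (h (of_real R * \<zeta>))" using R0 R by (intro pos) (simp add: norm_mult)
      then have "(R - norm z) / (R + norm z) * Re (h (of_real R * \<zeta>)) \<le> poisson R z \<zeta> * Re (h (of_real R * \<zeta>))"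
        using poisson_ge[OF \<open>norm \<zeta> = 1\<close> R0 R(1)] by (rule mult_right_mono[rotated])
      then show "(R - norm z) / (R + norm z) * Re (h (of_real R * \<zeta>)) \<le> Re (of_real (poisson R z \<zeta>) * h (of_real R * \<zeta>))"
        by simp
    qed
    also have "\<dots> = Re (h z)"
      using integral_Re[OF int(2)] poisson_formula[OF h R0 R(2,1)] by simp
    finally show ?thesis .
  qed
  have "((\<lambda>R. (R - norm z) / (R + norm z) * Re (h 0)) \<longlongrightarrow> (1 - norm z) / (1 + norm z) * Re (h 0)) (at_left 1)"
    using norm_ge_zero[of z] by (intro tendsto_intros) linarith
  moreover have "eventually (\<lambda>R. (R - norm z) / (R + norm z) * Re (h 0) \<le> Re (h z)) (at_left 1)"
    using eventually_at_left_real[OF z] by eventually_elim (use R in auto)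
  ultimately show ?thesis by (rule tendsto_upperbound) simp
qed

text \<open>Harnack's inequality is applied to \<open>1 - cnj \<eta> * \<phi>\<close> with \<eta>
  the direction of \<open>\<phi> z\<close>: its real part is nonnegative and equals
  \<open>1 - norm (\<phi> z)\<close> at \<open>z\<close>. The factor 1/2 comes from
  \<open>1 + norm z \<le> 2\<close>. This quantitative form stands in for the Schwarz-Pick
  lemma.\<close>

lemma self_map_boundary_distance:
  assumes \<phi>: "\<phi> holomorphic_on ball 0 1" "\<phi> ` ball 0 1 \<subseteq> ball 0 1" and z: "norm z < 1"
  shows "(1 - norm (\<phi> 0)) * (1 - norm z) / 2 \<le> 1 - norm (\<phi> z)"
proof -
  define \<eta> where "\<eta> = sgn (\<phi> z)"
  have lt: "norm (\<phi> u) < 1" if "norm u < 1" for u using \<phi>(2) that by (auto simp: image_subset_iff)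
  have \<eta>: "norm \<eta> \<le> 1" "cnj \<eta> * \<phi> z = of_real (norm (\<phi> z))"
  proof -
    show "norm \<eta> \<le> 1" by (simp add: \<eta>_def norm_sgn)
    have "cnj \<eta> * \<phi> z = cnj (\<phi> z) * \<phi> z / of_real (norm (\<phi> z))"
      by (simp only: \<eta>_def sgn_eq complex_cnj_divide complex_cnj_complex_of_real times_divide_eq_left)
    also have "cnj (\<phi> z) * \<phi> z = of_real ((norm (\<phi> z))\<^sup>2)"
      by (simp only: complex_norm_square mult.commute)
    also have "of_real ((norm (\<phi> z))\<^sup>2) / of_real (norm (\<phi> z)) = complex_of_real (norm (\<phi> z))"
      by (simp add: power2_eq_square)
    finally show "cnj \<eta> * \<phi> z = of_real (norm (\<phi> z))" .
  qed
  have *: "Re (cnj \<eta> * \<phi> u) \<le> norm (\<phi> u)" for u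
    using complex_Re_le_cmod[of "cnj \<eta> * \<phi> u"] mult_right_mono[OF \<eta>(1) norm_ge_zero[of "\<phi> u"]]
    by (simp only: norm_mult complex_mod_cnj mult_1)
  have "(1 - norm z) / (1 + norm z) * Re (1 - cnj \<eta> * \<phi> 0) \<le> Re (1 - cnj \<eta> * \<phi> z)"
  proof (rule harnack[OF _ _ z])
    show "(\<lambda>z. 1 - cnj \<eta> * \<phi> z) holomorphic_on ball 0 1" by (intro holomorphic_intros \<phi>)
    show "0 \<le> Re (1 - cnj \<eta> * \<phi> u)" if "norm u < 1" for u using *[of u] lt[OF that] by simp
  qed
  also have "Re (1 - cnj \<eta> * \<phi> z) = 1 - norm (\<phi> z)" by (simp add: \<eta>(2))
  finally have 1: "(1 - norm z) / (1 + norm z) * Re (1 - cnj \<eta> * \<phi> 0) \<le> 1 - norm (\<phi> z)" .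
  have "(1 - norm z) / 2 * (1 - norm (\<phi> 0)) \<le> (1 - norm z) / (1 + norm z) * Re (1 - cnj \<eta> * \<phi> 0)"
  proof (rule mult_mono)
    show "(1 - norm z) / 2 \<le> (1 - norm z) / (1 + norm z)"
      using z norm_ge_zero[of z] by (intro divide_left_mono mult_pos_pos) linarith+
  qed (use *[of 0] lt[of 0] z in auto)
  with 1 show ?thesis by (simp add: mult.commute)
qed

section \<open>Integral means and subordination\<close>

text \<open>Convexity of the power in the form of its tangent at \<open>a\<close>, from which both
  Jensen's and Minkowski's inequalities are obtained below. The derivative argument covers positive
  points; at 0 the convention \<open>0 powr p = 0\<close> makes the tangent vanish, also for
  \<open>p = 1\<close>.\<close>

lemma powr_tangent_le:
  fixes x a p :: real
  assumes "1 \<le> p" "0 \<le> x" "0 \<le> a"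
  shows "a powr p + p * a powr (p - 1) * (x - a) \<le> x powr p"
proof (cases "a = 0 \<or> x = 0")
  case True
  then show ?thesis
  proof
    assume "x = 0"
    then have "a powr p + p * a powr (p - 1) * (x - a) = (1 - p) * a powr p"
      using assms powr_mult_base[of a "p - 1"] by (simp add: algebra_simps)
    then show ?thesis using assms \<open>x = 0\<close> by (simp add: mult_nonpos_nonneg)
  qed (use assms in auto)
next
  case False
  have "(p * a powr (p - 1)) * (x - a) \<le> x powr p - a powr p"
  proof (rule f''_imp_f'[where C="{0<..}" and f''="\<lambda>x. p * (p - 1) * x powr (p - 2)"])
    show "DERIV (\<lambda>x. x powr p) y :> p * y powr (p - 1)" if "y \<in> {0<..}" for y :: real
      using that by (auto intro!: derivative_eq_intros)
    show "DERIV (\<lambda>x. p * x powr (p - 1)) y :> p * (p - 1) * y powr (p - 2)" if "y \<in> {0<..}" for y :: real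
      using that by (auto intro!: derivative_eq_intros)
  qed (use assms False in auto)
  then show ?thesis by simp
qed

text \<open>Jensen for the probability density \<open>k\<close>. The tangent is taken at
  \<open>A\<close>, the modulus of the integral, rather than at the mean of the moduli; as
  \<open>A\<close> is the smaller of the two and the slope is nonnegative, the discrepancy has the
  right sign.\<close>

lemma norm_integral_powr_le:
  fixes g :: "'a \<Rightarrow> complex" and k :: "'a \<Rightarrow> real"
  assumes p: "1 \<le> p" and k: "integrable M k" "(\<integral>x. k x \<partial>M) = 1" "\<And>x. x \<in> space M \<Longrightarrow> 0 \<le> k x"
    and kg: "integrable M (\<lambda>x. of_real (k x) * g x)"
    and kgp: "integrable M (\<lambda>x. k x * norm (g x) powr p)"
  shows "norm (\<integral>x. of_real (k x) * g x \<partial>M) powr p \<le> (\<integral>x. k x * norm (g x) powr p \<partial>M)"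
proof -
  define A where "A = norm (\<integral>x. of_real (k x) * g x \<partial>M)"
  have int: "integrable M (\<lambda>x. k x * norm (g x))"
  proof -
    have "integrable M (\<lambda>x. norm (of_real (k x) * g x))" using kg by simp
    then show ?thesis
      by (rule Bochner_Integration.integrable_cong[THEN iffD1, rotated -1]) (use k in \<open>auto simp: norm_mult\<close>)
  qed
  have "A \<le> (\<integral>x. norm (of_real (k x) * g x) \<partial>M)" unfolding A_def by (rule integral_norm_bound)
  also have "\<dots> = (\<integral>x. k x * norm (g x) \<partial>M)"
    by (rule Bochner_Integration.integral_cong) (use k in \<open>auto simp: norm_mult\<close>)
  finally have A: "0 \<le> (\<integral>x. k x * norm (g x) \<partial>M) - A" by simp
  define c where "c = p * A powr (p - 1)"
  have "A powr p \<le> A powr p + c * ((\<integral>x. k x * norm (g x) \<partial>M) - A)"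
    using A p by (simp add: c_def)
  also have "\<dots> = (\<integral>x. (A powr p - c * A) * k x + c * (k x * norm (g x)) \<partial>M)"
    using k int by (simp add: algebra_simps)
  also have "\<dots> \<le> (\<integral>x. k x * norm (g x) powr p \<partial>M)"
  proof (rule integral_mono)
    fix x assume "x \<in> space M"
    then have "k x * (A powr p + c * (norm (g x) - A)) \<le> k x * norm (g x) powr p"
      using powr_tangent_le[OF p norm_ge_zero, of A "g x"] k
      by (intro mult_left_mono) (auto simp: c_def A_def)
    then show "(A powr p - c * A) * k x + c * (k x * norm (g x)) \<le> k x * norm (g x) powr p"
      by (simp add: algebra_simps)
  qed (use k int kgp in auto)
  finally show ?thesis by (simp add: A_def)
qed

text \<open>The \<open>p\<close>-th power of the usual integral mean. Leaving out the root and
  taking values in \<open>ennreal\<close> allows integration over radii and Tonelli without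
  integrability conditions.\<close>

definition circle_mean :: "real \<Rightarrow> (complex \<Rightarrow> complex) \<Rightarrow> real \<Rightarrow> ennreal" where
  "circle_mean p f r = (\<integral>\<^sup>+\<zeta>. ennreal (norm (f (of_real r * \<zeta>)) powr p) \<partial>circle_measure)"

lemma continuous_on_circle_powr:
  assumes f: "f holomorphic_on ball 0 1" and R: "0 \<le> R" "R < 1" and p: "0 < p"
  shows "continuous_on (sphere 0 1) (\<lambda>\<zeta>. norm (f (of_real R * \<zeta>)) powr p)"
proof (rule continuous_on_powr')
  show "continuous_on (sphere 0 1) (\<lambda>\<zeta>. norm (f (of_real R * \<zeta>)))"
    by (intro continuous_on_norm continuous_on_compose2[OF holomorphic_on_imp_continuous_on[OF f]])
       (use R in \<open>auto intro!: continuous_intros simp: norm_mult\<close>)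
qed (use p in \<open>auto intro: continuous_intros\<close>)

lemma circle_mean_finite:
  assumes "f holomorphic_on ball 0 1" "0 \<le> R" "R < 1" "0 < p"
  shows "circle_mean p f R < \<infinity>"
proof -
  have "integrable circle_measure (\<lambda>\<zeta>. norm (f (of_real R * \<zeta>)) powr p)"
    by (intro integrable_circle_continuous continuous_on_circle_powr assms)
  then show ?thesis by (simp add: circle_mean_def integrable_iff_bounded)
qed

text \<open>With the kernel as probability density, Jensen shows that the subharmonic function
  \<open>|f|^p\<close> lies below its Poisson integral.\<close>

lemma holomorphic_powr_le_poisson:
  assumes p: "1 \<le> p" and f: "f holomorphic_on ball 0 1" and R: "0 < R" "R < 1" and w: "norm w < R"
  shows "ennreal (norm (f w) powr p)
    \<le> (\<integral>\<^sup>+\<zeta>. ennreal (poisson R w \<zeta>) * ennreal (norm (f (of_real R * \<zeta>)) powr p) \<partial>circle_measure)"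
proof -
  note c = continuous_on_poisson[OF R(1) w]
  have cf: "continuous_on (sphere 0 1) (\<lambda>\<zeta>. f (of_real R * \<zeta>))"
    by (rule continuous_on_compose2[OF holomorphic_on_imp_continuous_on[OF f]])
       (use R in \<open>auto intro!: continuous_intros simp: norm_mult\<close>)
  have int: "integrable circle_measure (\<lambda>\<zeta>. poisson R w \<zeta> * norm (f (of_real R * \<zeta>)) powr p)"
    using p R by (intro integrable_circle_continuous continuous_intros c continuous_on_circle_powr f) auto
  have "norm (f w) powr p \<le> (\<integral>\<zeta>. poisson R w \<zeta> * norm (f (of_real R * \<zeta>)) powr p \<partial>circle_measure)"
    using norm_integral_powr_le[OF p, of circle_measure "poisson R w" "\<lambda>\<zeta>. f (of_real R * \<zeta>)"]
      integrable_circle_continuous[OF c] integral_poisson[OF R(1) w] poisson_nonneg[of w R] w int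
      integrable_circle_continuous[OF continuous_on_mult[OF continuous_on_of_real[OF c] cf]]
    by (simp add: poisson_formula[OF f R w])
  then have "ennreal (norm (f w) powr p) \<le> ennreal (\<integral>\<zeta>. poisson R w \<zeta> * norm (f (of_real R * \<zeta>)) powr p \<partial>circle_measure)"
    by (rule ennreal_leI)
  also have "\<dots> = (\<integral>\<^sup>+\<zeta>. ennreal (poisson R w \<zeta> * norm (f (of_real R * \<zeta>)) powr p) \<partial>circle_measure)"
    using w by (intro nn_integral_eq_integral[symmetric] int AE_I2 mult_nonneg_nonneg poisson_nonneg) auto
  also have "\<dots> = (\<integral>\<^sup>+\<zeta>. ennreal (poisson R w \<zeta>) * ennreal (norm (f (of_real R * \<zeta>)) powr p) \<partial>circle_measure)"
    using w by (intro nn_integral_cong) (auto simp: ennreal_mult poisson_nonneg)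
  finally show ?thesis .
qed

text \<open>Littlewood subordination without the normalisation \<open>\<phi> 0 = 0\<close>.\<close>

lemma circle_mean_compose_le:
  assumes p: "1 \<le> p" and f: "f holomorphic_on ball 0 1" and R: "0 < R" "R < 1"
    and \<phi>: "\<phi> holomorphic_on ball 0 S" and r: "0 \<le> r" "r < S"
    and lt: "\<And>z. norm z < S \<Longrightarrow> norm (\<phi> z) < R"
  shows "circle_mean p (\<lambda>z. f (\<phi> z)) r \<le> ennreal ((R + norm (\<phi> 0)) / (R - norm (\<phi> 0))) * circle_mean p f R"
proof -
  let ?C = "circle_measure"
  have \<phi>r: "norm (\<phi> (of_real r * \<xi>)) < R" if "\<xi> \<in> sphere 0 1" for \<xi>
    using that r by (intro lt) (simp add: norm_mult)
  have "continuous_on (sphere 0 1) (\<lambda>\<xi>. \<phi> (of_real r * \<xi>))"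
    by (rule continuous_on_compose2[OF holomorphic_on_imp_continuous_on[OF \<phi>]])
       (use r in \<open>auto intro!: continuous_intros simp: norm_mult\<close>)
  then have m[measurable]: "(\<lambda>\<xi>. \<phi> (of_real r * \<xi>)) \<in> borel_measurable ?C"
    by (rule borel_measurable_circle_continuous)
  have mid[measurable]: "(\<lambda>\<zeta>. \<zeta>) \<in> ?C \<rightarrow>\<^sub>M borel"
    by (intro borel_measurable_circle_continuous continuous_intros)
  have mf[measurable]: "(\<lambda>\<zeta>. norm (f (of_real R * \<zeta>)) powr p) \<in> borel_measurable ?C"
    using p R by (intro borel_measurable_circle_continuous continuous_on_circle_powr f) auto
  have mP[measurable]: "(\<lambda>x. poisson R (\<phi> (of_real r * fst x)) (snd x)) \<in> borel_measurable (?C \<Otimes>\<^sub>M ?C)"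
  proof -
    have [measurable]: "(\<lambda>x. \<phi> (of_real r * fst x)) \<in> borel_measurable (?C \<Otimes>\<^sub>M ?C)"
      by (rule measurable_compose[OF measurable_fst m])
    have [measurable]: "snd \<in> borel_measurable (?C \<Otimes>\<^sub>M ?C)"
      by (rule measurable_compose[OF measurable_snd mid])
    show ?thesis unfolding poisson_def by measurable
  qed
  have mF: "(\<lambda>(\<zeta>, \<xi>). ennreal (poisson R (\<phi> (of_real r * \<xi>)) \<zeta>) * ennreal (norm (f (of_real R * \<zeta>)) powr p))
     \<in> borel_measurable (?C \<Otimes>\<^sub>M ?C)"
    using measurable_compose[OF measurable_pair_swap' mP] measurable_compose[OF measurable_fst mf]
    by (auto simp: case_prod_unfold intro!: borel_measurable_times_ennreal)
  interpret CC: pair_sigma_finite ?C ?C ..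
  \<comment> \<open>For fixed \<zeta> the kernel is harmonic in the composed variable, so averaging
    over \<xi> first leaves its value at \<open>\<phi> 0\<close>. This is why the map enters the
    constant only through the modulus of \<open>\<phi> 0\<close>.\<close>
  have P: "(\<integral>\<^sup>+\<xi>. ennreal (poisson R (\<phi> (of_real r * \<xi>)) \<zeta>) \<partial>?C) \<le> ennreal ((R + norm (\<phi> 0)) / (R - norm (\<phi> 0)))"
    if "\<zeta> \<in> sphere 0 1" for \<zeta>
  proof -
    have \<zeta>: "norm \<zeta> = 1" using that by simp
    have "(\<integral>\<^sup>+\<xi>. ennreal (poisson R (\<phi> (of_real r * \<xi>)) \<zeta>) \<partial>?C) = ennreal (\<integral>\<xi>. poisson R (\<phi> (of_real r * \<xi>)) \<zeta> \<partial>?C)"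
      using \<phi>r by (intro nn_integral_eq_integral poisson_mean_value(2)[OF \<phi> r R(1) lt \<zeta>] AE_I2 poisson_nonneg)
        (auto intro: less_imp_le)
    also have "\<dots> = ennreal (poisson R (\<phi> 0) \<zeta>)"
      using poisson_mean_value(1)[OF \<phi> r R(1) lt \<zeta>] by simp
    finally show ?thesis using poisson_le[OF \<zeta> R(1) lt[of 0]] r by (auto intro: ennreal_leI)
  qed
  have "circle_mean p (\<lambda>z. f (\<phi> z)) r \<le>
      (\<integral>\<^sup>+\<xi>. \<integral>\<^sup>+\<zeta>. ennreal (poisson R (\<phi> (of_real r * \<xi>)) \<zeta>) * ennreal (norm (f (of_real R * \<zeta>)) powr p) \<partial>?C \<partial>?C)"
    unfolding circle_mean_def using \<phi>r
    by (intro nn_integral_mono holomorphic_powr_le_poisson p f R) auto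
  also have "\<dots> = (\<integral>\<^sup>+\<zeta>. \<integral>\<^sup>+\<xi>. ennreal (poisson R (\<phi> (of_real r * \<xi>)) \<zeta>) * ennreal (norm (f (of_real R * \<zeta>)) powr p) \<partial>?C \<partial>?C)"
    using CC.Fubini'[OF mF] by simp
  also have "\<dots> = (\<integral>\<^sup>+\<zeta>. (\<integral>\<^sup>+\<xi>. ennreal (poisson R (\<phi> (of_real r * \<xi>)) \<zeta>) \<partial>?C) * ennreal (norm (f (of_real R * \<zeta>)) powr p) \<partial>?C)"
    using poisson_mean_value(2)[OF \<phi> r R(1) lt]
    by (intro nn_integral_cong nn_integral_multc measurable_compose[OF _ measurable_ennreal]
        borel_measurable_integrable) auto
  also have "\<dots> \<le> (\<integral>\<^sup>+\<zeta>. ennreal ((R + norm (\<phi> 0)) / (R - norm (\<phi> 0))) * ennreal (norm (f (of_real R * \<zeta>)) powr p) \<partial>?C)"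
    using P by (intro nn_integral_mono mult_right_mono) auto
  also have "\<dots> = ennreal ((R + norm (\<phi> 0)) / (R - norm (\<phi> 0))) * circle_mean p f R"
    unfolding circle_mean_def by (rule nn_integral_cmult) measurable
  finally show ?thesis .
qed

text \<open>The identity maps the disc of radius \<open>R\<close> to itself and fixes 0, so the
  factor in the subordination inequality is 1.\<close>

lemma circle_mean_mono:
  assumes "1 \<le> p" "f holomorphic_on ball 0 1" "0 \<le> r" "r \<le> R" "R < 1"
  shows "circle_mean p f r \<le> circle_mean p f R"
proof (cases "r = R")
  case False
  then show ?thesis
    using circle_mean_compose_le[of p f R "\<lambda>z. z" R r] assms by auto
qed simp

text \<open>Subordination for the constant map with value \<open>w\<close>: the left side becomes
  the mean of a constant, and the factor becomes Harnack's.\<close>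

lemma powr_le_circle_mean:
  assumes "1 \<le> p" "f holomorphic_on ball 0 1" "norm w < R" "R < 1"
  shows "ennreal (norm (f w) powr p) \<le> ennreal ((R + norm w) / (R - norm w)) * circle_mean p f R"
proof -
  have R: "0 < R" using assms(3) norm_ge_zero[of w] by linarith
  then have "circle_mean p (\<lambda>z. f w) 0 \<le> ennreal ((R + norm w) / (R - norm w)) * circle_mean p f R"
    using circle_mean_compose_le[of p f R "\<lambda>_. w" 1 0] assms by simp
  then show ?thesis by (simp add: circle_mean_def circle.emeasure_space_1[simplified])
qed

section \<open>Radial profiles of weights\<close>

text \<open>Polar coordinates for radial integrands only. The image of area under the modulus and
  the measure with density \<open>2 * pi * s\<close> agree on half-lines, where both give the area
  of an annulus, and half-lines determine such measures.\<close>

lemma nn_integral_disc_radial: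
  fixes h :: "real \<Rightarrow> ennreal"
  assumes [measurable]: "h \<in> borel_measurable borel"
  shows "(\<integral>\<^sup>+z. h (norm z) * indicator (ball 0 1) z \<partial>(lborel :: complex measure))
    = (\<integral>\<^sup>+s. h s * ennreal (2 * pi * s) * indicator {0..1} s \<partial>lborel)"
proof -
  have [measurable]: "ball 0 1 \<in> sets (borel :: complex measure)" by simp
  define M where "M = distr (density (lborel :: complex measure) (indicator (ball 0 1))) borel norm"
  define N where "N = density lborel (\<lambda>s::real. ennreal (2 * pi * s) * indicator {0..1} s)"
  have M: "emeasure M {x<..} = ennreal (pi - pi * (min 1 (max 0 x))\<^sup>2)" for x
  proof -
    define y where "y = min 1 (max 0 x)"
    have y: "0 \<le> y" "y \<le> 1" by (auto simp: y_def)
    have cb: "emeasure lborel (cball 0 y :: complex set) = ennreal (pi * y\<^sup>2)"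
      using y by (simp add: emeasure_cball unit_ball_vol_2)
    have "emeasure M {x<..} = emeasure lborel {z::complex. norm z < 1 \<and> x < norm z}"
    proof -
      have "emeasure M {x<..} = emeasure (density (lborel :: complex measure) (indicator (ball 0 1))) {z. x < norm z}"
        unfolding M_def by (subst emeasure_distr) (auto simp: vimage_def)
      also have "\<dots> = (\<integral>\<^sup>+z. indicator (ball 0 1) z * indicator {z. x < norm z} z \<partial>(lborel :: complex measure))"
        by (rule emeasure_density) (auto intro!: borel_measurable_indicator)
      also have "\<dots> = (\<integral>\<^sup>+z. indicator {z. norm z < 1 \<and> x < norm z} z \<partial>(lborel :: complex measure))"
        by (intro nn_integral_cong) (auto simp: indicator_def)
      finally show ?thesis by simp
    qed
    \<comment> \<open>Truncating \<open>x\<close> to \<open>y\<close> is harmless: for negative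
      \<open>x\<close> the two sets differ by the point 0, and for \<open>x\<close> above 1 both are
      empty.\<close>
    also have "\<dots> = emeasure lborel (ball 0 1 - cball 0 y :: complex set)"
    proof (cases "x < 0")
      case True
      have "emeasure lborel {z::complex. norm z < 1 \<and> x < norm z} = emeasure lborel (ball 0 1 :: complex set)"
        using True norm_ge_zero by (intro arg_cong2[where f=emeasure] refl) (auto intro: less_le_trans)
      moreover have "emeasure lborel (ball 0 1 - cball 0 y :: complex set)
          = emeasure lborel (ball 0 1 :: complex set) - emeasure lborel {0::complex}"
        using True by (subst emeasure_Diff[symmetric]) (auto simp: y_def)
      ultimately show ?thesis by simp
    next
      case False
      then show ?thesis
        by (intro arg_cong2[where f=emeasure] refl) (auto simp: y_def min_def max_def)
    qed
    also have "\<dots> = ennreal (pi - pi * y\<^sup>2)"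
    proof (cases "y = 1")
      case True
      then have "ball 0 1 - cball 0 y = ({} :: complex set)" by auto
      then show ?thesis by (simp only: True) simp
    next
      case False
      have "emeasure lborel (ball 0 1 - cball 0 y :: complex set) = ennreal pi - ennreal (pi * y\<^sup>2)"
        using y False by (subst emeasure_Diff) (auto simp: cb emeasure_unit_disc)
      then show ?thesis by (simp add: ennreal_minus)
    qed
    finally show ?thesis by (simp only: y_def)
  qed
  have N: "emeasure N {x<..} = ennreal (pi - pi * (min 1 (max 0 x))\<^sup>2)" for x
  proof -
    define y where "y = min 1 (max 0 x)"
    have y: "0 \<le> y" "y \<le> 1" by (auto simp: y_def)
    have "emeasure N {x<..} = (\<integral>\<^sup>+s. ennreal (2 * pi * s) * indicator {0..1} s * indicator {x<..} s \<partial>lborel)"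
      unfolding N_def by (subst emeasure_density) auto
    also have "\<dots> = (\<integral>\<^sup>+s. ennreal (2 * pi * s) * indicator {y..1} s \<partial>lborel)"
    proof (rule nn_integral_cong_AE)
      have "AE s in lborel. s \<noteq> y" "AE s in lborel. s \<noteq> x" by (rule AE_lborel_singleton)+
      then show "AE s in lborel. ennreal (2 * pi * s) * indicator {0..1} s * indicator {x<..} s
         = ennreal (2 * pi * s) * indicator {y..1} s"
        by eventually_elim (auto simp: y_def indicator_def min_def max_def)
    qed
    also have "\<dots> = ennreal (pi * 1\<^sup>2 - pi * y\<^sup>2)"
      by (rule nn_integral_FTC_Icc) (use y in \<open>auto intro!: derivative_eq_intros\<close>)
    finally show ?thesis by (simp add: y_def)
  qed
  have "M = N"
    by (rule measure_eqI_lessThan) (simp_all only: M N, auto simp: M_def N_def)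
  have "(\<integral>\<^sup>+z. h (norm z) * indicator (ball 0 1) z \<partial>(lborel :: complex measure)) = (\<integral>\<^sup>+s. h s \<partial>M)"
    unfolding M_def
    by (subst nn_integral_distr, measurable, subst nn_integral_density, measurable) (simp add: mult.commute)
  also have "\<dots> = (\<integral>\<^sup>+s. h s * ennreal (2 * pi * s) * indicator {0..1} s \<partial>lborel)"
    unfolding \<open>M = N\<close> unfolding N_def by (subst nn_integral_density) (auto simp: mult_ac)
  finally show ?thesis .
qed

lemma measurable_circle_id [measurable]: "(\<lambda>\<zeta>. \<zeta>) \<in> circle_measure \<rightarrow>\<^sub>M borel"
  by (intro borel_measurable_circle_continuous continuous_intros)

text \<open>The weight is only Lebesgue measurable on the disc, so its restriction to the radius is not
  measurable by composition; the profile is read off along a generic radius.\<close>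

lemma radial_weight_profile:
  assumes "radial_weight \<omega>"
  obtains w :: "real \<Rightarrow> real" where "w \<in> borel_measurable borel" "\<And>s. 0 \<le> w s"
    "AE z in lborel. z \<in> ball 0 1 \<longrightarrow> \<omega> z = w (norm z)"
    "AE s in lborel. 0 < s \<and> s < 1 \<longrightarrow> \<omega> (of_real s) = w s"
proof -
  have \<omega>: "0 \<le> \<omega> z" "\<omega> z = \<omega> (of_real (norm z))" if "norm z < 1" for z
    using assms that unfolding radial_weight_def mem_ball_0[symmetric] by blast+
  have "(\<lambda>z. indicator (ball 0 1) z *\<^sub>R \<omega> z) \<in> borel_measurable (completion lborel)"
    using assms unfolding radial_weight_def set_integrable_def by (intro borel_measurable_integrable) simp
  from completion_ex_borel_measurable_real[OF this]
  obtain g where g[measurable]: "g \<in> borel_measurable borel"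
    and "AE z in lborel. indicator (ball 0 1) z *\<^sub>R \<omega> z = g z" by auto
  then obtain N where N: "N \<in> null_sets lborel" and gN: "\<And>z. z \<notin> N \<Longrightarrow> indicator (ball 0 1) z *\<^sub>R \<omega> z = g z"
    by (force elim!: AE_E3)
  have [measurable]: "N \<in> sets borel" using N by auto
  have Nz: "(\<integral>\<^sup>+z. indicator N z \<partial>lborel) = 0" using N by auto
  have [measurable]: "ball 0 1 \<in> sets (borel :: complex measure)" by simp
  \<comment> \<open>\<open>n z\<close> is the proportion of the circle through \<open>z\<close> that
    lies in the null set \<open>N\<close>. It is radial, and it vanishes almost everywhere; Tonelli
    in polar form then gives a direction \<zeta> along which \<open>N\<close> meets the radius in a
    null set.\<close>
  define n where "n = (\<lambda>z::complex. \<integral>\<^sup>+\<zeta>. indicator N (\<zeta> * z) \<partial>circle_measure :: ennreal)"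
  interpret P: pair_sigma_finite circle_measure "lborel :: complex measure" ..
  interpret Q: pair_sigma_finite circle_measure "lborel :: real measure" ..
  have n_meas[measurable]: "n \<in> borel_measurable borel"
  proof -
    have "n \<in> borel_measurable lborel" unfolding n_def by measurable
    then show ?thesis by simp
  qed
  have n_norm: "n z = n (of_real (norm z))" for z
  proof (cases "z = 0")
    case False
    have "(\<integral>\<^sup>+\<zeta>. indicator N ((sgn z * \<zeta>) * of_real (norm z)) \<partial>circle_measure)
        = (\<integral>\<^sup>+\<zeta>. indicator N (\<zeta> * of_real (norm z)) \<partial>circle_measure :: ennreal)"
      by (rule nn_integral_circle_rotate[where g="\<lambda>\<zeta>. indicator N (\<zeta> * of_real (norm z))"])
         (use False in \<open>auto simp: norm_sgn\<close>)
    moreover have "(sgn z * \<zeta>) * of_real (norm z) = \<zeta> * z" for \<zeta>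
      using False by (simp add: sgn_eq)
    ultimately show ?thesis by (simp add: n_def)
  qed (simp add: n_def)
  have "(\<integral>\<^sup>+z. n z \<partial>lborel) = (\<integral>\<^sup>+\<zeta>. \<integral>\<^sup>+z. indicator N (\<zeta> * z) \<partial>lborel \<partial>circle_measure)"
    unfolding n_def by (rule P.Fubini') measurable
  also have "\<dots> = (\<integral>\<^sup>+\<zeta>. 0 \<partial>circle_measure)"
  proof (rule nn_integral_cong)
    fix \<zeta> assume "\<zeta> \<in> space circle_measure"
    then have "(\<integral>\<^sup>+z. indicator N (\<zeta> * z) \<partial>lborel) = (\<integral>\<^sup>+z. indicator N z \<partial>lborel :: ennreal)"
      by (intro nn_integral_rotate) auto
    then show "(\<integral>\<^sup>+z. indicator N (\<zeta> * z) \<partial>lborel) = (0::ennreal)" by (simp only: Nz)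
  qed
  finally have "(\<integral>\<^sup>+z. n z \<partial>lborel) = 0" by simp
  then have "AE z in lborel. n z = 0"
    by (subst (asm) nn_integral_0_iff_AE) auto
  then have "AE z in (lborel :: complex measure). n (of_real (norm z)) * indicator (ball 0 1) z = 0"
    by eventually_elim (metis n_norm mult_zero_left)
  then have "(\<integral>\<^sup>+z. n (of_real (norm z)) * indicator (ball 0 1) z \<partial>(lborel :: complex measure)) = 0"
    by (subst nn_integral_0_iff_AE) auto
  then have "(\<integral>\<^sup>+s. n (of_real s) * ennreal (2 * pi * s) * indicator {0..1} s \<partial>lborel) = 0"
    by (subst (asm) nn_integral_disc_radial[of "\<lambda>s. n (of_real s)"]) simp_all
  then have "AE s in lborel. n (of_real s) * ennreal (2 * pi * s) * indicator {0..1} s = 0"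
    by (subst (asm) nn_integral_0_iff_AE) auto
  then have "AE s in lborel. n (of_real s) * indicator {0<..<1} s = 0"
    by eventually_elim (auto simp: indicator_def split: if_splits)
  then have "0 = (\<integral>\<^sup>+s. n (of_real s) * indicator {0<..<1} s \<partial>lborel)"
    by (subst nn_integral_0_iff_AE[THEN iffD2]) auto
  also have "\<dots> = (\<integral>\<^sup>+s. \<integral>\<^sup>+\<zeta>. indicator N (\<zeta> * of_real s) * indicator {0<..<1} s \<partial>circle_measure \<partial>lborel)"
    unfolding n_def by (subst nn_integral_multc) auto
  also have "\<dots> = (\<integral>\<^sup>+\<zeta>. \<integral>\<^sup>+s. indicator N (\<zeta> * of_real s) * indicator {0<..<1} s \<partial>lborel \<partial>circle_measure)"
    by (rule Q.Fubini') measurable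
  finally have "AE \<zeta> in circle_measure. (\<integral>\<^sup>+s. indicator N (\<zeta> * of_real s) * indicator {0<..<1} s \<partial>lborel) = (0::ennreal)"
    by (subst (asm) eq_commute, subst (asm) nn_integral_0_iff_AE) auto
  moreover have "AE \<zeta> in circle_measure. norm \<zeta> = 1" by (intro AE_I2) auto
  ultimately have "AE \<zeta> in circle_measure. norm \<zeta> = 1 \<and> (\<integral>\<^sup>+s. indicator N (\<zeta> * of_real s) * indicator {0<..<1} s \<partial>lborel) = (0::ennreal)"
    by eventually_elim auto
  then have "\<exists>\<zeta>. norm \<zeta> = 1 \<and> (\<integral>\<^sup>+s. indicator N (\<zeta> * of_real s) * indicator {0<..<1} s \<partial>lborel) = (0::ennreal)"
    (is "\<exists>\<zeta>. ?P \<zeta>")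
  proof (rule contrapos_pp)
    assume "\<not> (\<exists>\<zeta>. ?P \<zeta>)"
    then have "?P = (\<lambda>_. False)" by blast
    then show "\<not> (AE \<zeta> in circle_measure. ?P \<zeta>)" by (simp only: circle.AE_False not_False_eq_True)
  qed
  then obtain \<zeta> where \<zeta>: "norm \<zeta> = 1" and "(\<integral>\<^sup>+s. indicator N (\<zeta> * of_real s) * indicator {0<..<1} s \<partial>lborel) = (0::ennreal)"
    by blast
  then have AE: "AE s in lborel. indicator N (\<zeta> * of_real s) * indicator {0<..<1} s = (0::ennreal)"
    by (subst (asm) nn_integral_0_iff_AE) auto
  \<comment> \<open>Truncation at 0 makes the profile nonnegative everywhere; where \<open>g\<close>
    represents the weight it changes nothing.\<close>
  define w where "w = (\<lambda>s. max 0 (g (\<zeta> * of_real s)))"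
  have w[measurable]: "w \<in> borel_measurable borel" unfolding w_def by measurable
  have AEs: "AE s in lborel. 0 < s \<and> s < 1 \<longrightarrow> \<omega> (of_real s) = w s"
    using AE
  proof eventually_elim
    case (elim s)
    show ?case
    proof
      assume s: "0 < s \<and> s < 1"
      then have "\<zeta> * of_real s \<notin> N" using elim by (auto simp: indicator_def split: if_splits)
      moreover have ns: "norm (\<zeta> * of_real s) = s" using s \<zeta> by (simp add: norm_mult)
      ultimately have "g (\<zeta> * of_real s) = \<omega> (\<zeta> * of_real s)" using gN[of "\<zeta> * of_real s"] s by simp
      moreover have "\<omega> (\<zeta> * of_real s) = \<omega> (of_real s)" using \<omega>(2)[of "\<zeta> * of_real s"] ns s by simp
      ultimately show "\<omega> (of_real s) = w s" using \<omega>(1)[of "of_real s"] s by (simp add: w_def)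
    qed
  qed
  \<comment> \<open>Back from the radius to the disc: the points whose modulus lies in a null set of
    radii form a null set in the plane.\<close>
  then obtain B where B: "B \<in> null_sets lborel" and Bs: "\<And>s. s \<notin> B \<Longrightarrow> 0 < s \<and> s < 1 \<longrightarrow> \<omega> (of_real s) = w s"
    by (force elim!: AE_E3)
  have [measurable]: "B \<in> sets borel" using B by auto
  have "AE s in lborel. s \<notin> B" using B by (rule AE_not_in)
  then have "(\<integral>\<^sup>+s. indicator B s * ennreal (2 * pi * s) * indicator {0..1} s \<partial>lborel) = 0"
    by (subst nn_integral_0_iff_AE) (auto elim!: eventually_mono)
  then have "(\<integral>\<^sup>+z. indicator B (norm z) * indicator (ball 0 1) z \<partial>(lborel :: complex measure)) = 0"
    by (subst nn_integral_disc_radial) simp_all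
  then have "AE z in (lborel :: complex measure). indicator B (norm z) * indicator (ball 0 1) z = (0::ennreal)"
    by (subst (asm) nn_integral_0_iff_AE) auto
  moreover have "AE z in lborel. z \<noteq> (0::complex)" by (rule AE_lborel_singleton)
  ultimately have AEz: "AE z in lborel. z \<in> ball 0 1 \<longrightarrow> \<omega> z = w (norm z)"
  proof eventually_elim
    case (elim z)
    show ?case
    proof
      assume z: "z \<in> ball 0 1"
      then have "norm z \<notin> B" using elim by (auto simp: indicator_def split: if_splits)
      then show "\<omega> z = w (norm z)" using Bs[of "norm z"] z elim \<omega>(2)[of z] by auto
    qed
  qed
  show ?thesis by (rule that[OF w _ AEz AEs]) (simp add: w_def)
qed

section \<open>Radial doubling measures\<close>

text \<open>What the operator estimates use of a weight, expressed through a Borel measure instead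
  of a density. \<open>circle_null\<close> gives open and closed tails the same mass, and
  \<open>tail_pos\<close> prevents the measure from living on a smaller disc, where point
  evaluations near the boundary would fail to be bounded.\<close>

locale radial_doubling_measure =
  fixes \<nu> :: "complex measure" and C :: real
  assumes sets_eq: "sets \<nu> = sets (restrict_space borel (ball 0 1))"
    and finite_measure: "finite_measure \<nu>"
    and rotation: "\<And>g c. g \<in> borel_measurable \<nu> \<Longrightarrow> norm c = 1
      \<Longrightarrow> (\<integral>\<^sup>+z. g (c * z) \<partial>\<nu>) = (\<integral>\<^sup>+z. g z \<partial>\<nu>)"
    and circle_null: "\<And>r. emeasure \<nu> {z \<in> ball 0 1. norm z = r} = 0"
    and tail_pos: "\<And>r. r < 1 \<Longrightarrow> 0 < emeasure \<nu> {z \<in> ball 0 1. r \<le> norm z}"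
    and C: "1 \<le> C"
    and doubling: "\<And>r. 0 \<le> r \<Longrightarrow> r < 1 \<Longrightarrow> emeasure \<nu> {z \<in> ball 0 1. r \<le> norm z}
      \<le> ennreal C * emeasure \<nu> {z \<in> ball 0 1. (1 + r) / 2 \<le> norm z}"
begin

sublocale finite_measure \<nu> by (rule finite_measure)

lemma space_eq [simp]: "space \<nu> = ball 0 1"
  using sets_eq_imp_space_eq[OF sets_eq] by (simp add: space_restrict_space)

lemma borel_measurable_continuous:
  assumes "continuous_on (ball 0 1) f"
  shows "f \<in> borel_measurable \<nu>"
  using borel_measurable_continuous_on_restrict[OF assms]
  by (simp cong: measurable_cong_sets add: sets_eq)

lemma measurable_id [measurable]: "(\<lambda>z. z) \<in> \<nu> \<rightarrow>\<^sub>M borel"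
  by (intro borel_measurable_continuous continuous_intros)

lemma sets_radial [measurable]: "S \<in> sets borel \<Longrightarrow> {z \<in> ball 0 1. norm z \<in> S} \<in> sets \<nu>"
proof -
  assume [measurable]: "S \<in> sets borel"
  have "{z \<in> space \<nu>. norm z \<in> S} \<in> sets \<nu>" by measurable
  then show ?thesis by simp
qed

text \<open>Rotation invariance averaged over all rotations, followed by Tonelli. It plays the role
  of polar coordinates for a measure without a given density.\<close>

lemma nn_integral_rotation_mean:
  assumes h: "h \<in> borel_measurable \<nu>"
  shows "(\<integral>\<^sup>+z. h z \<partial>\<nu>) = (\<integral>\<^sup>+z. \<integral>\<^sup>+\<zeta>. h (\<zeta> * z) \<partial>circle_measure \<partial>\<nu>)"
proof -
  interpret P: pair_sigma_finite circle_measure \<nu> ..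
  have m: "(\<lambda>(\<zeta>, z). \<zeta> * z) \<in> (circle_measure \<Otimes>\<^sub>M \<nu>) \<rightarrow>\<^sub>M \<nu>"
  proof -
    have [measurable]: "(\<lambda>x. fst x) \<in> borel_measurable (circle_measure \<Otimes>\<^sub>M \<nu>)"
      by (rule measurable_compose[OF measurable_fst measurable_circle_id])
    have [measurable]: "(\<lambda>x. snd x) \<in> borel_measurable (circle_measure \<Otimes>\<^sub>M \<nu>)"
      by (rule measurable_compose[OF measurable_snd measurable_id])
    have "(\<lambda>x. fst x * snd x) \<in> (circle_measure \<Otimes>\<^sub>M \<nu>) \<rightarrow>\<^sub>M restrict_space borel (ball 0 1)"
      by (rule measurable_restrict_space2) (auto simp: space_pair_measure norm_mult)
    then show ?thesis by (simp add: case_prod_unfold measurable_cong_sets[OF refl sets_eq])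
  qed
  have m2: "(\<lambda>(\<zeta>, z). h (\<zeta> * z)) \<in> borel_measurable (circle_measure \<Otimes>\<^sub>M \<nu>)"
    using measurable_compose[OF m h] by (simp add: case_prod_unfold)
  have "(\<integral>\<^sup>+z. \<integral>\<^sup>+\<zeta>. h (\<zeta> * z) \<partial>circle_measure \<partial>\<nu>) = (\<integral>\<^sup>+\<zeta>. \<integral>\<^sup>+z. h (\<zeta> * z) \<partial>\<nu> \<partial>circle_measure)"
    by (rule P.Fubini'[OF m2])
  also have "\<dots> = (\<integral>\<^sup>+\<zeta>. (\<integral>\<^sup>+z. h z \<partial>\<nu>) \<partial>circle_measure)"
    by (intro nn_integral_cong rotation[OF h]) simp
  also have "\<dots> = (\<integral>\<^sup>+z. h z \<partial>\<nu>)"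
    using circle.emeasure_space_1 by simp
  finally show ?thesis by simp
qed

lemma borel_measurable_holomorphic_powr:
  assumes "f holomorphic_on ball 0 1" "0 < p"
  shows "(\<lambda>z. ennreal (norm (f z) powr p)) \<in> borel_measurable \<nu>"
proof -
  have "f \<in> borel_measurable \<nu>"
    by (intro borel_measurable_continuous holomorphic_on_imp_continuous_on assms)
  then show ?thesis by measurable
qed

lemma circle_mean_norm:
  assumes f: "f holomorphic_on ball 0 1" and p: "0 < p" and z: "norm z < 1"
  shows "(\<integral>\<^sup>+\<zeta>. ennreal (norm (f (\<zeta> * z)) powr p) \<partial>circle_measure) = circle_mean p f (norm z)"
proof -
  define c where "c = (if z = 0 then 1 else sgn z)"
  have c: "norm c = 1" by (simp add: c_def norm_sgn)
  have c2: "z = c * of_real (norm z)" by (simp add: c_def sgn_eq)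
  have "(\<lambda>\<zeta>. norm (f (of_real (norm z) * \<zeta>)) powr p) \<in> borel_measurable circle_measure"
    using z p by (intro borel_measurable_circle_continuous continuous_on_circle_powr f) auto
  then have m: "(\<lambda>\<zeta>. ennreal (norm (f (of_real (norm z) * \<zeta>)) powr p)) \<in> borel_measurable circle_measure"
    by measurable
  have "(\<integral>\<^sup>+\<zeta>. ennreal (norm (f (\<zeta> * z)) powr p) \<partial>circle_measure)
     = (\<integral>\<^sup>+\<zeta>. ennreal (norm (f (of_real (norm z) * (c * \<zeta>))) powr p) \<partial>circle_measure)"
    by (subst c2) (simp add: mult_ac)
  also have "\<dots> = circle_mean p f (norm z)"
    unfolding circle_mean_def by (rule nn_integral_circle_rotate[OF m c])
  finally show ?thesis .
qed

lemma nn_integral_powr_radial: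
  assumes f: "f holomorphic_on ball 0 1" and p: "0 < p" and k[measurable]: "k \<in> borel_measurable borel"
  shows "(\<integral>\<^sup>+z. ennreal (norm (f z) powr p) * k (norm z) \<partial>\<nu>) = (\<integral>\<^sup>+z. circle_mean p f (norm z) * k (norm z) \<partial>\<nu>)"
proof -
  note m[measurable] = borel_measurable_holomorphic_powr[OF f p]
  have "(\<lambda>z. ennreal (norm (f z) powr p) * k (norm z)) \<in> borel_measurable \<nu>" by measurable
  then have "(\<integral>\<^sup>+z. ennreal (norm (f z) powr p) * k (norm z) \<partial>\<nu>)
      = (\<integral>\<^sup>+z. \<integral>\<^sup>+\<zeta>. ennreal (norm (f (\<zeta> * z)) powr p) * k (norm (\<zeta> * z)) \<partial>circle_measure \<partial>\<nu>)"
    by (rule nn_integral_rotation_mean)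
  also have "\<dots> = (\<integral>\<^sup>+z. circle_mean p f (norm z) * k (norm z) \<partial>\<nu>)"
  proof (rule nn_integral_cong)
    fix z assume "z \<in> space \<nu>"
    then have z: "norm z < 1" by simp
    have "continuous_on (sphere 0 1) (\<lambda>\<zeta>. f (\<zeta> * z))"
      by (rule continuous_on_compose2[OF holomorphic_on_imp_continuous_on[OF f]])
         (use z in \<open>auto intro!: continuous_intros simp: norm_mult\<close>)
    then have [measurable]: "(\<lambda>\<zeta>. f (\<zeta> * z)) \<in> borel_measurable circle_measure"
      by (rule borel_measurable_circle_continuous)
    have "(\<integral>\<^sup>+\<zeta>. ennreal (norm (f (\<zeta> * z)) powr p) * k (norm (\<zeta> * z)) \<partial>circle_measure)
        = (\<integral>\<^sup>+\<zeta>. ennreal (norm (f (\<zeta> * z)) powr p) * k (norm z) \<partial>circle_measure)"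
      by (intro nn_integral_cong) (auto simp: norm_mult)
    also have "\<dots> = (\<integral>\<^sup>+\<zeta>. ennreal (norm (f (\<zeta> * z)) powr p) \<partial>circle_measure) * k (norm z)"
      by (rule nn_integral_multc) measurable
    finally show "(\<integral>\<^sup>+\<zeta>. ennreal (norm (f (\<zeta> * z)) powr p) * k (norm (\<zeta> * z)) \<partial>circle_measure)
        = circle_mean p f (norm z) * k (norm z)"
      by (simp only: circle_mean_norm[OF f p z])
  qed
  finally show ?thesis .
qed

text \<open>An upward closed set is the interval from its infimum \<open>s\<close> to 1, with or
  without the endpoint, and \<open>circle_null\<close> makes the two cases equal. The condition on
  the midpoint forces \<open>2 * s - 1 \<le> norm z\<close>; the maximum with 0 is there because
  doubling speaks of nonnegative radii.\<close>

lemma up_set_doubling: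
  assumes U: "U \<subseteq> {0..<1}" "\<And>s t. s \<in> U \<Longrightarrow> s \<le> t \<Longrightarrow> t < 1 \<Longrightarrow> t \<in> U"
    and [measurable]: "{z \<in> ball 0 1. norm z \<in> U} \<in> sets \<nu>"
  shows "emeasure \<nu> {z \<in> ball 0 1. (1 + norm z) / 2 \<in> U} \<le> ennreal C * emeasure \<nu> {z \<in> ball 0 1. norm z \<in> U}"
proof (cases "U = {}")
  case False
  define s where "s = Inf U"
  have bdd: "bdd_below U" using U(1) by (auto intro!: bdd_belowI[of _ 0])
  have s_le: "s \<le> u" if "u \<in> U" for u unfolding s_def using bdd that by (rule cInf_lower[rotated])
  have s: "0 \<le> s" "s < 1"
    using False U(1) s_le unfolding s_def by (auto intro!: cInf_greatest) (meson atLeastLessThan_iff ex_in_conv le_less_trans subsetD)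
  have gt: "u \<in> U" if "s < u" "u < 1" for u
  proof -
    have "\<exists>v\<in>U. v < u" using cInf_lessD[OF False] that(1) unfolding s_def by blast
    then obtain v where "v \<in> U" "v < u" by blast
    then show ?thesis using U(2)[of v u] that by simp
  qed
  have tail: "emeasure \<nu> {z \<in> ball 0 1. s \<le> norm z} \<le> emeasure \<nu> {z \<in> ball 0 1. norm z \<in> U}"
  proof -
    have "emeasure \<nu> {z \<in> ball 0 1. s \<le> norm z} \<le> emeasure \<nu> ({z \<in> ball 0 1. norm z = s} \<union> {z \<in> ball 0 1. norm z \<in> U})"
      using gt sets_radial[of "{s}"] assms(3) by (intro emeasure_mono sets.Un) (auto simp: le_less)
    also have "\<dots> \<le> emeasure \<nu> {z \<in> ball 0 1. norm z = s} + emeasure \<nu> {z \<in> ball 0 1. norm z \<in> U}"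
      using sets_radial[of "{s}"] assms(3) by (intro emeasure_subadditive) auto
    finally show ?thesis by (simp only: circle_null add_0)
  qed
  have "emeasure \<nu> {z \<in> ball 0 1. (1 + norm z) / 2 \<in> U} \<le> emeasure \<nu> {z \<in> ball 0 1. max 0 (2 * s - 1) \<le> norm z}"
    using sets_radial[of "{max 0 (2 * s - 1)..}"] by (intro emeasure_mono) (auto dest!: s_le)
  also have "\<dots> \<le> ennreal C * emeasure \<nu> {z \<in> ball 0 1. (1 + max 0 (2 * s - 1)) / 2 \<le> norm z}"
    using s by (intro doubling) auto
  also have "\<dots> \<le> ennreal C * emeasure \<nu> {z \<in> ball 0 1. s \<le> norm z}"
    using sets_radial[of "{s..}"] by (intro mult_left_mono emeasure_mono) auto
  also have "\<dots> \<le> ennreal C * emeasure \<nu> {z \<in> ball 0 1. norm z \<in> U}"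
    by (intro mult_left_mono tail) simp
  finally show ?thesis .
qed simp

lemma measurable_radius:
  assumes "continuous_on {0..<1} g" "\<And>s. 0 \<le> s \<Longrightarrow> s < 1 \<Longrightarrow> 0 \<le> g s \<and> g s < 1"
  shows "(\<lambda>z. g (norm z)) \<in> \<nu> \<rightarrow>\<^sub>M restrict_space borel {0..<1 :: real}"
  by (rule measurable_restrict_space2)
     (use assms in \<open>auto intro!: borel_measurable_continuous continuous_on_compose2[OF assms(1)] continuous_intros\<close>)

text \<open>Layer cake: the superlevel sets of an increasing function are upward closed, so doubling
  of tails passes to integrals, without any continuity of \<open>F\<close>. Negative values of
  \<open>F\<close> count as 0 on both sides through \<open>ennreal\<close>.\<close>

lemma nn_integral_mono_doubling:
  fixes F :: "real \<Rightarrow> real"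
  assumes F: "mono_on {0..<1} F"
  shows "(\<integral>\<^sup>+z. ennreal (F ((1 + norm z) / 2)) \<partial>\<nu>) \<le> ennreal C * (\<integral>\<^sup>+z. ennreal (F (norm z)) \<partial>\<nu>)"
proof -
  have layer: "ennreal x = (\<integral>\<^sup>+l. indicator {0..<x} l \<partial>lborel)" for x :: real
    by (cases "0 \<le> x") (auto simp: ennreal_neg)
  interpret P: pair_sigma_finite \<nu> "lborel :: real measure" ..
  have int: "(\<integral>\<^sup>+z. ennreal (G z) \<partial>\<nu>) = (\<integral>\<^sup>+l. emeasure \<nu> {z \<in> ball 0 1. 0 \<le> l \<and> l < G z} \<partial>lborel)"
    "(\<lambda>l. emeasure \<nu> {z \<in> ball 0 1. 0 \<le> l \<and> l < G z}) \<in> borel_measurable lborel"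
    if [measurable]: "G \<in> borel_measurable \<nu>" for G :: "complex \<Rightarrow> real"
  proof -
    have m: "(\<lambda>(z, l). indicator {0..<G z} l :: ennreal) \<in> borel_measurable (\<nu> \<Otimes>\<^sub>M lborel)"
    proof -
      have "(\<lambda>(z, l). indicator {x. 0 \<le> snd x \<and> snd x < G (fst x)} (z, l) :: ennreal) \<in> borel_measurable (\<nu> \<Otimes>\<^sub>M lborel)"
        by measurable
      then show ?thesis by (simp add: indicator_def case_prod_unfold)
    qed
    have eq: "(\<integral>\<^sup>+z. indicator {0..<G z} l \<partial>\<nu>) = emeasure \<nu> {z \<in> ball 0 1. 0 \<le> l \<and> l < G z}" for l
    proof -
      have "{z \<in> space \<nu>. 0 \<le> l \<and> l < G z} \<in> sets \<nu>" by measurable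
      then have "emeasure \<nu> {z \<in> ball 0 1. 0 \<le> l \<and> l < G z} = (\<integral>\<^sup>+z. indicator {z \<in> ball 0 1. 0 \<le> l \<and> l < G z} z \<partial>\<nu>)"
        by simp
      also have "\<dots> = (\<integral>\<^sup>+z. indicator {0..<G z} l \<partial>\<nu>)"
        by (intro nn_integral_cong) (auto simp: indicator_def)
      finally show ?thesis by simp
    qed
    show "(\<integral>\<^sup>+z. ennreal (G z) \<partial>\<nu>) = (\<integral>\<^sup>+l. emeasure \<nu> {z \<in> ball 0 1. 0 \<le> l \<and> l < G z} \<partial>lborel)"
      unfolding layer eq[symmetric] by (rule P.Fubini'[symmetric, OF m])
    show "(\<lambda>l. emeasure \<nu> {z \<in> ball 0 1. 0 \<le> l \<and> l < G z}) \<in> borel_measurable lborel"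
      unfolding eq[symmetric] using measurable_compose[OF measurable_pair_swap' m]
      by (intro borel_measurable_nn_integral) (simp add: case_prod_unfold)
  qed
  note Fm = borel_measurable_mono_on_fnc[OF F]
  have G1: "(\<lambda>z. F (norm z)) \<in> borel_measurable \<nu>"
    by (rule measurable_compose[OF measurable_radius Fm]) (auto intro: continuous_intros)
  have G2: "(\<lambda>z. F ((1 + norm z) / 2)) \<in> borel_measurable \<nu>"
    by (rule measurable_compose[OF measurable_radius[of "\<lambda>s. (1 + s) / 2"] Fm]) (auto intro!: continuous_intros)
  have "(\<integral>\<^sup>+z. ennreal (F ((1 + norm z) / 2)) \<partial>\<nu>)
      = (\<integral>\<^sup>+l. emeasure \<nu> {z \<in> ball 0 1. 0 \<le> l \<and> l < F ((1 + norm z) / 2)} \<partial>lborel)"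
    by (rule int(1)[OF G2])
  also have "\<dots> \<le> (\<integral>\<^sup>+l. ennreal C * emeasure \<nu> {z \<in> ball 0 1. 0 \<le> l \<and> l < F (norm z)} \<partial>lborel)"
  proof (rule nn_integral_mono)
    fix l :: real
    define U where "U = {s \<in> {0..<1}. 0 \<le> l \<and> l < F s}"
    have m: "{z \<in> ball 0 1. norm z \<in> U} \<in> sets \<nu>"
    proof -
      have "{z \<in> space \<nu>. 0 \<le> l \<and> l < F (norm z)} \<in> sets \<nu>" using G1 by measurable
      moreover have "{z \<in> space \<nu>. 0 \<le> l \<and> l < F (norm z)} = {z \<in> ball 0 1. norm z \<in> U}" by (auto simp: U_def)
      ultimately show ?thesis by simp
    qed
    have "emeasure \<nu> {z \<in> ball 0 1. (1 + norm z) / 2 \<in> U} \<le> ennreal C * emeasure \<nu> {z \<in> ball 0 1. norm z \<in> U}"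
    proof (rule up_set_doubling[OF _ _ m])
      show "t \<in> U" if "s \<in> U" "s \<le> t" "t < 1" for s t
        using that mono_onD[OF F, of s t] by (auto simp: U_def)
    qed (auto simp: U_def)
    moreover have "{z :: complex \<in> ball 0 1. (1 + norm z) / 2 \<in> U} = {z \<in> ball 0 1. 0 \<le> l \<and> l < F ((1 + norm z) / 2)}"
      by (auto simp: U_def add_nonneg_nonneg)
    moreover have "{z :: complex \<in> ball 0 1. norm z \<in> U} = {z \<in> ball 0 1. 0 \<le> l \<and> l < F (norm z)}"
      by (auto simp: U_def)
    ultimately show "emeasure \<nu> {z \<in> ball 0 1. 0 \<le> l \<and> l < F ((1 + norm z) / 2)}
        \<le> ennreal C * emeasure \<nu> {z \<in> ball 0 1. 0 \<le> l \<and> l < F (norm z)}" by (simp only:)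
  qed
  also have "\<dots> = ennreal C * (\<integral>\<^sup>+z. ennreal (F (norm z)) \<partial>\<nu>)"
    by (subst nn_integral_cmult[OF int(2)[OF G1]]) (simp only: int(1)[OF G1])
  finally show ?thesis .
qed

text \<open>Each application of doubling halves the distance to the circle at the price of one
  factor \<open>C\<close>.\<close>

lemma nn_integral_mono_doubling_iterate:
  fixes F :: "real \<Rightarrow> real"
  assumes F: "mono_on {0..<1} F"
  shows "(\<integral>\<^sup>+z. ennreal (F (1 - (1 - norm z) / 2 ^ k)) \<partial>\<nu>) \<le> ennreal (C ^ k) * (\<integral>\<^sup>+z. ennreal (F (norm z)) \<partial>\<nu>)"
proof (induction k)
  case (Suc k)
  have "mono_on {0..<1} (\<lambda>s. F (1 - (1 - s) / 2 ^ k))"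
  proof (rule mono_onI)
    fix s t :: real assume st: "s \<in> {0..<1}" "t \<in> {0..<1}" "s \<le> t"
    have le: "(1 - u) / 2 ^ k \<le> 1 - u" if "u < 1" for u :: real
      using divide_left_mono[of 1 "2 ^ k" "1 - u"] that by simp
    have "(1 - t) / 2 ^ k \<le> (1 - s) / 2 ^ k" "0 < (1 - t) / 2 ^ k" "0 < (1 - s) / 2 ^ k"
      using st by (auto intro!: divide_right_mono)
    then show "F (1 - (1 - s) / 2 ^ k) \<le> F (1 - (1 - t) / 2 ^ k)"
      using st le[of s] le[of t] by (intro mono_onD[OF F]; simp only: atLeastLessThan_iff; linarith)
  qed
  from nn_integral_mono_doubling[OF this]
  have "(\<integral>\<^sup>+z. ennreal (F (1 - (1 - (1 + norm z) / 2) / 2 ^ k)) \<partial>\<nu>)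
      \<le> ennreal C * (\<integral>\<^sup>+z. ennreal (F (1 - (1 - norm z) / 2 ^ k)) \<partial>\<nu>)" .
  also have "\<dots> \<le> ennreal C * (ennreal (C ^ k) * (\<integral>\<^sup>+z. ennreal (F (norm z)) \<partial>\<nu>))"
    by (intro mult_left_mono Suc.IH) simp
  also have "\<dots> = ennreal (C ^ Suc k) * (\<integral>\<^sup>+z. ennreal (F (norm z)) \<partial>\<nu>)"
    using C by (simp add: ennreal_mult mult.assoc)
  also have "(\<lambda>z::complex. 1 - (1 - (1 + norm z) / 2) / 2 ^ k) = (\<lambda>z. 1 - (1 - norm z) / 2 ^ Suc k)"
    by (auto simp: field_simps)
  finally show ?case by (simp add: fun_eq_iff)
qed simp

end

section \<open>Composition estimates for radial measures\<close>

text \<open>A self-map with \<open>norm (\<phi> 0) \<le> a\<close> keeps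
  \<open>1 - norm (\<phi> z)\<close> above \<open>(1 - a) * (1 - r) / 4\<close> on the disc of
  radius \<open>(1 + r) / 2\<close>. Any dyadic \<open>d\<close> below \<open>(1 - a) / 4\<close>
  therefore gives an admissible target radius \<open>R = 1 - (1 - r) * d\<close>; dyadic values fit
  the iterated doubling.\<close>

lemma circle_mean_self_map_le:
  assumes p: "1 \<le> p" and a: "a < 1"
  obtains k :: nat and K :: real where "0 < K"
    "\<And>f \<phi> r. f holomorphic_on ball 0 1 \<Longrightarrow> \<phi> holomorphic_on ball 0 1 \<Longrightarrow> \<phi> ` ball 0 1 \<subseteq> ball 0 1
      \<Longrightarrow> norm (\<phi> 0) \<le> a \<Longrightarrow> 0 \<le> r \<Longrightarrow> r < 1
      \<Longrightarrow> circle_mean p (\<lambda>z. f (\<phi> z)) r \<le> ennreal K * circle_mean p f (1 - (1 - r) / 2 ^ k)"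
proof -
  obtain k :: nat where k: "(1 / 2) ^ k < (1 - a) / 4"
    using real_arch_pow_inv[of "(1 - a) / 4" "1 / 2"] a by auto
  define d where "d = (1 / 2 :: real) ^ k"
  have d: "0 < d" "d < (1 - a) / 4" using k by (auto simp: d_def)
  \<comment> \<open>In the subordination factor the numerator is at most 2, and
    \<open>R - norm (\<phi> 0)\<close> is at least \<open>3 * (1 - a) / 4\<close>.\<close>
  define K where "K = 8 / (3 * (1 - a))"
  have K: "0 < K" using a by (simp add: K_def)
  have "circle_mean p (\<lambda>z. f (\<phi> z)) r \<le> ennreal K * circle_mean p f (1 - (1 - r) / 2 ^ k)"
    if f: "f holomorphic_on ball 0 1" and \<phi>: "\<phi> holomorphic_on ball 0 1" "\<phi> ` ball 0 1 \<subseteq> ball 0 1"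
      and \<phi>0: "norm (\<phi> 0) \<le> a" and r: "0 \<le> r" "r < 1" for f \<phi> r
  proof -
    define R where "R = 1 - (1 - r) * d"
    have a0: "0 \<le> a" using \<phi>0 norm_ge_zero order_trans by blast
    have "(1 - r) * d \<le> d" "0 < (1 - r) * d" using r d by auto
    then have R: "1 - (1 - a) / 4 < R" "R < 1" using d unfolding R_def by linarith+
    then have R0: "0 < R"
    proof -
      have "(1 - a) / 4 \<le> 1 / 4" using a0 by (intro divide_right_mono) auto
      then show ?thesis using R by linarith
    qed
    \<comment> \<open>Subordination on the circle of radius \<open>r\<close> needs control on a
      strictly larger disc; the midpoint \<open>(1 + r) / 2\<close> costs only a factor 2 in the
      distance to the boundary.\<close>
    have lt: "norm (\<phi> z) < R" if z: "norm z < (1 + r) / 2" for z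
    proof -
      have "norm z < 1" using z r by simp
      have "(1 - r) * d < (1 - r) * ((1 - a) / 4)" using r d by (intro mult_strict_left_mono) auto
      also have "\<dots> = (1 - a) * ((1 - r) / 2) / 2" by simp
      also have "\<dots> \<le> (1 - norm (\<phi> 0)) * (1 - norm z) / 2"
        using \<phi>0 z r a by (intro divide_right_mono mult_mono) auto
      also have "\<dots> \<le> 1 - norm (\<phi> z)" by (rule self_map_boundary_distance[OF \<phi> \<open>norm z < 1\<close>])
      finally show ?thesis by (simp add: R_def)
    qed
    have "circle_mean p (\<lambda>z. f (\<phi> z)) r \<le> ennreal ((R + norm (\<phi> 0)) / (R - norm (\<phi> 0))) * circle_mean p f R"
    proof (rule circle_mean_compose_le[OF p f R0 R(2) _ r(1) _ lt])
      show "\<phi> holomorphic_on ball 0 ((1 + r) / 2)"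
        by (rule holomorphic_on_subset[OF \<phi>(1)]) (use r in auto)
    qed (use r in auto)
    also have "\<dots> \<le> ennreal K * circle_mean p f R"
    proof (intro mult_right_mono ennreal_leI)
      have "(R + norm (\<phi> 0)) / (R - norm (\<phi> 0)) \<le> 2 / (3 * (1 - a) / 4)"
        using R \<phi>0 a by (intro frac_le) (auto simp: field_simps)
      then show "(R + norm (\<phi> 0)) / (R - norm (\<phi> 0)) \<le> K" by (simp add: K_def)
    qed simp
    finally show ?thesis by (simp add: R_def d_def power_one_over field_simps)
  qed
  with K show ?thesis by (rule that)
qed

text \<open>The norm of the sum is at most twice the larger norm. The crude factor suffices for
  finiteness and for estimates tending to 0.\<close>

lemma norm_add_powr_le:
  fixes x y :: "'a::real_normed_vector"
  assumes "0 \<le> p"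
  shows "norm (x + y) powr p \<le> 2 powr p * (norm x powr p + norm y powr p)"
proof -
  have "norm (x + y) \<le> 2 * max (norm x) (norm y)" using norm_triangle_ineq[of x y] by simp
  then have "norm (x + y) powr p \<le> (2 * max (norm x) (norm y)) powr p"
    using assms by (intro powr_mono2) auto
  also have "\<dots> = 2 powr p * (max (norm x) (norm y)) powr p" by (simp add: powr_mult)
  also have "\<dots> \<le> 2 powr p * (norm x powr p + norm y powr p)"
    by (intro mult_left_mono) (auto simp: max_def)
  finally show ?thesis .
qed

context radial_doubling_measure begin

text \<open>This is the \<open>p\<close>-th power of the norm, without the root.\<close>

definition pnorm :: "real \<Rightarrow> (complex \<Rightarrow> complex) \<Rightarrow> ennreal" where
  "pnorm p f = (\<integral>\<^sup>+z. ennreal (norm (f z) powr p) \<partial>\<nu>)"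

lemma pnorm_cong: "(\<And>z. norm z < 1 \<Longrightarrow> f z = g z) \<Longrightarrow> pnorm p f = pnorm p g"
  unfolding pnorm_def by (intro nn_integral_cong) simp

lemma mono_on_circle_mean:
  assumes "1 \<le> p" "f holomorphic_on ball 0 1"
  shows "mono_on {0..<1} (\<lambda>r. enn2real (circle_mean p f r))"
  using circle_mean_mono[OF assms] circle_mean_finite[OF assms(2)] assms(1)
  by (intro mono_onI enn2real_mono) auto

lemma radial_shrink:
  fixes s :: real assumes "0 \<le> s" "s < 1"
  shows "0 \<le> 1 - (1 - s) / 2 ^ k" "1 - (1 - s) / 2 ^ k < 1"
proof -
  show "1 - (1 - s) / 2 ^ k < 1" using assms by simp
  have "(1 - s) / 2 ^ k \<le> 1 - s" using divide_left_mono[of 1 "2 ^ k" "1 - s"] assms by simp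
  then show "0 \<le> 1 - (1 - s) / 2 ^ k" using assms by linarith
qed

text \<open>Measurability comes from monotonicity in the radius. The detour through
  \<open>enn2real\<close> serves to apply the fact about monotone real functions, and finiteness of
  the means undoes it.\<close>

lemma borel_measurable_circle_mean:
  assumes "1 \<le> p" "f holomorphic_on ball 0 1"
  shows "(\<lambda>z. circle_mean p f (1 - (1 - norm z) / 2 ^ k)) \<in> borel_measurable \<nu>"
proof -
  have "(\<lambda>z. 1 - (1 - norm z) / 2 ^ k) \<in> \<nu> \<rightarrow>\<^sub>M restrict_space borel {0..<1 :: real}"
  proof (rule measurable_radius[of "\<lambda>s. 1 - (1 - s) / 2 ^ k"])
    show "0 \<le> 1 - (1 - s) / 2 ^ k \<and> 1 - (1 - s) / 2 ^ k < 1" if "0 \<le> s" "s < 1" for s :: real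
      using radial_shrink[OF that] by blast
  qed (intro continuous_intros, simp)
  from measurable_compose[OF this borel_measurable_mono_on_fnc[OF mono_on_circle_mean[OF assms]]]
  have "(\<lambda>z. ennreal (enn2real (circle_mean p f (1 - (1 - norm z) / 2 ^ k)))) \<in> borel_measurable \<nu>"
    by (rule measurable_compose) simp
  then show ?thesis
    by (rule measurable_cong[THEN iffD1, rotated])
       (use assms radial_shrink in \<open>auto intro!: ennreal_enn2real circle_mean_finite[simplified]\<close>)
qed

lemma nn_integral_circle_mean_shrink:
  assumes p: "1 \<le> p" and f: "f holomorphic_on ball 0 1"
  shows "(\<integral>\<^sup>+z. circle_mean p f (1 - (1 - norm z) / 2 ^ k) \<partial>\<nu>) \<le> ennreal (C ^ k) * pnorm p f"
proof -
  have fin: "ennreal (enn2real (circle_mean p f r)) = circle_mean p f r" if "0 \<le> r" "r < 1" for r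
    using circle_mean_finite[OF f that] p by (intro ennreal_enn2real) auto
  have "(\<integral>\<^sup>+z. circle_mean p f (1 - (1 - norm z) / 2 ^ k) \<partial>\<nu>)
    = (\<integral>\<^sup>+z. ennreal (enn2real (circle_mean p f (1 - (1 - norm z) / 2 ^ k))) \<partial>\<nu>)"
    by (intro nn_integral_cong fin[symmetric] radial_shrink) auto
  also have "\<dots> \<le> ennreal (C ^ k) * (\<integral>\<^sup>+z. ennreal (enn2real (circle_mean p f (norm z))) \<partial>\<nu>)"
    by (rule nn_integral_mono_doubling_iterate[OF mono_on_circle_mean[OF p f]])
  also have "(\<integral>\<^sup>+z. ennreal (enn2real (circle_mean p f (norm z))) \<partial>\<nu>) = (\<integral>\<^sup>+z. circle_mean p f (norm z) \<partial>\<nu>)"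
    by (intro nn_integral_cong fin) auto
  also have "\<dots> = pnorm p f"
    using nn_integral_powr_radial[OF f, of p "\<lambda>_. 1"] p by (simp add: pnorm_def)
  finally show ?thesis .
qed

text \<open>The free radial factor \<open>h\<close> lets one estimate serve two purposes:
  \<open>h = 1\<close> bounds the composition operator, and an indicator of radii near 1 controls
  the tails.\<close>

lemma nn_integral_compose_radial_le:
  assumes "1 \<le> p" "a < 1"
  obtains k :: nat and K :: real where "0 < K"
    "\<And>f \<phi> h. f holomorphic_on ball 0 1 \<Longrightarrow> \<phi> holomorphic_on ball 0 1 \<Longrightarrow> \<phi> ` ball 0 1 \<subseteq> ball 0 1
      \<Longrightarrow> norm (\<phi> 0) \<le> a \<Longrightarrow> h \<in> borel_measurable borel
      \<Longrightarrow> (\<integral>\<^sup>+z. ennreal (norm (f (\<phi> z)) powr p) * h (norm z) \<partial>\<nu>)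
        \<le> ennreal K * (\<integral>\<^sup>+z. circle_mean p f (1 - (1 - norm z) / 2 ^ k) * h (norm z) \<partial>\<nu>)"
proof -
  obtain k :: nat and K :: real where K: "0 < K" and
    le: "\<And>f \<phi> r. f holomorphic_on ball 0 1 \<Longrightarrow> \<phi> holomorphic_on ball 0 1 \<Longrightarrow> \<phi> ` ball 0 1 \<subseteq> ball 0 1
      \<Longrightarrow> norm (\<phi> 0) \<le> a \<Longrightarrow> 0 \<le> r \<Longrightarrow> r < 1
      \<Longrightarrow> circle_mean p (\<lambda>z. f (\<phi> z)) r \<le> ennreal K * circle_mean p f (1 - (1 - r) / 2 ^ k)"
    by (rule circle_mean_self_map_le[OF assms]) (rule that)
  show ?thesis
  proof (rule that[OF K])
    fix f \<phi> :: "complex \<Rightarrow> complex" and h :: "real \<Rightarrow> ennreal"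
    assume f: "f holomorphic_on ball 0 1" and \<phi>: "\<phi> holomorphic_on ball 0 1" "\<phi> ` ball 0 1 \<subseteq> ball 0 1"
      and \<phi>0: "norm (\<phi> 0) \<le> a" and h[measurable]: "h \<in> borel_measurable borel"
    have "f \<circ> \<phi> holomorphic_on ball 0 1"
      using \<phi> f by (intro holomorphic_on_compose_gen[of _ _ _ "ball 0 1"]) auto
    then have f\<phi>: "(\<lambda>z. f (\<phi> z)) holomorphic_on ball 0 1" by (simp add: o_def)
    have [measurable]: "(\<lambda>z. circle_mean p f (1 - (1 - norm z) / 2 ^ k)) \<in> borel_measurable \<nu>"
      by (rule borel_measurable_circle_mean[OF assms(1) f])
    have "(\<integral>\<^sup>+z. ennreal (norm (f (\<phi> z)) powr p) * h (norm z) \<partial>\<nu>)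
        = (\<integral>\<^sup>+z. circle_mean p (\<lambda>z. f (\<phi> z)) (norm z) * h (norm z) \<partial>\<nu>)"
      using nn_integral_powr_radial[OF f\<phi> _ h, of p] assms(1) by simp
    also have "\<dots> \<le> (\<integral>\<^sup>+z. ennreal K * (circle_mean p f (1 - (1 - norm z) / 2 ^ k) * h (norm z)) \<partial>\<nu>)"
      using le[OF f \<phi> \<phi>0] by (intro nn_integral_mono) (auto simp flip: mult.assoc intro!: mult_right_mono)
    also have "\<dots> = ennreal K * (\<integral>\<^sup>+z. circle_mean p f (1 - (1 - norm z) / 2 ^ k) * h (norm z) \<partial>\<nu>)"
      by (rule nn_integral_cmult) measurable
    finally show "(\<integral>\<^sup>+z. ennreal (norm (f (\<phi> z)) powr p) * h (norm z) \<partial>\<nu>)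
        \<le> ennreal K * (\<integral>\<^sup>+z. circle_mean p f (1 - (1 - norm z) / 2 ^ k) * h (norm z) \<partial>\<nu>)" .
  qed
qed

lemma pnorm_compose_le:
  assumes p: "1 \<le> p" and \<phi>: "\<phi> holomorphic_on ball 0 1" "\<phi> ` ball 0 1 \<subseteq> ball 0 1"
  obtains K :: real where "0 < K"
    "\<And>f. f holomorphic_on ball 0 1 \<Longrightarrow> pnorm p (\<lambda>z. f (\<phi> z)) \<le> ennreal K * pnorm p f"
proof -
  have "norm (\<phi> 0) < 1" using \<phi>(2) by (auto simp: image_subset_iff)
  then obtain k :: nat and K :: real where K: "0 < K" and
    le': "\<And>f \<psi> h. f holomorphic_on ball 0 1 \<Longrightarrow> \<psi> holomorphic_on ball 0 1 \<Longrightarrow> \<psi> ` ball 0 1 \<subseteq> ball 0 1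
      \<Longrightarrow> norm (\<psi> 0) \<le> norm (\<phi> 0) \<Longrightarrow> h \<in> borel_measurable borel
      \<Longrightarrow> (\<integral>\<^sup>+z. ennreal (norm (f (\<psi> z)) powr p) * h (norm z) \<partial>\<nu>)
        \<le> ennreal K * (\<integral>\<^sup>+z. circle_mean p f (1 - (1 - norm z) / 2 ^ k) * h (norm z) \<partial>\<nu>)"
    by (rule nn_integral_compose_radial_le[OF p]) (rule that)
  note le = le'[OF _ \<phi> order_refl]
  show ?thesis
  proof (rule that)
    show "0 < K * C ^ k" using K C by simp
    fix f :: "complex \<Rightarrow> complex" assume f: "f holomorphic_on ball 0 1"
    have "pnorm p (\<lambda>z. f (\<phi> z)) \<le> ennreal K * (\<integral>\<^sup>+z. circle_mean p f (1 - (1 - norm z) / 2 ^ k) \<partial>\<nu>)"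
      using le[OF f, of "\<lambda>_. 1"] by (simp add: pnorm_def)
    also have "\<dots> \<le> ennreal K * (ennreal (C ^ k) * pnorm p f)"
      by (intro mult_left_mono nn_integral_circle_mean_shrink p f) simp
    also have "\<dots> = ennreal (K * C ^ k) * pnorm p f"
      using K C by (simp add: ennreal_mult mult.assoc)
    finally show "pnorm p (\<lambda>z. f (\<phi> z)) \<le> ennreal (K * C ^ k) * pnorm p f" .
  qed
qed

lemma nn_integral_tail_tendsto_0:
  assumes [measurable]: "H \<in> borel_measurable \<nu>" and fin: "(\<integral>\<^sup>+z. H z \<partial>\<nu>) < \<infinity>"
  shows "(\<lambda>n. \<integral>\<^sup>+z. H z * indicator {1 - 1 / Suc n..} (norm z) \<partial>\<nu>) \<longlonglongrightarrow> 0"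
proof -
  have "(\<lambda>n. \<integral>\<^sup>+z. H z * indicator {1 - 1 / Suc n..} (norm z) \<partial>\<nu>) \<longlonglongrightarrow> (\<integral>\<^sup>+z. 0 \<partial>\<nu>)"
  proof (rule nn_integral_dominated_convergence[where w=H])
    show "AE z in \<nu>. (\<lambda>n. H z * indicator {1 - 1 / Suc n..} (norm z)) \<longlonglongrightarrow> 0"
    proof (intro AE_I2 tendsto_eventually)
      fix z assume "z \<in> space \<nu>"
      then have "0 < 1 - norm z" by simp
      have "(\<lambda>n. 1 / real (Suc n)) \<longlonglongrightarrow> 0" by (rule LIMSEQ_Suc[OF lim_1_over_n])
      then have "eventually (\<lambda>n. 1 / real (Suc n) < 1 - norm z) sequentially"
        using \<open>0 < 1 - norm z\<close> by (rule order_tendstoD)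
      then show "eventually (\<lambda>n. H z * indicator {1 - 1 / Suc n..} (norm z) = 0) sequentially"
        by eventually_elim auto
    qed
  qed (use fin in \<open>auto simp: indicator_def top_unique less_top\<close>)
  then show ?thesis by simp
qed

text \<open>The disc is split at a radius \<open>s\<close>. Outside, the majorant \<open>H\<close>
  does not depend on \<open>n\<close>, so one \<open>s\<close> works for all \<open>n\<close> with
  \<open>norm (\<phi> n 0) \<le> 1 / 2\<close>. Inside, the maps send everything into a fixed
  compact disc, and bounded convergence applies because the measure is finite.\<close>

lemma pnorm_compose_tendsto_0:
  assumes p: "1 \<le> p" and f: "f holomorphic_on ball 0 1" and fin: "pnorm p f < \<infinity>"
    and \<phi>: "\<And>n. \<phi> n holomorphic_on ball 0 1" "\<And>n. \<phi> n ` ball 0 1 \<subseteq> ball 0 1"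
    and lim: "\<And>z. norm z < 1 \<Longrightarrow> (\<lambda>n. \<phi> n z) \<longlonglongrightarrow> z"
  shows "(\<lambda>n :: nat. pnorm p (\<lambda>z. f (\<phi> n z) - f z)) \<longlonglongrightarrow> 0"
proof -
  obtain k :: nat and K :: real where K: "0 < K" and
    le: "\<And>f \<phi> h. f holomorphic_on ball 0 1 \<Longrightarrow> \<phi> holomorphic_on ball 0 1 \<Longrightarrow> \<phi> ` ball 0 1 \<subseteq> ball 0 1
      \<Longrightarrow> norm (\<phi> 0) \<le> 1 / 2 \<Longrightarrow> h \<in> borel_measurable borel
      \<Longrightarrow> (\<integral>\<^sup>+z. ennreal (norm (f (\<phi> z)) powr p) * h (norm z) \<partial>\<nu>)
        \<le> ennreal K * (\<integral>\<^sup>+z. circle_mean p f (1 - (1 - norm z) / 2 ^ k) * h (norm z) \<partial>\<nu>)"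
    by (rule nn_integral_compose_radial_le[OF p, of "1/2"]) (simp, rule that)
  define H where "H = (\<lambda>z :: complex. circle_mean p f (1 - (1 - norm z) / 2 ^ k))"
  have Hm[measurable]: "H \<in> borel_measurable \<nu>"
    unfolding H_def by (rule borel_measurable_circle_mean[OF p f])
  have "(\<integral>\<^sup>+z. H z \<partial>\<nu>) \<le> ennreal (C ^ k) * pnorm p f"
    unfolding H_def by (rule nn_integral_circle_mean_shrink[OF p f])
  also have "\<dots> < \<infinity>" using fin by (simp add: ennreal_mult_less_top)
  finally have Hfin: "(\<integral>\<^sup>+z. H z \<partial>\<nu>) < \<infinity>" .
  have p0: "0 < p" using p by simp
  note fm[measurable] = borel_measurable_holomorphic_powr[OF f p0]
  \<comment> \<open>A bound for the contribution of the annulus beyond \<open>1 - 1 / Suc m\<close>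
    that is uniform in the index of the maps.\<close>
  define T where "T = (\<lambda>m. ennreal (2 powr p) * (ennreal K * (\<integral>\<^sup>+z. H z * indicator {1 - 1 / Suc m..} (norm z) \<partial>\<nu>)
      + (\<integral>\<^sup>+z. ennreal (norm (f z) powr p) * indicator {1 - 1 / Suc m..} (norm z) \<partial>\<nu>)))"
  have "T \<longlonglongrightarrow> ennreal (2 powr p) * (ennreal K * 0 + 0)"
    unfolding T_def using fin
    by (intro tendsto_intros ennreal_tendsto_cmult nn_integral_tail_tendsto_0 Hfin Hm fm) (auto simp: pnorm_def)
  then have T: "T \<longlonglongrightarrow> 0" by simp
  have f\<phi>: "(\<lambda>z. f (\<phi> n z)) holomorphic_on ball 0 1" for n
    using holomorphic_on_compose_gen[OF \<phi>(1) f \<phi>(2), of n] by (simp add: o_def)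
  have fm2[measurable]: "(\<lambda>z. f (\<phi> n z)) \<in> borel_measurable \<nu>" "f \<in> borel_measurable \<nu>" for n
    by (intro borel_measurable_continuous holomorphic_on_imp_continuous_on f\<phi> f)+
  have "(\<lambda>n. norm (\<phi> n 0)) \<longlonglongrightarrow> 0" using tendsto_norm[OF lim[of 0]] by simp
  then have ev: "eventually (\<lambda>n. norm (\<phi> n 0) < 1 / 2) sequentially" by (rule order_tendstoD) simp
  have inner: "(\<lambda>n. \<integral>\<^sup>+z. ennreal (norm (f (\<phi> n z) - f z) powr p) * indicator {..<s} (norm z) \<partial>\<nu>) \<longlonglongrightarrow> 0"
    if s: "s < 1" for s
  proof -
    \<comment> \<open>With \<open>norm (\<phi> n 0) < 1 / 2\<close> and \<open>norm z < s\<close>,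
      \<open>self_map_boundary_distance\<close> keeps the images at distance at least
      \<open>(1 - s) / 4\<close> from the circle.\<close>
    define R where "R = max 0 (1 - (1 - s) / 4)"
    have "0 < (1 - s) / 4" "(1 - s) / 4 < 1 - s" using s by (auto intro: divide_less_eq[THEN iffD2])
    then have R: "R < 1" "s < R" "0 \<le> R" unfolding R_def by linarith+
    have "compact (f ` cball 0 R)"
      using R by (intro compact_continuous_image holomorphic_on_imp_continuous_on holomorphic_on_subset[OF f]) auto
    then obtain B0 where B0: "\<forall>x\<in>f ` cball 0 R. norm x \<le> B0" using compact_imp_bounded bounded_iff by blast
    define B where "B = 2 * max 0 B0"
    obtain n0 where n0: "\<And>n. n \<ge> n0 \<Longrightarrow> norm (\<phi> n 0) < 1 / 2" using ev[unfolded eventually_sequentially] by blast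
    have bd: "norm (f (\<phi> n z) - f z) powr p \<le> B powr p" if n: "n \<ge> n0" and z: "norm z < s" for n z
    proof -
      have "norm z < 1" using z s by simp
      have "(1 - s) / 4 \<le> (1 - norm (\<phi> n 0)) * (1 - norm z) / 2"
      proof -
        have "(1 / 2) * (1 - s) \<le> (1 - norm (\<phi> n 0)) * (1 - norm z)"
          using n0[OF n] z s by (intro mult_mono) auto
        then show ?thesis by simp
      qed
      also have "\<dots> \<le> 1 - norm (\<phi> n z)" by (rule self_map_boundary_distance[OF \<phi> \<open>norm z < 1\<close>])
      finally have "norm (\<phi> n z) \<le> R" unfolding R_def by linarith
      then have "norm (f (\<phi> n z)) \<le> B0" "norm (f z) \<le> B0" using B0 z R by auto
      then have "norm (f (\<phi> n z) - f z) \<le> B" using norm_triangle_ineq4[of "f (\<phi> n z)" "f z"] by (simp add: B_def)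
      then show ?thesis using p by (intro powr_mono2) auto
    qed
    have "(\<lambda>n. \<integral>\<^sup>+z. ennreal (norm (f (\<phi> (n + n0) z) - f z) powr p) * indicator {..<s} (norm z) \<partial>\<nu>)
        \<longlonglongrightarrow> (\<integral>\<^sup>+z. 0 \<partial>\<nu>)"
    proof (rule nn_integral_dominated_convergence[where w="\<lambda>_. ennreal (B powr p)"])
      show "AE z in \<nu>. ennreal (norm (f (\<phi> (n + n0) z) - f z) powr p) * indicator {..<s} (norm z) \<le> ennreal (B powr p)" for n
        using bd by (intro AE_I2) (auto simp: indicator_def)
      show "(\<integral>\<^sup>+z. ennreal (B powr p) \<partial>\<nu>) < \<infinity>"
        by (simp add: ennreal_mult_less_top emeasure_eq_measure)
      show "AE z in \<nu>. (\<lambda>n. ennreal (norm (f (\<phi> (n + n0) z) - f z) powr p) * indicator {..<s} (norm z)) \<longlonglongrightarrow> 0"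
      proof (intro AE_I2)
        fix z assume "z \<in> space \<nu>"
        then have z: "norm z < 1" by simp
        have "isCont f z" using holomorphic_on_imp_continuous_on[OF f] z by (auto simp: continuous_on_eq_continuous_at)
        from isCont_tendsto_compose[OF this LIMSEQ_ignore_initial_segment[OF lim[OF z], of n0]]
        have "(\<lambda>n. f (\<phi> (n + n0) z)) \<longlonglongrightarrow> f z" .
        from tendsto_norm_zero[OF this[unfolded Lim_null[of _ "f z"]]]
        have "(\<lambda>n. norm (f (\<phi> (n + n0) z) - f z)) \<longlonglongrightarrow> 0" .
        then have "(\<lambda>n. norm (f (\<phi> (n + n0) z) - f z) powr p) \<longlonglongrightarrow> 0"
          using p0 by (intro tendsto_zero_powrI[where b=p]) auto
        then have "(\<lambda>n. ennreal (norm (f (\<phi> (n + n0) z) - f z) powr p)) \<longlonglongrightarrow> 0"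
          using tendsto_ennrealI by fastforce
        then have "(\<lambda>n. ennreal (norm (f (\<phi> (n + n0) z) - f z) powr p) * indicator {..<s} (norm z)) \<longlonglongrightarrow> 0 * indicator {..<s} (norm z)"
          by (rule tendsto_mult_ennreal) (auto simp: indicator_def)
        then show "(\<lambda>n. ennreal (norm (f (\<phi> (n + n0) z) - f z) powr p) * indicator {..<s} (norm z)) \<longlonglongrightarrow> 0"
          by simp
      qed
    qed measurable
    then have "(\<lambda>n. \<integral>\<^sup>+z. ennreal (norm (f (\<phi> (n + n0) z) - f z) powr p) * indicator {..<s} (norm z) \<partial>\<nu>)
        \<longlonglongrightarrow> 0" by (simp only: nn_integral_const mult_zero_left)
    then show ?thesis by (rule LIMSEQ_offset)
  qed
  show ?thesis
  proof (rule order_tendstoI)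
    fix e :: ennreal assume "0 < e"
    then have e2: "0 < e / 2" by (simp add: ennreal_zero_less_divide)
    obtain m where m: "T m < e / 2"
      using order_tendstoD(2)[OF T e2, unfolded eventually_sequentially] by blast
    define s where "s = 1 - 1 / real (Suc m)"
    have s: "s < 1" by (simp add: s_def)
    have "eventually (\<lambda>n. (\<integral>\<^sup>+z. ennreal (norm (f (\<phi> n z) - f z) powr p) * indicator {..<s} (norm z) \<partial>\<nu>) < e / 2) sequentially"
      by (rule order_tendstoD(2)[OF inner[OF s] e2])
    then show "eventually (\<lambda>n. pnorm p (\<lambda>z. f (\<phi> n z) - f z) < e) sequentially"
      using ev
    proof eventually_elim
      case (elim n)
      let ?i = "\<lambda>z :: complex. indicator {s..} (norm z) :: ennreal"
      have "(\<integral>\<^sup>+z. ennreal (norm (f (\<phi> n z) - f z) powr p) * ?i z \<partial>\<nu>)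
          \<le> (\<integral>\<^sup>+z. ennreal (2 powr p) * (ennreal (norm (f (\<phi> n z)) powr p) * ?i z + ennreal (norm (f z) powr p) * ?i z) \<partial>\<nu>)"
      proof (rule nn_integral_mono)
        fix z
        have "ennreal (norm (f (\<phi> n z) - f z) powr p) \<le> ennreal (2 powr p * (norm (f (\<phi> n z)) powr p + norm (f z) powr p))"
          using norm_add_powr_le[of p "f (\<phi> n z)" "- f z"] p by (intro ennreal_leI) simp
        also have "\<dots> = ennreal (2 powr p) * (ennreal (norm (f (\<phi> n z)) powr p) + ennreal (norm (f z) powr p))"
          by (simp add: ennreal_mult)
        finally show "ennreal (norm (f (\<phi> n z) - f z) powr p) * ?i z
          \<le> ennreal (2 powr p) * (ennreal (norm (f (\<phi> n z)) powr p) * ?i z + ennreal (norm (f z) powr p) * ?i z)"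
          by (auto simp: indicator_def)
      qed
      also have "\<dots> = ennreal (2 powr p) * ((\<integral>\<^sup>+z. ennreal (norm (f (\<phi> n z)) powr p) * ?i z \<partial>\<nu>)
          + (\<integral>\<^sup>+z. ennreal (norm (f z) powr p) * ?i z \<partial>\<nu>))"
        by (subst nn_integral_cmult, measurable, subst nn_integral_add, measurable)
      also have "\<dots> \<le> ennreal (2 powr p) * (ennreal K * (\<integral>\<^sup>+z. H z * ?i z \<partial>\<nu>)
          + (\<integral>\<^sup>+z. ennreal (norm (f z) powr p) * ?i z \<partial>\<nu>))"
        unfolding H_def using elim by (intro mult_left_mono add_right_mono le f \<phi>) auto
      also have "\<dots> = T m" by (simp add: T_def s_def)
      finally have outer: "(\<integral>\<^sup>+z. ennreal (norm (f (\<phi> n z) - f z) powr p) * ?i z \<partial>\<nu>) < e / 2"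
        using m by simp
      have "pnorm p (\<lambda>z. f (\<phi> n z) - f z)
         = (\<integral>\<^sup>+z. ennreal (norm (f (\<phi> n z) - f z) powr p) * indicator {..<s} (norm z)
             + ennreal (norm (f (\<phi> n z) - f z) powr p) * ?i z \<partial>\<nu>)"
        unfolding pnorm_def by (intro nn_integral_cong) (auto simp: indicator_def)
      also have "\<dots> = (\<integral>\<^sup>+z. ennreal (norm (f (\<phi> n z) - f z) powr p) * indicator {..<s} (norm z) \<partial>\<nu>)
             + (\<integral>\<^sup>+z. ennreal (norm (f (\<phi> n z) - f z) powr p) * ?i z \<partial>\<nu>)"
        by (rule nn_integral_add) measurable
      also have "\<dots> < e / 2 + e / 2" using elim(1) outer by (rule add_strict_mono)
      also have "e / 2 + e / 2 = e * 2 / 2" by (simp add: divide_ennreal_def mult_2_right distrib_right)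
      also have "\<dots> = e" by (rule ennreal_mult_divide_eq) simp_all
      finally show ?case .
    qed
  qed simp
qed

text \<open>The means increase with the radius, so the mean over the circle of radius
  \<open>R\<close> is controlled by the integral over the annulus beyond it, which has positive mass
  by \<open>tail_pos\<close>. The Poisson bound then passes from this circle to points
  inside.\<close>

lemma pnorm_point_evaluation:
  assumes p: "1 \<le> p" and r0: "0 \<le> r0" "r0 < 1"
  obtains K :: real where "0 < K"
    "\<And>f w. f holomorphic_on ball 0 1 \<Longrightarrow> norm w \<le> r0 \<Longrightarrow> ennreal (norm (f w) powr p) \<le> ennreal K * pnorm p f"
proof -
  define R where "R = (1 + r0) / 2"
  have R: "r0 < R" "R < 1" "0 < R" using r0 by (auto simp: R_def)
  define t where "t = measure \<nu> {z \<in> ball 0 1. R \<le> norm z}"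
  have et: "emeasure \<nu> {z \<in> ball 0 1. R \<le> norm z} = ennreal t"
    unfolding t_def by (rule emeasure_eq_measure)
  then have t: "0 < t" using tail_pos[OF R(2)] by simp
  have means: "ennreal t * circle_mean p f R \<le> pnorm p f" if f: "f holomorphic_on ball 0 1" for f
  proof -
    have "ennreal t * circle_mean p f R = (\<integral>\<^sup>+z. circle_mean p f R * indicator {z \<in> ball 0 1. R \<le> norm z} z \<partial>\<nu>)"
    proof -
      have "(\<integral>\<^sup>+z. circle_mean p f R * indicator {z \<in> ball 0 1. R \<le> norm z} z \<partial>\<nu>)
          = circle_mean p f R * emeasure \<nu> {z \<in> ball 0 1. R \<le> norm z}"
        by (rule nn_integral_cmult_indicator) (use sets_radial[of "{R..}"] in auto)
      then show ?thesis by (simp only: et mult.commute)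
    qed
    also have "\<dots> \<le> (\<integral>\<^sup>+z. circle_mean p f (norm z) * 1 \<partial>\<nu>)"
      using circle_mean_mono[OF p f] R by (intro nn_integral_mono) (auto simp: indicator_def)
    also have "\<dots> = pnorm p f"
      using nn_integral_powr_radial[OF f, of p "\<lambda>_. 1"] p by (simp add: pnorm_def)
    finally show ?thesis .
  qed
  define c where "c = (R + r0) / (R - r0)"
  have c: "0 < c" using R r0 by (simp add: c_def)
  show ?thesis
  proof (rule that)
    show "0 < c / t" using c t by simp
    fix f :: "complex \<Rightarrow> complex" and w :: complex assume f: "f holomorphic_on ball 0 1" and w: "norm w \<le> r0"
    have "ennreal (norm (f w) powr p) \<le> ennreal ((R + norm w) / (R - norm w)) * circle_mean p f R"
      using powr_le_circle_mean[OF p f, of w R] w R by simp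
    also have "\<dots> \<le> ennreal c * circle_mean p f R"
      unfolding c_def using w R r0 by (intro mult_right_mono ennreal_leI frac_le) auto
    also have "ennreal c = ennreal (c / t) * ennreal t" using c t by (simp flip: ennreal_mult)
    also have "ennreal (c / t) * ennreal t * circle_mean p f R \<le> ennreal (c / t) * pnorm p f"
      unfolding mult.assoc by (intro mult_left_mono means f) simp
    finally show "ennreal (norm (f w) powr p) \<le> ennreal (c / t) * pnorm p f" .
  qed
qed

end

section \<open>Differentiability of orbits\<close>

text \<open>Cauchy's estimate bounds the derivative. Discs of radius \<open>(r - s) / 2\<close> are
  used so that their closures still fit into the open ball, whence the factor 2.\<close>

lemma bounded_holomorphic_lipschitz:
  assumes f: "f holomorphic_on ball a r" and B: "\<And>z. z \<in> ball a r \<Longrightarrow> norm (f z) \<le> B"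
    and s: "s < r" and z: "z \<in> cball a s" "w \<in> cball a s"
  shows "norm (f z - f w) \<le> 2 * B / (r - s) * norm (z - w)"
proof (rule field_differentiable_bound[OF convex_cball _ _ z])
  define d where "d = (r - s) / 2"
  have d: "0 < d" "d + s < r" using s by (auto simp: d_def field_simps)
  fix u assume u: "u \<in> cball a s"
  have sub: "cball u d \<subseteq> ball a r"
  proof
    fix x assume "x \<in> cball u d"
    then show "x \<in> ball a r" using u d dist_triangle[of a x u] unfolding mem_ball mem_cball by linarith
  qed
  have "u \<in> ball a r" using u s by auto
  then show "(f has_field_derivative deriv f u) (at u within cball a s)"
    using holomorphic_derivI[OF f open_ball] has_field_derivative_at_within by blast
  have "norm ((deriv ^^ 1) f u) \<le> fact 1 * B / d ^ 1"
  proof (rule Cauchy_inequality)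
    show "f holomorphic_on ball u d" using f sub by (meson ball_subset_cball holomorphic_on_subset subset_trans)
    show "continuous_on (cball u d) f" using f sub holomorphic_on_imp_continuous_on holomorphic_on_subset by blast
    show "norm (f x) \<le> B" if "norm (u - x) = d" for x
      using that sub by (intro B) (auto simp: dist_norm)
  qed (use d in auto)
  then show "norm (deriv f u) \<le> 2 * B / (r - s)" by (simp add: d_def field_simps)
qed

lemma has_vector_derivative_iff_quotient:
  fixes u :: "real \<Rightarrow> complex"
  shows "(u has_vector_derivative D) (at t0 within S)
    \<longleftrightarrow> ((\<lambda>t. (u t - u t0) / of_real (t - t0)) \<longlongrightarrow> D) (at t0 within S)"
proof -
  have eq: "norm ((1 / norm (t - t0)) *\<^sub>R (u t - (u t0 + (t - t0) *\<^sub>R D))) = norm ((u t - u t0) / of_real (t - t0) - D)"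
    if t: "t \<noteq> t0" for t
  proof -
    define c where "c = complex_of_real (t - t0)"
    have c: "c \<noteq> 0" "norm c = norm (t - t0)" using t by (auto simp: c_def simp del: of_real_diff)
    have "(u t - u t0) / c - D = (u t - (u t0 + c * D)) / c"
      using c by (simp add: diff_divide_distrib add_divide_distrib)
    moreover have "(t - t0) *\<^sub>R D = c * D" by (simp only: scaleR_conv_of_real c_def)
    ultimately show ?thesis
      by (simp only: norm_scaleR norm_divide c(2) flip: c_def) simp
  qed
  have "((\<lambda>t. norm ((1 / norm (t - t0)) *\<^sub>R (u t - (u t0 + (t - t0) *\<^sub>R D)))) \<longlongrightarrow> 0) (at t0 within S)
     \<longleftrightarrow> ((\<lambda>t. norm ((u t - u t0) / of_real (t - t0) - D)) \<longlongrightarrow> 0) (at t0 within S)"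
    by (rule Lim_cong_within) (use eq in auto)
  then show ?thesis
    unfolding has_vector_derivative_def has_derivative_within tendsto_norm_zero_iff Lim_null[of _ D]
    by (simp only: bounded_linear_scaleR_left simp_thms)
qed

lemmas has_vector_derivative_quotientI = has_vector_derivative_iff_quotient[THEN iffD2]
lemmas has_vector_derivative_quotientD = has_vector_derivative_iff_quotient[THEN iffD1]

text \<open>No local inverse of \<open>A\<close> is constructed. Caratheodory's factor
  \<open>g\<close>, continuous and nonzero at the point, can be divided out along the curve.\<close>

lemma has_vector_derivative_inverse_comp:
  fixes u :: "real \<Rightarrow> complex"
  assumes A: "(A has_field_derivative Q) (at (u t0))" "Q \<noteq> 0"
    and u: "(u \<longlongrightarrow> u t0) (at t0 within S)"
    and Au: "((\<lambda>t. A (u t)) has_vector_derivative D) (at t0 within S)"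
  shows "(u has_vector_derivative D / Q) (at t0 within S)"
proof (rule has_vector_derivative_quotientI)
  obtain g where g: "\<And>z. A z - A (u t0) = g z * (z - u t0)" "isCont g (u t0)" "g (u t0) = Q"
    using A(1) unfolding CARAT_DERIV by blast
  have gu: "((\<lambda>t. g (u t)) \<longlongrightarrow> Q) (at t0 within S)"
    using isCont_tendsto_compose[OF g(2) u] g(3) by simp
  have "((\<lambda>t. ((A (u t) - A (u t0)) / of_real (t - t0)) / g (u t)) \<longlongrightarrow> D / Q) (at t0 within S)"
    by (intro tendsto_divide has_vector_derivative_quotientD[OF Au] gu A)
  moreover have "eventually (\<lambda>t. ((A (u t) - A (u t0)) / of_real (t - t0)) / g (u t) = (u t - u t0) / of_real (t - t0)) (at t0 within S)"
    using tendsto_imp_eventually_ne[OF gu A(2)] by eventually_elim (simp add: g)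
  ultimately show "((\<lambda>t. (u t - u t0) / of_real (t - t0)) \<longlongrightarrow> D / Q) (at t0 within S)"
    by (rule Lim_transform_eventually)
qed

locale disc_semigroup =
  fixes \<phi> :: "real \<Rightarrow> complex \<Rightarrow> complex"
  assumes self_map_semigroup: "self_map_semigroup \<phi>"
begin

lemmas semigroup_facts = self_map_semigroup[unfolded self_map_semigroup_def]

lemma holo: "0 \<le> t \<Longrightarrow> \<phi> t holomorphic_on ball 0 1"
  and self_map: "0 \<le> t \<Longrightarrow> \<phi> t ` ball 0 1 \<subseteq> ball 0 1"
  using semigroup_facts[THEN conjunct1] by blast+

lemma in_disc: "0 \<le> t \<Longrightarrow> norm z < 1 \<Longrightarrow> norm (\<phi> t z) < 1"
  using self_map[of t] by (auto simp: image_subset_iff)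

lemma zero: "norm z < 1 \<Longrightarrow> \<phi> 0 z = z"
  by (rule semigroup_facts[THEN conjunct2, THEN conjunct1, rule_format]) simp

lemma add: "0 \<le> t \<Longrightarrow> 0 \<le> s \<Longrightarrow> norm z < 1 \<Longrightarrow> \<phi> t (\<phi> s z) = \<phi> (t + s) z"
  by (rule semigroup_facts[THEN conjunct2, THEN conjunct2, THEN conjunct1, rule_format]) simp_all

lemma lim: "norm z < 1 \<Longrightarrow> ((\<lambda>t. \<phi> t z) \<longlongrightarrow> z) (at_right 0)"
  by (rule semigroup_facts[THEN conjunct2, THEN conjunct2, THEN conjunct2, rule_format]) simp

text \<open>The constant is independent of \<open>t\<close> because all the maps are bounded by 1.
  This equicontinuity upgrades the pointwise continuity at time 0.\<close>

lemma lipschitz: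
  assumes "0 \<le> t" "r < 1" "norm z \<le> r" "norm w \<le> r"
  shows "norm (\<phi> t z - \<phi> t w) \<le> 2 / (1 - r) * norm (z - w)"
  using bounded_holomorphic_lipschitz[OF holo[OF assms(1)], of 1 r z w] in_disc[OF assms(1)] assms
  by (auto intro: less_imp_le)

text \<open>For \<open>s < t\<close> the points \<open>\<phi> t z\<close> and
  \<open>\<phi> s z\<close> are the images under \<open>\<phi> s\<close> of
  \<open>\<phi> (t - s) z\<close> and \<open>z\<close>. Right continuity at time 0 thus yields
  two-sided continuity, uniformly over all times.\<close>

lemma uniformly_continuous_time:
  assumes z: "norm z < 1" and e: "0 < e"
  obtains d where "0 < d" "\<And>s t. 0 \<le> s \<Longrightarrow> 0 \<le> t \<Longrightarrow> \<bar>t - s\<bar> < d \<Longrightarrow> norm (\<phi> t z - \<phi> s z) < e"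
proof -
  define r where "r = (1 + norm z) / 2"
  have r: "norm z < r" "r < 1" using z by (auto simp: r_def)
  \<comment> \<open>The first bound keeps the moved point within radius \<open>r\<close>, the second
    cancels the Lipschitz constant there.\<close>
  define e' where "e' = min (r - norm z) (e * (1 - r) / 2)"
  have e': "0 < e'" using r e by (auto simp: e'_def)
  have "eventually (\<lambda>t. dist (\<phi> t z) z < e') (at_right 0)"
    using lim[OF z] e' by (rule tendstoD)
  then obtain d where d: "0 < d" "\<And>h. 0 < h \<Longrightarrow> h < d \<Longrightarrow> dist (\<phi> h z) z < e'"
    unfolding eventually_at_right_field by auto
  have *: "norm (\<phi> t z - \<phi> s z) < e" if st: "0 \<le> s" "s < t" "t - s < d" for s t
  proof -
    have dh: "norm (\<phi> (t - s) z - z) < e'" using d(2)[of "t - s"] st by (simp add: dist_norm)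
    then have "norm (\<phi> (t - s) z) \<le> r"
      using norm_triangle_ineq2[of "\<phi> (t - s) z" z] by (simp add: e'_def)
    then have "norm (\<phi> s (\<phi> (t - s) z) - \<phi> s z) \<le> 2 / (1 - r) * norm (\<phi> (t - s) z - z)"
      using st r by (intro lipschitz) auto
    also have "\<dots> < 2 / (1 - r) * (e * (1 - r) / 2)"
      using dh r by (intro mult_strict_left_mono) (auto simp: e'_def)
    also have "\<dots> = e" using r by simp
    finally show ?thesis using add[of s "t - s" z] st z by simp
  qed
  show ?thesis
  proof (rule that[OF d(1)])
    fix s t :: real assume "0 \<le> s" "0 \<le> t" "\<bar>t - s\<bar> < d"
    then show "norm (\<phi> t z - \<phi> s z) < e"
      using *[of s t] *[of t s] e by (cases s t rule: linorder_cases) (auto simp: norm_minus_commute)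
  qed
qed

lemma continuous_on_joint: "continuous_on ({0..} \<times> ball 0 1) (\<lambda>(t, z). \<phi> t z)"
  unfolding continuous_on_iff
proof (intro ballI allI impI)
  fix x :: "real \<times> complex" and e :: real assume x: "x \<in> {0..} \<times> ball 0 1" and e: "0 < e"
  obtain t0 z0 where [simp]: "x = (t0, z0)" by (cases x)
  have t0: "0 \<le> t0" and z0: "norm z0 < 1" using x by auto
  define r where "r = (1 + norm z0) / 2"
  have r: "norm z0 < r" "r < 1" using z0 by (auto simp: r_def)
  obtain d where d: "0 < d" "\<And>s t. 0 \<le> s \<Longrightarrow> 0 \<le> t \<Longrightarrow> \<bar>t - s\<bar> < d \<Longrightarrow> norm (\<phi> t z0 - \<phi> s z0) < e / 2"
    by (rule uniformly_continuous_time[OF z0, of "e / 2"]) (use e in simp, rule that)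
  define d' where "d' = min d (min (r - norm z0) (e / 2 * ((1 - r) / 2)))"
  have d': "0 < d'" using d r e by (simp add: d'_def)
  show "\<exists>d>0. \<forall>x'\<in>{0..} \<times> ball 0 1. dist x' x < d \<longrightarrow> dist (case x' of (t, z) \<Rightarrow> \<phi> t z) (case x of (t, z) \<Rightarrow> \<phi> t z) < e"
  proof (intro exI[of _ d'] conjI d' ballI impI)
    fix x' :: "real \<times> complex" assume x': "x' \<in> {0..} \<times> ball 0 1" and dist: "dist x' x < d'"
    obtain t z where [simp]: "x' = (t, z)" by (cases x')
    have t: "0 \<le> t" using x' by auto
    have dt: "\<bar>t - t0\<bar> < d'" using dist dist_fst_le[of x' x] by (simp add: dist_real_def)
    have dz: "norm (z - z0) < d'" using dist dist_snd_le[of x' x] by (simp add: dist_norm)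
    have "norm z \<le> r" using dz norm_triangle_ineq2[of z z0] by (simp add: d'_def)
    then have "norm (\<phi> t z - \<phi> t z0) \<le> 2 / (1 - r) * norm (z - z0)"
      using t r by (intro lipschitz) auto
    also have "\<dots> < 2 / (1 - r) * (e / 2 * ((1 - r) / 2))"
      using dz r by (intro mult_strict_left_mono) (auto simp: d'_def)
    also have "\<dots> = e / 2" using r by simp
    finally have "norm (\<phi> t z - \<phi> t z0) < e / 2" .
    moreover have "norm (\<phi> t z0 - \<phi> t0 z0) < e / 2"
      using dt t t0 by (intro d) (auto simp: d'_def)
    ultimately have "norm (\<phi> t z - \<phi> t0 z0) < e"
      using norm_triangle_ineq[of "\<phi> t z - \<phi> t z0" "\<phi> t z0 - \<phi> t0 z0"] by simp
    then show "dist (case x' of (t, z) \<Rightarrow> \<phi> t z) (case x of (t, z) \<Rightarrow> \<phi> t z) < e"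
      by (simp add: dist_norm)
  qed
qed

lemma continuous_on_time:
  assumes "norm z < 1" shows "continuous_on {0..} (\<lambda>t. \<phi> t z)"
proof -
  have "continuous_on {0..} ((\<lambda>(t, z). \<phi> t z) \<circ> (\<lambda>t. (t, z)))"
    by (intro continuous_on_compose continuous_intros continuous_on_subset[OF continuous_on_joint])
       (use assms in auto)
  then show ?thesis by (simp add: o_def)
qed

lemma uniformly_near_identity:
  assumes r: "r < 1" "0 < e"
  obtains d where "0 < d" "\<And>s z. 0 \<le> s \<Longrightarrow> s \<le> d \<Longrightarrow> norm z \<le> r \<Longrightarrow> norm (\<phi> s z - z) < e"
proof -
  have "uniformly_continuous_on ({0..1} \<times> cball 0 r) (\<lambda>(t, z). \<phi> t z)"
    by (intro compact_uniformly_continuous compact_Times continuous_on_subset[OF continuous_on_joint])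
       (use r in auto)
  then obtain d where d: "0 < d" "\<And>x x'. x \<in> {0..1} \<times> cball 0 r \<Longrightarrow> x' \<in> {0..1} \<times> cball 0 r \<Longrightarrow> dist x' x < d
      \<Longrightarrow> dist (case x' of (t, z) \<Rightarrow> \<phi> t z) (case x of (t, z) \<Rightarrow> \<phi> t z) < e"
    using r unfolding uniformly_continuous_on_def by meson
  show ?thesis
  proof (rule that[of "min (d / 2) 1"])
    fix s :: real and z :: complex assume s: "0 \<le> s" "s \<le> min (d / 2) 1" and z: "norm z \<le> r"
    have "dist (\<phi> s z) (\<phi> 0 z) < e"
      using d(2)[of "(0, z)" "(s, z)"] s z d(1) by (simp add: dist_Pair_Pair)
    then show "norm (\<phi> s z - z) < e" using z r by (simp add: zero dist_norm)
  qed (use d in simp)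
qed

text \<open>The time average \<open>A w = \<integral>\<^sub>0\<^sup>\<delta> \<phi>\<^sub>s w ds\<close> is differentiable along orbits by the fundamental theorem
  and locally invertible for small \<open>\<delta>\<close>; this makes the orbits themselves differentiable.\<close>

lemma orbit_differentiable:
  assumes z: "norm z < 1" and t0: "0 \<le> t0"
  shows "\<exists>D. ((\<lambda>t. \<phi> t z) has_vector_derivative D) (at t0 within {0..})"
proof -
  define w0 where "w0 = \<phi> t0 z"
  have w0: "norm w0 < 1" unfolding w0_def by (rule in_disc[OF t0 z])
  define \<rho> where "\<rho> = (1 - norm w0) / 2"
  have \<rho>: "0 < \<rho>" "norm w0 + \<rho> < 1" using w0 by (auto simp: \<rho>_def field_simps)
  \<comment> \<open>With this accuracy \<open>bounded_holomorphic_lipschitz\<close> gives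
    \<open>\<phi> s u - u\<close> the Lipschitz constant
    \<open>2 * (\<rho> / 8) / (\<rho> - \<rho> / 2) = 1 / 2\<close> on the disc of half the radius,
    which keeps the derivative of \<open>A\<close> away from 0.\<close>
  have "0 < \<rho> / 8" using \<rho> by simp
  from uniformly_near_identity[OF \<rho>(2) this]
  obtain \<delta> where \<delta>: "0 < \<delta>" "\<And>s u. 0 \<le> s \<Longrightarrow> s \<le> \<delta> \<Longrightarrow> norm u \<le> norm w0 + \<rho> \<Longrightarrow> norm (\<phi> s u - u) < \<rho> / 8"
    by blast
  have near: "norm u \<le> norm w0 + \<rho>" if "u \<in> cball w0 \<rho>" for u
    using that norm_triangle_ineq2[of u w0] by (simp add: dist_norm norm_minus_commute)
  have lip: "norm ((\<phi> s u - \<phi> s w0) - (u - w0)) \<le> 1 / 2 * norm (u - w0)"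
    if s: "0 \<le> s" "s \<le> \<delta>" and u: "u \<in> cball w0 (\<rho> / 2)" for s u
  proof -
    have "norm ((\<phi> s u - u) - (\<phi> s w0 - w0)) \<le> 2 * (\<rho> / 8) / (\<rho> - \<rho> / 2) * norm (u - w0)"
    proof (rule bounded_holomorphic_lipschitz)
      have "ball w0 \<rho> \<subseteq> ball 0 1"
      proof
        fix u assume "u \<in> ball w0 \<rho>"
        then show "u \<in> ball 0 1" using near[of u] \<rho> by simp
      qed
      then show "(\<lambda>u. \<phi> s u - u) holomorphic_on ball w0 \<rho>"
        using holo[OF s(1)] by (intro holomorphic_intros) (rule holomorphic_on_subset)
      show "norm (\<phi> s u - u) \<le> \<rho> / 8" if "u \<in> ball w0 \<rho>" for u
        using \<delta>(2)[OF s near] that by (auto intro: less_imp_le)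
    qed (use \<rho> u in auto)
    also have "2 * (\<rho> / 8) / (\<rho> - \<rho> / 2) = 1 / 2" using \<rho> by (simp add: field_simps)
    finally show ?thesis by (simp add: algebra_simps)
  qed
  define A where "A = (\<lambda>u. integral {0..\<delta>} (\<lambda>s. \<phi> s u))"
  have cont: "continuous_on {a..b} (\<lambda>s. \<phi> s u)" if "0 \<le> a" "norm u < 1" for a b u
    using continuous_on_time[OF that(2)] by (rule continuous_on_subset) (use that in auto)
  define d where "d = (\<lambda>s. deriv (\<phi> s) w0)"
  define Q where "Q = integral {0..\<delta>} d"
  \<comment> \<open>The difference quotients of \<open>A\<close> are integrals of those of
    \<open>\<phi> s\<close>, which \<open>lip\<close> bounds by 3/2. Dominated convergence gives the
    limit and, as a by-product, integrability of \<open>d\<close>, for which no regularity in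
    \<open>s\<close> is at hand.\<close>
  have quot: "(\<lambda>n. (A (X n) - A w0) / (X n - w0)) \<longlonglongrightarrow> Q \<and> d integrable_on {0..\<delta>}"
    if X: "\<And>n. X n \<noteq> w0" "\<And>n. X n \<in> cball w0 (\<rho> / 2)" "X \<longlonglongrightarrow> w0" for X
  proof -
    have Xd: "norm (X n) < 1" for n
    proof -
      have "X n \<in> cball w0 \<rho>" using X(2)[of n] \<rho> by simp
      then show ?thesis using near[of "X n"] \<rho> by linarith
    qed
    define q where "q = (\<lambda>n s. (\<phi> s (X n) - \<phi> s w0) / (X n - w0))"
    have int: "(\<lambda>s. \<phi> s u) integrable_on {0..\<delta>}" if "norm u < 1" for u
      by (intro integrable_continuous_real cont that) simp
    have qi: "q n integrable_on {0..\<delta>}" for n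
      unfolding q_def by (intro integrable_continuous_real continuous_intros cont Xd w0) (use X in auto)
    have Aq: "(A (X n) - A w0) / (X n - w0) = integral {0..\<delta>} (q n)" for n
      unfolding A_def q_def
      by (simp add: Henstock_Kurzweil_Integration.integral_diff[OF int[OF Xd] int[OF w0], symmetric])
    have qb: "norm (q n s) \<le> 3 / 2" if "s \<in> {0..\<delta>}" for n s
    proof -
      have "norm (\<phi> s (X n) - \<phi> s w0) \<le> norm ((\<phi> s (X n) - \<phi> s w0) - (X n - w0)) + norm (X n - w0)"
        by (metis diff_add_cancel norm_triangle_ineq)
      also have "\<dots> \<le> 3 / 2 * norm (X n - w0)" using lip[of s "X n"] that X(2)[of n] by simp
      finally show ?thesis using X(1)[of n] by (simp add: q_def norm_divide field_simps)
    qed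
    have ql: "(\<lambda>n. q n s) \<longlonglongrightarrow> d s" if "s \<in> {0..\<delta>}" for s
    proof -
      have "(\<phi> s has_field_derivative d s) (at w0)"
        unfolding d_def using that w0 by (intro holomorphic_derivI[OF holo open_ball]) auto
      then have "((\<lambda>u. (\<phi> s u - \<phi> s w0) / (u - w0)) \<longlongrightarrow> d s) (at w0)"
        by (simp add: has_field_derivative_iff)
      moreover have "filterlim X (at w0) sequentially"
        using X by (auto simp: filterlim_at intro: always_eventually)
      ultimately show ?thesis unfolding q_def by (rule filterlim_compose)
    qed
    have hi: "(\<lambda>_. 3 / 2 :: real) integrable_on {0..\<delta>}" by (intro integrable_continuous_real continuous_intros)
    show ?thesis
      unfolding Aq Q_def using dominated_convergence[OF qi hi qb ql] by blast
  qed
  have A_deriv: "(A has_field_derivative Q) (at w0)"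
    unfolding has_field_derivative_iff tendsto_at_iff_sequentially
  proof (intro allI impI)
    fix X :: "nat \<Rightarrow> complex" assume X: "\<forall>i. X i \<in> UNIV - {w0}" "X \<longlonglongrightarrow> w0"
    have "eventually (\<lambda>n. X n \<in> ball w0 (\<rho> / 2)) sequentially"
      using X(2) \<rho> by (intro topological_tendstoD) auto
    then obtain n0 where n0: "\<forall>n\<ge>n0. X n \<in> ball w0 (\<rho> / 2)" unfolding eventually_sequentially by blast
    have "(\<lambda>n. (A (X (n + n0)) - A w0) / (X (n + n0) - w0)) \<longlonglongrightarrow> Q"
      by (rule quot[THEN conjunct1])
         (use X n0 LIMSEQ_ignore_initial_segment[OF X(2)] in \<open>auto intro: less_imp_le\<close>)
    then show "((\<lambda>y. (A y - A w0) / (y - w0)) \<circ> X) \<longlonglongrightarrow> Q"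
      unfolding o_def by (rule LIMSEQ_offset)
  qed
  have "Q \<noteq> 0"
  proof
    assume "Q = 0"
    \<comment> \<open>This concrete sequence only supplies the integrability of \<open>d\<close>.
      The contradiction is that each \<open>d s\<close> lies within 1/2 of 1, so \<open>Q\<close>
      lies within \<open>\<delta> / 2\<close> of \<open>\<delta>\<close>.\<close>
    define X where "X = (\<lambda>n. w0 + of_real (\<rho> / 2 / Suc n))"
    have "(\<lambda>n. \<rho> / 2 * (1 / real (Suc n))) \<longlonglongrightarrow> \<rho> / 2 * 0"
      by (intro tendsto_mult tendsto_const LIMSEQ_Suc[OF lim_1_over_n])
    then have "(\<lambda>n. \<rho> / 2 / real (Suc n)) \<longlonglongrightarrow> 0" by simp
    then have Xl: "X \<longlonglongrightarrow> w0 + of_real 0"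
      unfolding X_def by (intro tendsto_intros)
    have nX: "norm (X n - w0) = \<rho> / 2 / real (Suc n)" for n
      using \<rho> unfolding X_def add_diff_cancel_left' norm_of_real by simp
    have X_ne: "X n \<noteq> w0" for n
    proof -
      have "0 < norm (X n - w0)" unfolding nX using \<rho> by simp
      then show ?thesis by auto
    qed
    have X_in: "X n \<in> cball w0 (\<rho> / 2)" for n
    proof -
      have "\<rho> / 2 / real (Suc n) \<le> \<rho> / 2 / 1" using \<rho> by (intro divide_left_mono) auto
      then show ?thesis using nX[of n] by (simp add: dist_norm norm_minus_commute)
    qed
    have di: "d integrable_on {0..\<delta>}"
      using quot[OF X_ne X_in] Xl by simp
    have "norm (d s - 1) \<le> 1 / 2" if s: "s \<in> {0..\<delta>}" for s
    proof -
      have "(\<phi> s has_field_derivative d s) (at w0)"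
        unfolding d_def using s w0 by (intro holomorphic_derivI[OF holo open_ball]) auto
      then have "((\<lambda>u. (\<phi> s u - \<phi> s w0) / (u - w0)) \<longlongrightarrow> d s) (at w0)"
        by (simp add: has_field_derivative_iff)
      then have "((\<lambda>u. norm ((\<phi> s u - \<phi> s w0) / (u - w0) - 1)) \<longlongrightarrow> norm (d s - 1)) (at w0)"
        by (intro tendsto_intros)
      moreover have "eventually (\<lambda>u. norm ((\<phi> s u - \<phi> s w0) / (u - w0) - 1) \<le> 1 / 2) (at w0)"
      proof (rule eventually_mono)
        show "eventually (\<lambda>u. u \<in> ball w0 (\<rho> / 2) \<and> u \<noteq> w0) (at w0)"
          using \<rho> eventually_at_in_open[of "ball w0 (\<rho> / 2)" w0] by (simp add: conj_commute)
        fix u assume u: "u \<in> ball w0 (\<rho> / 2) \<and> u \<noteq> w0"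
        have "(\<phi> s u - \<phi> s w0) / (u - w0) - 1 = ((\<phi> s u - \<phi> s w0) - (u - w0)) / (u - w0)"
          using u by (simp add: diff_divide_distrib)
        then show "norm ((\<phi> s u - \<phi> s w0) / (u - w0) - 1) \<le> 1 / 2"
          using lip[of s u] u s by (simp add: norm_divide field_simps)
      qed
      ultimately show ?thesis by (rule tendsto_upperbound) simp
    qed
    then have "norm (integral {0..\<delta>} (\<lambda>s. d s - 1)) \<le> integral {0..\<delta>} (\<lambda>s. 1 / 2)"
      by (intro Henstock_Kurzweil_Integration.integral_norm_bound_integral integrable_diff di) auto
    moreover have "integral {0..\<delta>} (\<lambda>s. d s - 1) = Q - of_real \<delta>"
    proof -
      have "integral {0..\<delta>} (\<lambda>s. d s - 1) = integral {0..\<delta>} d - integral {0..\<delta>} (\<lambda>s. 1)"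
        by (intro Henstock_Kurzweil_Integration.integral_diff di integrable_continuous_real continuous_intros)
      then show ?thesis using \<delta>(1) by (simp add: Q_def scaleR_conv_of_real)
    qed
    ultimately show False using \<open>Q = 0\<close> \<delta> by simp
  qed
  define J where "J = (\<lambda>t. integral {0..t} (\<lambda>s. \<phi> s z))"
  have J: "(J has_vector_derivative \<phi> t z) (at t within {0..t + 1})" if "0 \<le> t" for t
    unfolding J_def using that by (intro integral_has_vector_derivative cont z) auto
  have J': "(J has_vector_derivative \<phi> t z) (at t within {0..})" if "0 \<le> t" for t
  proof -
    have "at t within {0..} = at t within {0..t + 1}"
      by (rule at_within_nhd[of _ "{..<t + 1}"]) (use that in auto)
    then show ?thesis using J[OF that] by simp
  qed
  \<comment> \<open>By the semigroup law, the average taken at the moving point is an integral of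
    one fixed orbit over the window from \<open>t\<close> to \<open>t + \<delta>\<close>, hence
    differentiable in \<open>t\<close>.\<close>
  have AJ: "A (\<phi> t z) = J (t + \<delta>) - J t" if t: "0 \<le> t" for t
  proof -
    have "A (\<phi> t z) = integral {0..\<delta>} (\<lambda>s. \<phi> (s + t) z)"
      unfolding A_def by (intro Henstock_Kurzweil_Integration.integral_cong) (use t z add in auto)
    also have "\<dots> = integral {t..t + \<delta>} (\<lambda>s. \<phi> s z)"
      using integral_shift_real_ivl[of t t "t + \<delta>" "\<lambda>s. \<phi> s z"] by simp
    also have "\<dots> = J (t + \<delta>) - J t"
      unfolding J_def using Henstock_Kurzweil_Integration.integral_combine[of 0 t "t + \<delta>" "\<lambda>s. \<phi> s z"] t \<delta> z
      by (simp add: integrable_continuous_real cont algebra_simps)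
    finally show ?thesis .
  qed
  have "((\<lambda>t. A (\<phi> t z)) has_vector_derivative \<phi> (t0 + \<delta>) z - \<phi> t0 z) (at t0 within {0..})"
  proof (rule has_vector_derivative_transform)
    have "(J has_vector_derivative \<phi> (t0 + \<delta>) z) (at (t0 + \<delta>) within (\<lambda>t. t + \<delta>) ` {0..})"
      by (rule has_vector_derivative_within_subset[OF J']) (use t0 \<delta>(1) in auto)
    then have "(J \<circ> (\<lambda>t. t + \<delta>) has_vector_derivative 1 *\<^sub>R \<phi> (t0 + \<delta>) z) (at t0 within {0..})"
      by (intro vector_diff_chain_within) (auto intro!: derivative_eq_intros)
    then show "((\<lambda>t. J (t + \<delta>) - J t) has_vector_derivative \<phi> (t0 + \<delta>) z - \<phi> t0 z) (at t0 within {0..})"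
      using J'[OF t0] by (intro has_vector_derivative_diff) (auto simp: o_def)
  qed (use AJ t0 in auto)
  then have "((\<lambda>t. \<phi> t z) has_vector_derivative (\<phi> (t0 + \<delta>) z - \<phi> t0 z) / Q) (at t0 within {0..})"
    using A_deriv \<open>Q \<noteq> 0\<close> continuous_on_time[OF z] t0
    by (intro has_vector_derivative_inverse_comp[where A=A]) (auto simp: w0_def continuous_on)
  then show ?thesis by blast
qed

text \<open>\<open>Lim\<close> says something only once a limit exists; differentiability of the
  orbit at time 0 provides it.\<close>

lemma generator_limit:
  assumes z: "norm z < 1"
  shows "((\<lambda>t. (\<phi> t z - z) / of_real t) \<longlongrightarrow> infinitesimal_generator \<phi> z) (at_right 0)"
proof -
  obtain D where "((\<lambda>t. \<phi> t z) has_vector_derivative D) (at 0 within {0..})"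
    using orbit_differentiable[OF z, of 0] by auto
  from has_vector_derivative_quotientD[OF this]
  have "((\<lambda>t. (\<phi> t z - z) / of_real t) \<longlongrightarrow> D) (at 0 within {0..})" using z by (simp add: zero)
  then have "((\<lambda>t. (\<phi> t z - z) / of_real t) \<longlongrightarrow> D) (at_right 0)"
    by (rule tendsto_within_subset) auto
  moreover from this have "infinitesimal_generator \<phi> z = D"
    unfolding infinitesimal_generator_def by (intro tendsto_Lim) auto
  ultimately show ?thesis by simp
qed

text \<open>The derivative is already known to exist, so the right-hand quotient identifies it; for
  \<open>h \<ge> 0\<close> the semigroup law rewrites that quotient as one starting from
  \<open>\<phi> t0 z\<close>.\<close>

lemma orbit_derivative:
  assumes z: "norm z < 1" and t0: "0 \<le> t0"
  shows "((\<lambda>t. \<phi> t z) has_vector_derivative infinitesimal_generator \<phi> (\<phi> t0 z)) (at t0 within {0..})"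
proof -
  obtain D where D: "((\<lambda>t. \<phi> t z) has_vector_derivative D) (at t0 within {0..})"
    using orbit_differentiable[OF z t0] by auto
  have "((\<lambda>t. (\<phi> t z - \<phi> t0 z) / of_real (t - t0)) \<longlongrightarrow> D) (at_right t0)"
    using has_vector_derivative_quotientD[OF D] by (rule tendsto_within_subset) (use t0 in auto)
  then have "((\<lambda>h. (\<phi> (h + t0) z - \<phi> t0 z) / of_real h) \<longlongrightarrow> D) (at_right 0)"
    by (subst (asm) filterlim_at_right_to_0) simp
  moreover have "eventually (\<lambda>h. (\<phi> (h + t0) z - \<phi> t0 z) / of_real h = (\<phi> h (\<phi> t0 z) - \<phi> t0 z) / of_real h) (at_right 0)"
    unfolding eventually_at_right_field using add[OF _ t0 z] by (intro exI[of _ 1]) auto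
  ultimately have "((\<lambda>h. (\<phi> h (\<phi> t0 z) - \<phi> t0 z) / of_real h) \<longlongrightarrow> D) (at_right 0)"
    by (rule Lim_transform_eventually)
  then have "infinitesimal_generator \<phi> (\<phi> t0 z) = D"
    by (rule tendsto_unique[OF _ generator_limit[OF in_disc[OF t0 z]], rotated]) simp
  with D show ?thesis by simp
qed

lemma trivial_if_generator_zero:
  assumes "\<And>z. norm z < 1 \<Longrightarrow> infinitesimal_generator \<phi> z = 0"
  shows "trivial_semigroup \<phi>"
  unfolding trivial_semigroup_def
proof (intro allI impI ballI)
  fix t :: real and z :: complex assume t: "0 \<le> t" and "z \<in> ball 0 1"
  then have z: "norm z < 1" by simp
  have "((\<lambda>t. \<phi> t z) has_vector_derivative 0) (at t within {0..})" if "t \<in> {0..}" for t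
    using orbit_derivative[OF z, of t] assms[OF in_disc[OF _ z], of t] that by simp
  then obtain c where c: "\<And>t. t \<in> {0..} \<Longrightarrow> \<phi> t z = c"
    by (rule has_vector_derivative_zero_constant[rotated]) auto
  show "\<phi> t z = z" using c[of t] c[of 0] zero[OF z] t by simp
qed

lemma compose_orbit_derivative:
  assumes f: "f holomorphic_on ball 0 1" and z: "norm z < 1" and s: "0 \<le> s"
  shows "((\<lambda>s. f (\<phi> s z)) has_vector_derivative
    infinitesimal_generator \<phi> (\<phi> s z) * deriv f (\<phi> s z)) (at s within {0..})"
proof -
  have in_s: "\<phi> s z \<in> ball 0 1" using in_disc[OF s z] by simp
  have D: "(f has_field_derivative deriv f (\<phi> s z)) (at (\<phi> s z) within (\<lambda>s. \<phi> s z) ` {0..})"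
    by (rule has_field_derivative_at_within[OF holomorphic_derivI[OF f open_ball in_s]])
  show ?thesis
    using field_vector_diff_chain_within[OF orbit_derivative[OF z s] D] by (simp add: o_def)
qed

lemma compose_generator_limit:
  assumes f: "f holomorphic_on ball 0 1" and z: "norm z < 1"
  shows "((\<lambda>t. (f (\<phi> t z) - f z) / of_real t) \<longlongrightarrow> infinitesimal_generator \<phi> z * deriv f z) (at_right 0)"
proof -
  have "((\<lambda>t. (f (\<phi> t z) - f z) / of_real t) \<longlongrightarrow> infinitesimal_generator \<phi> z * deriv f z) (at 0 within {0..})"
    using has_vector_derivative_quotientD[OF compose_orbit_derivative[OF f z order_refl]] z by (simp add: zero)
  then show ?thesis by (rule tendsto_within_subset) auto
qed

text \<open>The fundamental theorem for the Henstock-Kurzweil integral asks for no continuity of the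
  derivative, and no regularity of the generator is available here.\<close>

lemma compose_minus_has_integral:
  assumes f: "f holomorphic_on ball 0 1" and z: "norm z < 1" and t: "0 \<le> t"
  shows "((\<lambda>s. infinitesimal_generator \<phi> (\<phi> s z) * deriv f (\<phi> s z)) has_integral (f (\<phi> t z) - f z)) {0..t}"
proof -
  have "((\<lambda>s. infinitesimal_generator \<phi> (\<phi> s z) * deriv f (\<phi> s z)) has_integral (f (\<phi> t z) - f (\<phi> 0 z))) {0..t}"
  proof (rule fundamental_theorem_of_calculus[OF t])
    fix s assume s: "s \<in> {0..t}"
    then have "0 \<le> s" "{0..t} \<subseteq> {0..}" by auto
    from has_vector_derivative_within_subset[OF compose_orbit_derivative[OF f z this(1)] this(2)]
    show "((\<lambda>s. f (\<phi> s z)) has_vector_derivative infinitesimal_generator \<phi> (\<phi> s z) * deriv f (\<phi> s z)) (at s within {0..t})" .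
  qed
  then show ?thesis using z by (simp add: zero)
qed

end

section \<open>Norm inequalities\<close>

context radial_doubling_measure begin

lemma pnorm_scale: "0 \<le> p \<Longrightarrow> pnorm p (\<lambda>z. c * f z) = ennreal (norm c powr p) * pnorm p f"
  if f: "f holomorphic_on ball 0 1" for f
proof -
  assume "0 \<le> p"
  have [measurable]: "f \<in> borel_measurable \<nu>"
    by (intro borel_measurable_continuous holomorphic_on_imp_continuous_on f)
  show ?thesis
    unfolding pnorm_def
    by (subst nn_integral_cmult[symmetric]) (auto simp: norm_mult powr_mult ennreal_mult)
qed

lemma pnorm_add_finite:
  assumes "0 < p" "f holomorphic_on ball 0 1" "g holomorphic_on ball 0 1" "pnorm p f < \<infinity>" "pnorm p g < \<infinity>"
  shows "pnorm p (\<lambda>z. f z + g z) < \<infinity>"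
proof -
  note [measurable] = borel_measurable_holomorphic_powr[OF assms(2,1)] borel_measurable_holomorphic_powr[OF assms(3,1)]
  have "pnorm p (\<lambda>z. f z + g z) \<le> (\<integral>\<^sup>+z. ennreal (2 powr p) * (ennreal (norm (f z) powr p) + ennreal (norm (g z) powr p)) \<partial>\<nu>)"
    unfolding pnorm_def
  proof (rule nn_integral_mono)
    fix z
    have "ennreal (norm (f z + g z) powr p) \<le> ennreal (2 powr p * (norm (f z) powr p + norm (g z) powr p))"
      using assms(1) by (intro ennreal_leI norm_add_powr_le) simp
    then show "ennreal (norm (f z + g z) powr p) \<le> ennreal (2 powr p) * (ennreal (norm (f z) powr p) + ennreal (norm (g z) powr p))"
      by (simp add: ennreal_mult)
  qed
  also have "\<dots> = ennreal (2 powr p) * (pnorm p f + pnorm p g)"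
    unfolding pnorm_def by (subst nn_integral_cmult, measurable, subst nn_integral_add, measurable)
  also have "\<dots> < \<infinity>" using assms(4,5) by (simp add: ennreal_mult_less_top)
  finally show ?thesis .
qed

text \<open>Scaled by \<open>a + b\<close>, the sum is a convex combination of \<open>f / a\<close>
  and \<open>g / b\<close> with weights \<open>l\<close> and \<open>1 - l\<close>, and the power is
  convex. Arbitrary positive bounds instead of the norms themselves avoid division by a vanishing
  norm.\<close>

lemma pnorm_minkowski:
  assumes p: "1 \<le> p" and f: "f holomorphic_on ball 0 1" and g: "g holomorphic_on ball 0 1"
    and a: "0 < a" "pnorm p f \<le> ennreal (a powr p)" and b: "0 < b" "pnorm p g \<le> ennreal (b powr p)"
  shows "pnorm p (\<lambda>z. f z + g z) \<le> ennreal ((a + b) powr p)"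
proof -
  have p0: "0 < p" using p by simp
  note [measurable] = borel_measurable_holomorphic_powr[OF f p0] borel_measurable_holomorphic_powr[OF g p0]
  define l where "l = a / (a + b)"
  have l: "0 \<le> l" "0 \<le> 1 - l" "l * (1 / a) = 1 / (a + b)" "(1 - l) * (1 / b) = 1 / (a + b)"
    using a b by (auto simp: l_def field_simps)
  \<comment> \<open>\<open>u\<close> and \<open>v\<close> are the weights of the convex combination
    after undoing the scalings; under the two bounds the total is
    \<open>(a + b) powr p\<close>.\<close>
  define u where "u = (a + b) powr p * l / a powr p"
  define v where "v = (a + b) powr p * (1 - l) / b powr p"
  have uv: "0 \<le> u" "0 \<le> v" using l by (auto simp: u_def v_def)
  have conv: "(l * x + (1 - l) * y) powr p \<le> l * x powr p + (1 - l) * y powr p" if xy: "0 \<le> x" "0 \<le> y" for x y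
  proof -
    define m where "m = l * x + (1 - l) * y"
    have m: "0 \<le> m" using l xy by (simp add: m_def)
    have "l * (m powr p + p * m powr (p - 1) * (x - m)) + (1 - l) * (m powr p + p * m powr (p - 1) * (y - m))
      \<le> l * x powr p + (1 - l) * y powr p"
      using l xy m p by (intro add_mono mult_left_mono powr_tangent_le) auto
    moreover have "l * (m powr p + p * m powr (p - 1) * (x - m)) + (1 - l) * (m powr p + p * m powr (p - 1) * (y - m))
      = m powr p + p * m powr (p - 1) * (l * x + (1 - l) * y - m)"
      by algebra
    ultimately show ?thesis by (simp add: m_def)
  qed
  have pt: "norm (f z + g z) powr p \<le> u * norm (f z) powr p + v * norm (g z) powr p" for z
  proof -
    have "norm (f z + g z) \<le> (a + b) * (l * (norm (f z) / a) + (1 - l) * (norm (g z) / b))"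
    proof -
      have "(a + b) * (l * (norm (f z) / a) + (1 - l) * (norm (g z) / b))
          = (a + b) * (l * (1 / a)) * norm (f z) + (a + b) * ((1 - l) * (1 / b)) * norm (g z)"
        by (simp add: algebra_simps)
      also have "\<dots> = norm (f z) + norm (g z)" unfolding l using a b by simp
      finally show ?thesis using norm_triangle_ineq[of "f z" "g z"] by simp
    qed
    then have "norm (f z + g z) powr p \<le> ((a + b) * (l * (norm (f z) / a) + (1 - l) * (norm (g z) / b))) powr p"
      using p by (intro powr_mono2) auto
    also have "\<dots> = (a + b) powr p * (l * (norm (f z) / a) + (1 - l) * (norm (g z) / b)) powr p"
      by (rule powr_mult)
    also have "\<dots> \<le> (a + b) powr p * (l * (norm (f z) / a) powr p + (1 - l) * (norm (g z) / b) powr p)"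
      using a b by (intro mult_left_mono conv) auto
    also have "\<dots> = u * norm (f z) powr p + v * norm (g z) powr p"
      using a b by (simp add: u_def v_def powr_divide algebra_simps)
    finally show ?thesis .
  qed
  have "pnorm p (\<lambda>z. f z + g z) \<le> (\<integral>\<^sup>+z. ennreal u * ennreal (norm (f z) powr p) + ennreal v * ennreal (norm (g z) powr p) \<partial>\<nu>)"
    unfolding pnorm_def
  proof (rule nn_integral_mono)
    fix z
    have "ennreal (norm (f z + g z) powr p) \<le> ennreal (u * norm (f z) powr p + v * norm (g z) powr p)"
      by (rule ennreal_leI[OF pt])
    then show "ennreal (norm (f z + g z) powr p) \<le> ennreal u * ennreal (norm (f z) powr p) + ennreal v * ennreal (norm (g z) powr p)"
      using uv by (simp add: ennreal_mult)
  qed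
  also have "\<dots> = ennreal u * pnorm p f + ennreal v * pnorm p g"
    unfolding pnorm_def by (subst nn_integral_add, measurable, subst nn_integral_cmult, measurable, subst nn_integral_cmult, measurable)
  also have "\<dots> \<le> ennreal u * ennreal (a powr p) + ennreal v * ennreal (b powr p)"
    by (intro add_mono mult_left_mono a b) auto
  also have "\<dots> = ennreal (u * a powr p + v * b powr p)" using uv by (simp add: ennreal_mult)
  also have "u * a powr p + v * b powr p = (a + b) powr p"
  proof -
    have "u * a powr p = (a + b) powr p * l" "v * b powr p = (a + b) powr p * (1 - l)"
      using a(1) b(1) by (simp_all add: u_def v_def)
    then show ?thesis by (simp add: right_diff_distrib)
  qed
  finally show ?thesis .
qed

end

section \<open>Composition semigroups\<close>

text \<open>Keeping \<open>X\<close> and \<open>N\<close> as parameters lets the abstract notions be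
  applied to the original space. \<open>N\<close> is prescribed only on holomorphic functions, the
  class on which \<open>bergman_pnorm\<close> identifies it.\<close>

locale bergman_flow = radial_doubling_measure \<nu> C + disc_semigroup \<phi>
  for \<nu> C and \<phi> :: "real \<Rightarrow> complex \<Rightarrow> complex" +
  fixes p :: real and X :: "(complex \<Rightarrow> complex) set" and N :: "(complex \<Rightarrow> complex) \<Rightarrow> real"
  assumes p: "1 \<le> p"
    and X_eq: "X = {f. f holomorphic_on ball 0 1 \<and> pnorm p f < \<infinity>}"
    and N_eq: "\<And>f. f holomorphic_on ball 0 1 \<Longrightarrow> N f = enn2real (pnorm p f) powr (1 / p)"
begin

lemma p0: "0 < p" using p by simp

lemma X_holo: "f \<in> X \<Longrightarrow> f holomorphic_on ball 0 1"
  and X_fin: "f \<in> X \<Longrightarrow> pnorm p f < \<infinity>"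
  by (auto simp: X_eq)

lemma XI: "f holomorphic_on ball 0 1 \<Longrightarrow> pnorm p f < \<infinity> \<Longrightarrow> f \<in> X"
  by (simp add: X_eq)

lemma N_nonneg: "f \<in> X \<Longrightarrow> 0 \<le> N f"
  using N_eq[OF X_holo] by simp

lemma pnorm_eq_N: "f \<in> X \<Longrightarrow> pnorm p f = ennreal (N f powr p)"
  using X_fin[of f] p0 by (simp add: N_eq[OF X_holo] powr_powr ennreal_enn2real less_top)

lemma N_le_iff:
  assumes "f \<in> X" "0 \<le> a"
  shows "N f \<le> a \<longleftrightarrow> pnorm p f \<le> ennreal (a powr p)"
proof
  assume "N f \<le> a"
  then show "pnorm p f \<le> ennreal (a powr p)"
    using N_nonneg[OF assms(1)] p0 by (simp add: pnorm_eq_N[OF assms(1)] ennreal_leI powr_mono2)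
next
  assume "pnorm p f \<le> ennreal (a powr p)"
  then have le: "N f powr p \<le> a powr p" by (simp add: pnorm_eq_N[OF assms(1)])
  show "N f \<le> a"
  proof (rule ccontr)
    assume "\<not> N f \<le> a"
    then have "a powr p < N f powr p" using assms(2) p0 by (intro powr_less_mono2) auto
    with le show False by simp
  qed
qed

lemma X_cong: "f \<in> X \<Longrightarrow> (\<And>z. norm z < 1 \<Longrightarrow> f z = g z) \<Longrightarrow> g \<in> X"
  using pnorm_cong[of f g] holomorphic_cong[of "ball 0 1" "ball 0 1" f g] by (auto simp: X_eq)

lemma N_cong:
  assumes "f \<in> X" "\<And>z. norm z < 1 \<Longrightarrow> f z = g z"
  shows "N f = N g"
proof -
  have eq: "pnorm p f = pnorm p g" by (rule pnorm_cong) (rule assms(2))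
  have gX: "g \<in> X" by (rule X_cong[OF assms(1)]) (rule assms(2))
  show ?thesis
    unfolding N_eq[OF X_holo[OF assms(1)]] N_eq[OF X_holo[OF gX]] eq ..
qed

lemma X_scale:
  assumes f: "f \<in> X" shows "(\<lambda>z. c * f z) \<in> X"
proof (rule XI)
  show "(\<lambda>z. c * f z) holomorphic_on ball 0 1" by (intro holomorphic_intros X_holo[OF f])
  show "pnorm p (\<lambda>z. c * f z) < \<infinity>"
    using pnorm_scale[OF X_holo[OF f], of p c] p0 X_fin[OF f] by (simp add: ennreal_mult_less_top)
qed

lemma N_scale:
  assumes "f \<in> X" shows "N (\<lambda>z. c * f z) = norm c * N f"
proof -
  have "N (\<lambda>z. c * f z) = (norm c powr p * enn2real (pnorm p f)) powr (1 / p)"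
    using N_eq[OF X_holo[OF X_scale[OF assms]]] pnorm_scale[OF X_holo[OF assms], of p c] p0
    by (simp add: enn2real_mult)
  also have "\<dots> = norm c * N f"
    using p0 by (simp add: powr_mult powr_powr N_eq[OF X_holo[OF assms]])
  finally show ?thesis .
qed

lemma X_add:
  assumes f: "f \<in> X" and g: "g \<in> X" shows "(\<lambda>z. f z + g z) \<in> X"
proof (rule XI)
  show "(\<lambda>z. f z + g z) holomorphic_on ball 0 1"
    by (intro holomorphic_intros X_holo[OF f] X_holo[OF g])
  show "pnorm p (\<lambda>z. f z + g z) < \<infinity>"
    by (rule pnorm_add_finite[OF p0 X_holo[OF f] X_holo[OF g] X_fin[OF f] X_fin[OF g]])
qed

lemma X_diff: "f \<in> X \<Longrightarrow> g \<in> X \<Longrightarrow> (\<lambda>z. f z - g z) \<in> X"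
  using X_add[of f "\<lambda>z. (-1) * g z"] X_scale[of g "-1"] by simp

lemma N_triangle:
  assumes f: "f \<in> X" and g: "g \<in> X"
  shows "N (\<lambda>z. f z + g z) \<le> N f + N g"
proof (rule field_le_epsilon)
  fix e :: real assume e: "0 < e"
  \<comment> \<open>The added \<open>e / 2\<close> supplies the strictly positive bounds that
    \<open>pnorm_minkowski\<close> requires, even if a norm vanishes.\<close>
  define a b where "a = N f + e / 2" and "b = N g + e / 2"
  have a: "0 < a" "N f \<le> a" and b: "0 < b" "N g \<le> b"
    using N_nonneg[OF f] N_nonneg[OF g] e by (auto simp: a_def b_def)
  have "pnorm p (\<lambda>z. f z + g z) \<le> ennreal ((a + b) powr p)"
    using N_le_iff[OF f, of a] N_le_iff[OF g, of b] a b
    by (intro pnorm_minkowski p X_holo f g) auto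
  then have "N (\<lambda>z. f z + g z) \<le> a + b"
    using N_le_iff[OF X_add[OF f g], of "a + b"] a b by simp
  then show "N (\<lambda>z. f z + g z) \<le> N f + N g + e" by (simp add: a_def b_def)
qed

lemma N_triangle_diff:
  assumes f: "f \<in> X" and g: "g \<in> X"
  shows "N (\<lambda>z. f z - g z) \<le> N f + N g"
  using N_triangle[OF f X_scale[OF g], of "-1"] N_scale[OF g, of "-1"] by simp

lemma point_evaluation:
  assumes "0 \<le> r" "r < 1"
  obtains K where "0 \<le> K" "\<And>f w. f \<in> X \<Longrightarrow> norm w \<le> r \<Longrightarrow> norm (f w) \<le> K * N f"
proof -
  obtain K0 :: real where K0: "0 < K0"
    "\<And>f w. f holomorphic_on ball 0 1 \<Longrightarrow> norm w \<le> r \<Longrightarrow> ennreal (norm (f w) powr p) \<le> ennreal K0 * pnorm p f"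
    by (rule pnorm_point_evaluation[OF p assms]) (rule that)
  show ?thesis
  proof (rule that[of "K0 powr (1 / p)"])
    fix f and w :: complex assume f: "f \<in> X" and w: "norm w \<le> r"
    have "ennreal (norm (f w) powr p) \<le> ennreal (K0 * N f powr p)"
      using K0(2)[OF X_holo[OF f] w] K0(1) by (simp add: pnorm_eq_N[OF f] ennreal_mult)
    then have "norm (f w) powr p \<le> K0 * N f powr p" using K0(1) by (simp add: ennreal_le_iff)
    then have "(norm (f w) powr p) powr (1 / p) \<le> (K0 * N f powr p) powr (1 / p)"
      using p0 by (intro powr_mono2) auto
    then show "norm (f w) \<le> K0 powr (1 / p) * N f"
      using p0 K0(1) N_nonneg[OF f] by (simp add: powr_mult powr_powr)
  qed simp
qed

lemma tendsto_NI:
  assumes lim: "((\<lambda>t. pnorm p (h t)) \<longlongrightarrow> 0) F" and h: "eventually (\<lambda>t. h t holomorphic_on ball 0 1) F"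
  shows "((\<lambda>t. N (h t)) \<longlongrightarrow> 0) F"
proof -
  have "((\<lambda>t. enn2real (pnorm p (h t))) \<longlongrightarrow> enn2real 0) F"
    using lim by (intro tendsto_enn2real) auto
  then have "((\<lambda>t. enn2real (pnorm p (h t)) powr (1 / p)) \<longlongrightarrow> 0) F"
    using p0 by (intro tendsto_zero_powrI[where b="1 / p"]) auto
  moreover have "eventually (\<lambda>t. enn2real (pnorm p (h t)) powr (1 / p) = N (h t)) F"
    using h by eventually_elim (simp add: N_eq)
  ultimately show ?thesis by (rule Lim_transform_eventually)
qed

abbreviation "\<Phi> \<equiv> composition_semigroup \<phi>"

lemma composition_apply: "\<Phi> t f z = f (\<phi> t z)"
  by (simp add: composition_semigroup_def)

lemma compose_holo: "f holomorphic_on ball 0 1 \<Longrightarrow> 0 \<le> t \<Longrightarrow> \<Phi> t f holomorphic_on ball 0 1"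
  unfolding composition_semigroup_def
  using holomorphic_on_compose_gen[OF holo _ self_map, of t f] by simp

lemma bounded_composition:
  assumes t: "0 \<le> t" shows "bounded_operator X N (\<Phi> t)"
proof -
  obtain K :: real where K: "0 < K"
    "\<And>f. f holomorphic_on ball 0 1 \<Longrightarrow> pnorm p (\<lambda>z. f (\<phi> t z)) \<le> ennreal K * pnorm p f"
    by (rule pnorm_compose_le[OF p holo[OF t] self_map[OF t]]) (rule that)
  have eq: "\<Phi> t f = (\<lambda>z. f (\<phi> t z))" for f by (simp add: composition_apply fun_eq_iff)
  have inX: "\<Phi> t f \<in> X" if f: "f \<in> X" for f
  proof (rule XI[OF compose_holo[OF X_holo[OF f] t]])
    have "pnorm p (\<Phi> t f) \<le> ennreal K * pnorm p f" unfolding eq by (rule K(2)[OF X_holo[OF f]])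
    also have "\<dots> < \<infinity>" using X_fin[OF f] by (simp add: ennreal_mult_less_top)
    finally show "pnorm p (\<Phi> t f) < \<infinity>" .
  qed
  have "N (\<Phi> t f) \<le> K powr (1 / p) * N f" if f: "f \<in> X" for f
  proof -
    have "pnorm p (\<Phi> t f) \<le> ennreal K * ennreal (N f powr p)"
      using K(2)[OF X_holo[OF f]] unfolding eq pnorm_eq_N[OF f] .
    also have "\<dots> = ennreal ((K powr (1 / p) * N f) powr p)"
      using K(1) p0 by (simp add: powr_mult powr_powr ennreal_mult)
    finally show ?thesis using N_le_iff[OF inX[OF f]] N_nonneg[OF f] by simp
  qed
  then show ?thesis unfolding bounded_operator_def using inX by (auto simp: composition_apply)
qed

lemma compose_X: "f \<in> X \<Longrightarrow> 0 \<le> t \<Longrightarrow> \<Phi> t f \<in> X"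
  using bounded_composition[of t] unfolding bounded_operator_def by blast

lemma pnorm_compose_minus_tendsto:
  assumes f: "f \<in> X"
  shows "((\<lambda>t. pnorm p (\<lambda>z. f (\<phi> t z) - f z)) \<longlongrightarrow> 0) (at_right 0)"
  unfolding tendsto_at_iff_sequentially
proof (intro allI impI)
  fix S :: "nat \<Rightarrow> real" assume S: "\<forall>i. S i \<in> {0<..} - {0}" "S \<longlonglongrightarrow> 0"
  then have S_pos: "0 < S n" for n by auto
  then have S0: "0 \<le> S n" for n by (rule less_imp_le)
  have "filterlim S (at_right 0) sequentially"
    using S(2) S_pos less_imp_neq[OF S_pos] unfolding filterlim_at by (intro conjI always_eventually allI) auto
  then have "(\<lambda>n. \<phi> (S n) z) \<longlonglongrightarrow> z" if "norm z < 1" for z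
    using filterlim_compose[OF lim[OF that]] by blast
  then have "(\<lambda>n. pnorm p (\<lambda>z. f (\<phi> (S n) z) - f z)) \<longlonglongrightarrow> 0"
    by (intro pnorm_compose_tendsto_0[where \<phi>="\<lambda>n. \<phi> (S n)"] p X_holo X_fin f holo self_map S0) auto
  then show "((\<lambda>t. pnorm p (\<lambda>z. f (\<phi> t z) - f z)) \<circ> S) \<longlonglongrightarrow> 0" by (simp add: o_def)
qed

lemma strongly_continuous_composition: "strongly_continuous X N \<Phi>"
  unfolding strongly_continuous_def
proof (intro conjI allI impI ballI bounded_composition)
  fix f assume f: "f \<in> X"
  show "((\<lambda>t. N (\<lambda>z. \<Phi> t f z - f z)) \<longlongrightarrow> 0) (at_right 0)"
  proof (rule tendsto_NI)
    show "((\<lambda>t. pnorm p (\<lambda>z. \<Phi> t f z - f z)) \<longlongrightarrow> 0) (at_right 0)"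
      unfolding composition_apply by (rule pnorm_compose_minus_tendsto[OF f])
    show "eventually (\<lambda>t. (\<lambda>z. \<Phi> t f z - f z) holomorphic_on ball 0 1) (at_right 0)"
      unfolding eventually_at_right_field
      by (intro exI[of _ 1] conjI allI impI holomorphic_intros compose_holo X_holo[OF f]) auto
  qed
qed

lemma generator_value_eq:
  assumes f: "f \<in> X" and g: "has_generator_value X N \<Phi> f g" and z: "norm z < 1"
  shows "g z = infinitesimal_generator \<phi> z * deriv f z"
proof -
  have gX: "g \<in> X" and lim: "((\<lambda>t. N (\<lambda>z. (\<Phi> t f z - f z) / of_real t - g z)) \<longlongrightarrow> 0) (at_right 0)"
    using g by (auto simp: has_generator_value_def)
  obtain K where K: "0 \<le> K" "\<And>f w. f \<in> X \<Longrightarrow> norm w \<le> norm z \<Longrightarrow> norm (f w) \<le> K * N f"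
    by (rule point_evaluation[OF norm_ge_zero z]) (rule that)
  have "((\<lambda>t. K * N (\<lambda>z. (\<Phi> t f z - f z) / of_real t - g z)) \<longlongrightarrow> K * 0) (at_right 0)"
    by (intro tendsto_mult tendsto_const lim)
  then have lim0: "((\<lambda>t. K * N (\<lambda>z. (\<Phi> t f z - f z) / of_real t - g z)) \<longlongrightarrow> 0) (at_right 0)"
    by simp
  have "((\<lambda>t. (\<Phi> t f z - f z) / of_real t - g z) \<longlongrightarrow> 0) (at_right 0)"
  proof (rule Lim_null_comparison[OF _ lim0])
    show "eventually (\<lambda>t. norm ((\<Phi> t f z - f z) / of_real t - g z) \<le> K * N (\<lambda>z. (\<Phi> t f z - f z) / of_real t - g z)) (at_right 0)"
      unfolding eventually_at_right_field
    proof (intro exI[of _ 1] conjI allI impI)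
      fix t :: real assume t: "0 < t" "t < 1"
      have "(\<lambda>z. (1 / of_real t) * (\<Phi> t f z - f z) - g z) \<in> X"
        by (intro X_diff X_scale compose_X f gX) (use t in simp)
      then have u: "(\<lambda>z. (\<Phi> t f z - f z) / of_real t - g z) \<in> X" by simp
      show "norm ((\<Phi> t f z - f z) / of_real t - g z) \<le> K * N (\<lambda>z. (\<Phi> t f z - f z) / of_real t - g z)"
        using K(2)[OF u, of z] by simp
    qed simp
  qed
  then have "((\<lambda>t. (f (\<phi> t z) - f z) / of_real t) \<longlongrightarrow> g z) (at_right 0)"
    unfolding composition_apply by (rule Lim_null[THEN iffD2])
  then show ?thesis
    using compose_generator_limit[OF X_holo[OF f] z] by (rule tendsto_unique[rotated]) simp
qed

end

section \<open>Time averages and the generator\<close>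

text \<open>Second countability makes pairing measurable into the Borel sets of the product. This
  provides the measurability for Tonelli between the disc and time.\<close>

lemma borel_measurable_pair_continuous:
  fixes F :: "'a::second_countable_topology \<times> 'b::second_countable_topology \<Rightarrow> 'c::topological_space"
  assumes "continuous_on (A \<times> B) F"
  shows "F \<in> borel_measurable (restrict_space borel A \<Otimes>\<^sub>M restrict_space borel B)"
proof -
  have "fst \<in> restrict_space borel A \<Otimes>\<^sub>M restrict_space borel B \<rightarrow>\<^sub>M borel"
    by (rule measurable_compose[OF measurable_fst]) (rule measurable_restrict_space1, simp)
  moreover have "snd \<in> restrict_space borel A \<Otimes>\<^sub>M restrict_space borel B \<rightarrow>\<^sub>M borel"
    by (rule measurable_compose[OF measurable_snd]) (rule measurable_restrict_space1, simp)
  ultimately have "(\<lambda>x. (fst x, snd x)) \<in> restrict_space borel A \<Otimes>\<^sub>M restrict_space borel B \<rightarrow>\<^sub>M borel"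
    by (rule borel_measurable_Pair)
  then have "(\<lambda>x. (fst x, snd x)) \<in> restrict_space borel A \<Otimes>\<^sub>M restrict_space borel B \<rightarrow>\<^sub>M restrict_space borel (A \<times> B)"
    by (intro measurable_restrict_space2) (auto simp: space_pair_measure space_restrict_space)
  from measurable_compose[OF this borel_measurable_continuous_on_restrict[OF assms]]
  show ?thesis by simp
qed

text \<open>Jensen with the constant density \<open>1 / t\<close>. Continuity lets the
  Henstock-Kurzweil integral, in which the orbit formula is stated, be read as a Lebesgue
  integral.\<close>

lemma norm_average_powr_le:
  fixes g :: "real \<Rightarrow> complex"
  assumes p: "1 \<le> p" and t: "0 < t" and g: "continuous_on {0..t} g"
  shows "ennreal (norm (of_real (1 / t) * integral {0..t} g) powr p)
    \<le> (\<integral>\<^sup>+s. ennreal (1 / t) * ennreal (norm (g s) powr p) \<partial>restrict_space lborel {0..t})"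
proof -
  define M where "M = restrict_space lborel {0..t}"
  have int: "integrable M h" if "continuous_on {0..t} h" for h :: "real \<Rightarrow> 'b::euclidean_space"
    unfolding M_def using borel_integrable_compact[OF compact_Icc that]
    by (subst integrable_restrict_space) auto
  have eq: "(\<integral>s. g s \<partial>M) = integral {0..t} g"
  proof -
    have "(\<integral>s. g s \<partial>M) = (LINT s:{0..t}|lborel. g s)"
      unfolding M_def set_lebesgue_integral_def by (subst integral_restrict_space) auto
    also have "\<dots> = integral {0..t} g"
      using borel_integrable_compact[OF compact_Icc g]
      by (intro set_borel_integral_eq_integral) (simp add: set_integrable_def)
    finally show ?thesis .
  qed
  have spM: "space M = {0..t}" by (simp add: M_def space_restrict_space)
  have "emeasure M (space M) = ennreal t"
    using t unfolding spM by (simp add: M_def emeasure_restrict_space)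
  then have mM: "measure M (space M) = t" using t by (simp add: measure_def)
  have cp: "continuous_on {0..t} (\<lambda>s. 1 / t * norm (g s) powr p)"
    using p by (intro continuous_intros continuous_on_powr' g) auto
  have "norm (\<integral>s. of_real (1 / t) * g s \<partial>M) powr p \<le> (\<integral>s. 1 / t * norm (g s) powr p \<partial>M)"
  proof (rule norm_integral_powr_le[OF p, where k="\<lambda>_. 1 / t"])
    show "integrable M (\<lambda>_. 1 / t)" by (intro int continuous_intros)
    show "(\<integral>x. 1 / t \<partial>M) = 1" using t by (simp add: mM)
    show "integrable M (\<lambda>x. of_real (1 / t) * g x)" by (intro int continuous_intros g)
    show "integrable M (\<lambda>x. 1 / t * norm (g x) powr p)" by (rule int[OF cp])
  qed (use t in auto)
  also have "(\<integral>s. of_real (1 / t) * g s \<partial>M) = of_real (1 / t) * integral {0..t} g"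
    unfolding eq[symmetric] by (rule Bochner_Integration.integral_mult_right_zero)
  finally have "ennreal (norm (of_real (1 / t) * integral {0..t} g) powr p) \<le> ennreal (\<integral>s. 1 / t * norm (g s) powr p \<partial>M)"
    by (rule ennreal_leI)
  also have "\<dots> = (\<integral>\<^sup>+s. ennreal (1 / t * norm (g s) powr p) \<partial>M)"
    using t by (intro nn_integral_eq_integral[symmetric] int cp) auto
  also have "\<dots> = (\<integral>\<^sup>+s. ennreal (1 / t) * ennreal (norm (g s) powr p) \<partial>M)"
    using t by (intro nn_integral_cong ennreal_mult) auto
  finally show ?thesis by (simp only: M_def)
qed

text \<open>Since \<open>C\<^sub>2\<^sub>t - I = 2 (C\<^sub>t - I) + (C\<^sub>t - I)\<^sup>2\<close>, the norms of \<open>C\<^sub>s - I\<close> at \<open>s = t / 2 ^ k\<close> satisfy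
  this recursion, which makes them decay linearly in \<open>s\<close>.\<close>

lemma half_iterate_bound:
  fixes e :: "nat \<Rightarrow> real"
  assumes e0: "\<And>k. 0 \<le> e k" "\<And>k. e k \<le> 1 / 2" and rec: "\<And>k. 2 * e (Suc k) \<le> e k + (e (Suc k))\<^sup>2"
  shows "e k * 2 ^ k \<le> 1"
proof (rule ccontr)
  assume "\<not> e k * 2 ^ k \<le> 1"
  then have gt: "1 < e k * 2 ^ k" by simp
  \<comment> \<open>The recursion says that \<open>1 - e n\<close> is at most the square of
    \<open>1 - e (Suc n)\<close>, so these powers stay above \<open>1 - e 0\<close>. If
    \<open>e k * 2 ^ k\<close> exceeded 1, the power at \<open>k\<close> would fall below
    \<open>exp (- 1)\<close>, which is at most 1/2.\<close>
  have ind: "1 / 2 \<le> (1 - e n) ^ (2 ^ n)" for n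
  proof (induction n)
    case 0
    show ?case using e0(2)[of 0] by simp
  next
    case (Suc n)
    have "1 - e n \<le> (1 - e (Suc n))\<^sup>2"
      using rec[of n] by (simp add: power2_eq_square algebra_simps)
    then have "(1 - e n) ^ (2 ^ n) \<le> ((1 - e (Suc n))\<^sup>2) ^ (2 ^ n)"
      using e0(2)[of n] by (intro power_mono) auto
    also have "\<dots> = (1 - e (Suc n)) ^ (2 ^ Suc n)" by (simp only: power_mult[symmetric] power_Suc)
    finally show ?case using Suc.IH by simp
  qed
  have "1 - e k \<le> exp (- e k)" using exp_ge_add_one_self[of "- e k"] by simp
  then have "(1 - e k) ^ (2 ^ k) \<le> exp (- e k) ^ (2 ^ k)"
    using e0(2)[of k] by (intro power_mono) auto
  also have "\<dots> = exp (- (e k * 2 ^ k))" by (simp add: exp_of_nat_mult[symmetric] mult.commute)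
  also have "\<dots> < exp (- 1)" using gt by simp
  also have "exp (- 1) \<le> (1 / 2 :: real)"
    using exp_ge_add_one_self[of "1::real"] by (simp add: exp_minus field_simps)
  finally show False using ind[of k] by simp
qed

context bergman_flow begin

lemma has_generator_valueI:
  assumes f: "f \<in> X" and h: "(\<lambda>z. infinitesimal_generator \<phi> z * deriv f z) \<in> X"
  shows "has_generator_value X N \<Phi> f (\<lambda>z. infinitesimal_generator \<phi> z * deriv f z)"
proof -
  define h where "h = (\<lambda>z. infinitesimal_generator \<phi> z * deriv f z)"
  have hX: "h \<in> X" using h by (simp add: h_def)
  have hc: "continuous_on (ball 0 1) h" by (rule holomorphic_on_imp_continuous_on[OF X_holo[OF hX]])
  define D where "D = (\<lambda>s z. h (\<phi> s z) - h z)"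
  define u where "u = (\<lambda>t z. (\<Phi> t f z - f z) / of_real t - h z)"
  \<comment> \<open>On the disc \<open>u t\<close> is the time average of \<open>D s\<close> over
    \<open>0 \<le> s \<le> t\<close>. Jensen in time and Tonelli bring \<open>pnorm\<close> inside,
    in place of Minkowski's integral inequality.\<close>
  have bound: "pnorm p (u t) \<le> (\<integral>\<^sup>+s. ennreal (1 / t) * pnorm p (D s) \<partial>restrict_space lborel {0..t})" if t: "0 < t" for t
  proof -
    define M where "M = restrict_space (lborel :: real measure) {0..t}"
    have sM: "sets M = sets (restrict_space borel {0..t})" by (simp add: M_def sets_restrict_space)
    have spM: "space M = {0..t}" by (simp add: M_def space_restrict_space)
    have Djoint: "continuous_on (ball 0 1 \<times> {0..t}) (\<lambda>x. D (snd x) (fst x))"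
    proof -
      have "continuous_on (ball 0 1 \<times> {0..t}) ((\<lambda>(s, z). \<phi> s z) \<circ> (\<lambda>x. (snd x, fst x)))"
        by (intro continuous_on_compose continuous_intros continuous_on_subset[OF continuous_on_joint]) auto
      then have "continuous_on (ball 0 1 \<times> {0..t}) (\<lambda>x. \<phi> (snd x) (fst x))" by (simp add: o_def)
      then show ?thesis
        unfolding D_def
        by (intro continuous_on_diff continuous_on_compose2[OF hc] continuous_intros) (auto intro: in_disc)
    qed
    have mD: "(\<lambda>x. D (snd x) (fst x)) \<in> borel_measurable (\<nu> \<Otimes>\<^sub>M M)"
      using borel_measurable_pair_continuous[OF Djoint]
      by (simp cong: measurable_cong_sets sets_pair_measure_cong add: sets_pair_measure_cong[OF sets_eq sM])
    then have mF: "(\<lambda>(z, s). ennreal (1 / t) * ennreal (norm (D s z) powr p)) \<in> borel_measurable (\<nu> \<Otimes>\<^sub>M M)"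
      by (simp add: case_prod_unfold)
    have mz: "(\<lambda>z. ennreal (norm (D s z) powr p)) \<in> borel_measurable \<nu>" if "s \<in> {0..t}" for s
    proof -
      have "continuous_on (ball 0 1) (\<lambda>z. D s z)"
        unfolding D_def using that
        by (intro continuous_on_diff continuous_on_compose2[OF hc] holomorphic_on_imp_continuous_on[OF holo])
           (auto intro: in_disc hc)
      then have "(\<lambda>z. D s z) \<in> borel_measurable \<nu>" by (rule borel_measurable_continuous)
      then show ?thesis by measurable
    qed
    interpret M: sigma_finite_measure M
      unfolding M_def by (rule sigma_finite_measure_restrict_space) (auto intro: sigma_finite_lborel)
    interpret P: pair_sigma_finite \<nu> M ..
    have "pnorm p (u t) \<le> (\<integral>\<^sup>+z. \<integral>\<^sup>+s. ennreal (1 / t) * ennreal (norm (D s z) powr p) \<partial>M \<partial>\<nu>)"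
      unfolding pnorm_def
    proof (rule nn_integral_mono)
      fix z assume "z \<in> space \<nu>"
      then have z: "norm z < 1" by simp
      have cont: "continuous_on {0..t} (\<lambda>s. D s z)"
      proof -
        have "continuous_on {0..t} (\<lambda>s. \<phi> s z)"
          by (rule continuous_on_subset[OF continuous_on_time[OF z]]) auto
        then show ?thesis unfolding D_def
          by (intro continuous_on_diff continuous_on_compose2[OF hc] continuous_intros) (use in_disc[OF _ z] in auto)
      qed
      have "((\<lambda>s. h (\<phi> s z)) has_integral (f (\<phi> t z) - f z)) {0..t}"
        unfolding h_def by (rule compose_minus_has_integral[OF X_holo[OF f] z]) (use t in simp)
      moreover have "((\<lambda>s. h z) has_integral (of_real t * h z)) {0..t}"
        using has_integral_const_real[of "h z" 0 t] t by (simp add: scaleR_conv_of_real)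
      ultimately have "((\<lambda>s. D s z) has_integral (f (\<phi> t z) - f z - of_real t * h z)) {0..t}"
        unfolding D_def by (rule has_integral_diff)
      then have "integral {0..t} (\<lambda>s. D s z) = f (\<phi> t z) - f z - of_real t * h z"
        by (rule integral_unique)
      then have "of_real (1 / t) * integral {0..t} (\<lambda>s. D s z) = u t z"
        using t by (simp add: u_def composition_apply field_simps)
      then show "ennreal (norm (u t z) powr p) \<le> (\<integral>\<^sup>+s. ennreal (1 / t) * ennreal (norm (D s z) powr p) \<partial>M)"
        using norm_average_powr_le[OF p t cont] by (simp only: M_def)
    qed
    also have "\<dots> = (\<integral>\<^sup>+s. \<integral>\<^sup>+z. ennreal (1 / t) * ennreal (norm (D s z) powr p) \<partial>\<nu> \<partial>M)"
      by (rule P.Fubini'[OF mF, symmetric])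
    also have "\<dots> = (\<integral>\<^sup>+s. ennreal (1 / t) * pnorm p (D s) \<partial>M)"
      unfolding pnorm_def by (intro nn_integral_cong nn_integral_cmult mz) (simp add: spM)
    finally show ?thesis by (simp only: M_def)
  qed
  have lim: "((\<lambda>s. pnorm p (D s)) \<longlongrightarrow> 0) (at_right 0)"
    unfolding D_def by (rule pnorm_compose_minus_tendsto[OF hX])
  have "((\<lambda>t. pnorm p (u t)) \<longlongrightarrow> 0) (at_right 0)"
  proof (rule order_tendstoI)
    fix e :: ennreal assume "0 < e"
    then obtain e' where e': "0 < e'" "e' < e" using dense by blast
    obtain d where d: "0 < d" "\<And>s. 0 < s \<Longrightarrow> s < d \<Longrightarrow> pnorm p (D s) < e'"
      using order_tendstoD(2)[OF lim e'(1)] unfolding eventually_at_right_field by auto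
    \<comment> \<open>The limit at 0 from the right says nothing about \<open>s = 0\<close> itself,
      which belongs to the interval of integration.\<close>
    have D0: "pnorm p (D 0) = 0"
    proof -
      have "pnorm p (D 0) = pnorm p (\<lambda>z. 0)" by (rule pnorm_cong) (simp add: D_def zero)
      then show ?thesis by (simp add: pnorm_def)
    qed
    show "eventually (\<lambda>t. pnorm p (u t) < e) (at_right 0)"
      unfolding eventually_at_right_field
    proof (intro exI[of _ d] conjI allI impI d(1))
      fix t :: real assume t: "0 < t" "t < d"
      have "pnorm p (u t) \<le> (\<integral>\<^sup>+s. ennreal (1 / t) * pnorm p (D s) \<partial>restrict_space lborel {0..t})"
        by (rule bound[OF t(1)])
      also have "\<dots> \<le> (\<integral>\<^sup>+s. ennreal (1 / t) * e' \<partial>restrict_space lborel {0..t})"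
      proof (intro nn_integral_mono mult_left_mono)
        fix s assume "s \<in> space (restrict_space lborel {0..t})"
        then have "s \<in> {0..t}" by (simp add: space_restrict_space)
        then show "pnorm p (D s) \<le> e'"
          using d(2)[of s] t D0 by (cases "s = 0") auto
      qed simp
      also have "\<dots> = ennreal (1 / t) * e' * ennreal t"
        using t by (simp add: space_restrict_space emeasure_restrict_space)
      also have "\<dots> = (ennreal (1 / t) * ennreal t) * e'" by (simp only: mult_ac)
      also have "ennreal (1 / t) * ennreal t = 1" using t by (simp flip: ennreal_mult)
      finally show "pnorm p (u t) < e" using e' by simp
    qed
  qed simp
  then have "((\<lambda>t. N (u t)) \<longlongrightarrow> 0) (at_right 0)"
  proof (rule tendsto_NI)
    show "eventually (\<lambda>t. u t holomorphic_on ball 0 1) (at_right 0)"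
      unfolding eventually_at_right_field u_def
      by (intro exI[of _ 1] conjI allI impI holomorphic_intros compose_holo X_holo[OF f] X_holo[OF hX]) auto
  qed
  then show ?thesis
    unfolding has_generator_value_def using h by (simp add: u_def h_def)
qed

end

context bergman_flow begin

lemma X_bounded:
  assumes f: "f holomorphic_on ball 0 1" and B: "\<And>z. norm z < 1 \<Longrightarrow> norm (f z) \<le> B"
  shows "f \<in> X"
proof (rule XI[OF f])
  have "pnorm p f \<le> (\<integral>\<^sup>+z. ennreal (B powr p) \<partial>\<nu>)"
    unfolding pnorm_def using B p0 by (intro nn_integral_mono ennreal_leI powr_mono2) auto
  also have "\<dots> < \<infinity>" by (simp add: ennreal_mult_less_top emeasure_eq_measure)
  finally show "pnorm p f < \<infinity>" .
qed

lemma power_X: "(\<lambda>z. z ^ n) \<in> X"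
  by (rule X_bounded[where B=1]) (auto intro!: holomorphic_intros simp: norm_power power_le_one)

section \<open>Uniform continuity\<close>

definition op_diff :: "real \<Rightarrow> ennreal" where
  "op_diff t = operator_norm X N (\<lambda>f z. \<Phi> t f z - f z)"

lemma diff_X: "f \<in> X \<Longrightarrow> 0 \<le> t \<Longrightarrow> (\<lambda>z. \<Phi> t f z - f z) \<in> X"
  by (rule X_diff[OF compose_X])

lemma op_diff_le:
  assumes "\<And>f. f \<in> X \<Longrightarrow> N f \<le> 1 \<Longrightarrow> N (\<lambda>z. \<Phi> t f z - f z) \<le> c"
  shows "op_diff t \<le> ennreal c"
  unfolding op_diff_def operator_norm_def using assms by (auto intro!: SUP_least ennreal_leI)

lemma N_diff_le:
  assumes t: "0 \<le> t" and fin: "op_diff t < \<infinity>" and f: "f \<in> X"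
  shows "N (\<lambda>z. \<Phi> t f z - f z) \<le> enn2real (op_diff t) * N f"
proof -
  define e where "e = enn2real (op_diff t)"
  have e: "0 \<le> e" "op_diff t = ennreal e" using fin by (auto simp: e_def less_top)
  have unit: "N (\<lambda>z. \<Phi> t g z - g z) \<le> e" if g: "g \<in> X" "N g \<le> 1" for g
  proof -
    have "ennreal (N (\<lambda>z. \<Phi> t g z - g z)) \<le> op_diff t"
      unfolding op_diff_def operator_norm_def by (rule SUP_upper) (use g in auto)
    then show ?thesis using e by simp
  qed
  \<comment> \<open>Normalising by a number \<open>a\<close> strictly above \<open>N f\<close>
    covers \<open>N f = 0\<close> without a separate case; afterwards \<open>a\<close> is taken
    arbitrarily close to \<open>N f\<close>.\<close>
  have large: "N (\<lambda>z. \<Phi> t f z - f z) \<le> e * a" if a: "N f < a" for a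
  proof -
    have a0: "0 < a" using a N_nonneg[OF f] by simp
    define c where "c = complex_of_real (1 / a)"
    have nc: "norm c = 1 / a" using a0 by (simp add: c_def norm_divide)
    have "N (\<lambda>z. c * f z) \<le> 1" using a a0 by (simp add: N_scale[OF f] nc)
    from unit[OF X_scale[OF f] this]
    have "N (\<lambda>z. c * (\<Phi> t f z - f z)) \<le> e"
      by (simp add: composition_apply right_diff_distrib)
    then have "1 / a * N (\<lambda>z. \<Phi> t f z - f z) \<le> e"
      by (simp only: N_scale[OF diff_X[OF f t]] nc)
    then show ?thesis using a0 by (simp add: field_simps)
  qed
  have "N (\<lambda>z. \<Phi> t f z - f z) \<le> e * N f"
  proof (rule field_le_epsilon)
    fix d :: real assume d: "0 < d"
    have "N (\<lambda>z. \<Phi> t f z - f z) \<le> e * (N f + d / (e + 1))"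
      by (rule large) (use d e in simp)
    also have "\<dots> = e * N f + d * (e / (e + 1))" by (simp add: algebra_simps)
    also have "\<dots> \<le> e * N f + d * 1"
      using d e by (intro add_left_mono mult_left_mono) auto
    finally show "N (\<lambda>z. \<Phi> t f z - f z) \<le> e * N f + d" by simp
  qed
  then show ?thesis by (simp only: e_def)
qed

lemma op_diff_double:
  assumes t: "0 \<le> t" and fin: "op_diff t < \<infinity>" "op_diff (2 * t) < \<infinity>"
  shows "2 * enn2real (op_diff t) \<le> enn2real (op_diff (2 * t)) + (enn2real (op_diff t))\<^sup>2"
proof -
  define a b where "a = enn2real (op_diff t)" and "b = enn2real (op_diff (2 * t))"
  have ab: "0 \<le> a" "0 \<le> b" by (auto simp: a_def b_def)
  have "op_diff t \<le> ennreal ((b + a\<^sup>2) / 2)"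
  proof (rule op_diff_le)
    fix f assume f: "f \<in> X" and f1: "N f \<le> 1"
    define g where "g = (\<lambda>z. \<Phi> t f z - f z)"
    have g: "g \<in> X" unfolding g_def by (rule diff_X[OF f t])
    have gN: "N g \<le> a"
    proof -
      have "N g \<le> a * N f" unfolding g_def a_def by (rule N_diff_le[OF t fin(1) f])
      also have "\<dots> \<le> a * 1" using f1 ab by (intro mult_left_mono) auto
      finally show ?thesis by simp
    qed
    have g2: "N (\<lambda>z. \<Phi> t g z - g z) \<le> a\<^sup>2"
    proof -
      have "N (\<lambda>z. \<Phi> t g z - g z) \<le> a * N g" unfolding a_def by (rule N_diff_le[OF t fin(1) g])
      also have "\<dots> \<le> a * a" using gN ab by (intro mult_left_mono) auto
      finally show ?thesis by (simp add: power2_eq_square)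
    qed
    have t2: "0 \<le> 2 * t" using t by simp
    have f2: "N (\<lambda>z. \<Phi> (2 * t) f z - f z) \<le> b"
    proof -
      have "N (\<lambda>z. \<Phi> (2 * t) f z - f z) \<le> b * N f" unfolding b_def by (rule N_diff_le[OF t2 fin(2) f])
      also have "\<dots> \<le> b * 1" using f1 ab by (intro mult_left_mono) auto
      finally show ?thesis by simp
    qed
    have "2 * N g = N (\<lambda>z. 2 * g z)" using N_scale[OF g, of 2] by simp
    also have "\<dots> = N (\<lambda>z. (\<Phi> (2 * t) f z - f z) - (\<Phi> t g z - g z))"
    proof (rule N_cong[OF X_scale[OF g]])
      fix z :: complex assume z: "norm z < 1"
      have "\<phi> t (\<phi> t z) = \<phi> (2 * t) z" using add[OF t t z] by simp
      then show "2 * g z = (\<Phi> (2 * t) f z - f z) - (\<Phi> t g z - g z)"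
        by (simp add: g_def composition_apply)
    qed
    also have "\<dots> \<le> N (\<lambda>z. \<Phi> (2 * t) f z - f z) + N (\<lambda>z. \<Phi> t g z - g z)"
      by (rule N_triangle_diff[OF diff_X[OF f t2] diff_X[OF g t]])
    also have "\<dots> \<le> b + a\<^sup>2" using f2 g2 by simp
    finally show "N (\<lambda>z. \<Phi> t f z - f z) \<le> (b + a\<^sup>2) / 2" by (simp add: g_def)
  qed
  then have "a \<le> (b + a\<^sup>2) / 2" unfolding a_def[symmetric] using ab
    by (metis a_def add_nonneg_nonneg divide_nonneg_nonneg enn2real_leI zero_le_numeral zero_le_power2)
  then show ?thesis by (simp add: a_def b_def)
qed

text \<open>All times \<open>t0 / 2 ^ k\<close> lie where the norm of the difference is below 1/2,
  the range in which \<open>half_iterate_bound\<close> turns the doubling recursion into linear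
  decay.\<close>

lemma linear_bound:
  assumes "uniformly_continuous X N \<Phi>"
  obtains t0 where "0 < t0"
    "\<And>f k. f \<in> X \<Longrightarrow> N (\<lambda>z. \<Phi> (t0 / 2 ^ k) f z - f z) \<le> N f / 2 ^ k"
proof -
  have "(op_diff \<longlongrightarrow> 0) (at_right 0)"
    using assms unfolding uniformly_continuous_def op_diff_def by blast
  then have "eventually (\<lambda>t. op_diff t < ennreal (1 / 2)) (at_right 0)"
    by (rule order_tendstoD) (subst ennreal_0[symmetric], rule ennreal_lessI, simp_all)
  then obtain d where d: "0 < d" "\<And>t. 0 < t \<Longrightarrow> t < d \<Longrightarrow> op_diff t < ennreal (1 / 2)"
    unfolding eventually_at_right_field by auto
  define t0 where "t0 = d / 2"
  define s where "s = (\<lambda>k :: nat. t0 / 2 ^ k)"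
  have t0: "0 < t0" using d by (simp add: t0_def)
  have s: "0 < s k" "s k < d" for k
  proof -
    show "0 < s k" using t0 by (simp add: s_def)
    have "s k \<le> t0 / 1" unfolding s_def using t0 by (intro divide_left_mono) auto
    also have "\<dots> < d" using d by (simp add: t0_def)
    finally show "s k < d" .
  qed
  have fin: "op_diff (s k) < \<infinity>" for k
    using less_trans[OF d(2)[OF s] ennreal_less_top] by simp
  define e where "e = (\<lambda>k. enn2real (op_diff (s k)))"
  have half: "e k \<le> 1 / 2" for k
    unfolding e_def by (rule enn2real_leI[OF _ less_imp_le[OF d(2)[OF s]]]) simp
  have rec: "2 * e (Suc k) \<le> e k + (e (Suc k))\<^sup>2" for k
  proof -
    have "2 * s (Suc k) = s k" by (simp add: s_def)
    then show ?thesis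
      using op_diff_double[of "s (Suc k)"] s(1)[of "Suc k"] fin[of k] fin[of "Suc k"] by (simp add: e_def)
  qed
  have e_bd: "e k * 2 ^ k \<le> 1" for k
    by (rule half_iterate_bound[of e, OF _ half rec]) (simp add: e_def)
  show ?thesis
  proof (rule that[OF t0])
    fix f k assume f: "f \<in> X"
    have "N (\<lambda>z. \<Phi> (s k) f z - f z) \<le> e k * N f"
      unfolding e_def by (rule N_diff_le[OF less_imp_le[OF s(1)] fin f])
    also have "\<dots> \<le> 1 / 2 ^ k * N f"
      using e_bd[of k] N_nonneg[OF f] by (intro mult_right_mono) (auto simp: field_simps)
    finally show "N (\<lambda>z. \<Phi> (t0 / 2 ^ k) f z - f z) \<le> N f / 2 ^ k" by (simp add: s_def)
  qed
qed

lemma trivial_if_uniformly_continuous: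
  assumes "uniformly_continuous X N \<Phi>"
  shows "trivial_semigroup \<phi>"
proof -
  obtain t0 where t0: "0 < t0" and lin: "\<And>f k. f \<in> X \<Longrightarrow> N (\<lambda>z. \<Phi> (t0 / 2 ^ k) f z - f z) \<le> N f / 2 ^ k"
    by (rule linear_bound[OF assms]) (rule that)
  define G where "G = infinitesimal_generator \<phi>"
  define s where "s = (\<lambda>k :: nat. t0 / 2 ^ k)"
  have s: "0 < s k" for k using t0 by (simp add: s_def)
  define Q where "Q = (\<lambda>f k z. (1 / complex_of_real (s k)) * (\<Phi> (s k) f z - f z))"
  have QX: "Q f k \<in> X" if "f \<in> X" for f k
    unfolding Q_def by (intro X_scale diff_X that less_imp_le s)
  have QN: "N (Q f k) \<le> N f / t0" if f: "f \<in> X" for f k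
  proof -
    have "N (Q f k) = 1 / s k * N (\<lambda>z. \<Phi> (s k) f z - f z)"
      unfolding Q_def using N_scale[OF diff_X[OF f less_imp_le[OF s]], of "1 / complex_of_real (s k)"] s[of k]
      by (simp add: norm_divide)
    also have "\<dots> \<le> 1 / s k * (N f / 2 ^ k)"
      using lin[OF f, of k] t0 by (intro mult_left_mono) (auto simp: s_def)
    also have "\<dots> = N f / t0" using t0 by (simp add: s_def)
    finally show ?thesis .
  qed
  have "s \<longlonglongrightarrow> 0"
  proof -
    have "(\<lambda>k. t0 * (1 / 2) ^ k) \<longlonglongrightarrow> t0 * 0"
      by (intro tendsto_mult tendsto_const LIMSEQ_realpow_zero) auto
    then show ?thesis by (simp add: s_def power_one_over)
  qed
  then have slim: "filterlim s (at_right 0) sequentially"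
    using s less_imp_neq[OF s] unfolding filterlim_at by (intro conjI always_eventually allI) auto
  have Qlim: "(\<lambda>k. Q f k z) \<longlonglongrightarrow> G z * deriv f z" if f: "f \<in> X" and z: "norm z < 1" for f z
  proof -
    have "(\<lambda>k. (f (\<phi> (s k) z) - f z) / of_real (s k)) \<longlonglongrightarrow> G z * deriv f z"
      unfolding G_def by (rule filterlim_compose[OF compose_generator_limit[OF X_holo[OF f] z] slim])
    then show ?thesis by (simp add: Q_def composition_apply)
  qed
  \<comment> \<open>Fatou uses only pointwise limits of the quotients, so \<open>f\<close> need not
    be known to belong to the domain of the generator.\<close>
  have fatou: "(\<integral>\<^sup>+z. ennreal (norm (G z * deriv f z) powr p) \<partial>\<nu>) \<le> ennreal ((N f / t0) powr p)" if f: "f \<in> X" for f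
  proof -
    have "(\<integral>\<^sup>+z. ennreal (norm (G z * deriv f z) powr p) \<partial>\<nu>)
        = (\<integral>\<^sup>+z. liminf (\<lambda>k. ennreal (norm (Q f k z) powr p)) \<partial>\<nu>)"
    proof (rule nn_integral_cong)
      fix z assume "z \<in> space \<nu>"
      then have "(\<lambda>k. Q f k z) \<longlonglongrightarrow> G z * deriv f z" by (intro Qlim f) simp
      then have "(\<lambda>k. ennreal (norm (Q f k z) powr p)) \<longlonglongrightarrow> ennreal (norm (G z * deriv f z) powr p)"
        using p0 by (intro tendsto_ennrealI tendsto_powr' tendsto_norm tendsto_const) auto
      then show "ennreal (norm (G z * deriv f z) powr p) = liminf (\<lambda>k. ennreal (norm (Q f k z) powr p))"
        using lim_imp_Liminf[OF sequentially_bot] by metis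
    qed
    also have "\<dots> \<le> liminf (\<lambda>k. \<integral>\<^sup>+z. ennreal (norm (Q f k z) powr p) \<partial>\<nu>)"
      by (intro nn_integral_liminf borel_measurable_holomorphic_powr X_holo QX f p0)
    also have "\<dots> \<le> liminf (\<lambda>k :: nat. ennreal ((N f / t0) powr p))"
    proof (intro Liminf_mono always_eventually allI)
      fix k
      have "pnorm p (Q f k) \<le> ennreal ((N f / t0) powr p)"
        using N_le_iff[OF QX[OF f, of k], of "N f / t0"] QN[OF f, of k] N_nonneg[OF f] t0 by simp
      then show "(\<integral>\<^sup>+z. ennreal (norm (Q f k z) powr p) \<partial>\<nu>) \<le> ennreal ((N f / t0) powr p)"
        by (simp add: pnorm_def)
    qed
    also have "\<dots> = ennreal ((N f / t0) powr p)" by (rule Liminf_const) simp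
    finally show ?thesis .
  qed
  define i where "i = (\<lambda>z :: complex. z)"
  have iX: "i \<in> X" using power_X[of 1] by (simp add: i_def)
  \<comment> \<open>For the identity function the quotients converge pointwise to \<open>G\<close>.
    They are bounded in norm, hence locally bounded by point evaluation, and Montel's theorem makes
    a subsequential limit holomorphic.\<close>
  have Gholo: "G holomorphic_on ball 0 1"
  proof -
    have bd: "\<exists>B. \<forall>h\<in>range (Q i). \<forall>z\<in>K. norm (h z) \<le> B" if K: "compact K" "K \<subseteq> ball 0 1" for K
    proof -
      obtain r where r: "0 \<le> r" "r < 1" "K \<subseteq> cball 0 r"
      proof (cases "K = {}")
        case False
        obtain w where w: "w \<in> K" "\<forall>z\<in>K. norm z \<le> norm w"
          using continuous_attains_sup[OF K(1) False, of norm] by (auto intro: continuous_intros)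
        show ?thesis by (rule that[of "norm w"]) (use w K in auto)
      qed (use that[of 0] in auto)
      obtain c where c: "0 \<le> c" "\<And>f w. f \<in> X \<Longrightarrow> norm w \<le> r \<Longrightarrow> norm (f w) \<le> c * N f"
        by (rule point_evaluation[OF r(1,2)]) (rule that)
      have "norm (Q i k z) \<le> c * (N i / t0)" if z: "z \<in> K" for k z
      proof -
        have "norm (Q i k z) \<le> c * N (Q i k)" using r z by (intro c QX iX) auto
        also have "\<dots> \<le> c * (N i / t0)" by (intro mult_left_mono QN iX c)
        finally show ?thesis .
      qed
      then show ?thesis by blast
    qed
    have hol: "h holomorphic_on ball 0 1" if "h \<in> range (Q i)" for h
      using that X_holo[OF QX[OF iX]] by auto
    obtain g r where g: "g holomorphic_on ball 0 1" "strict_mono (r :: nat \<Rightarrow> nat)"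
      and gl: "\<And>x. x \<in> ball 0 1 \<Longrightarrow> (\<lambda>n. Q i (r n) x) \<longlonglongrightarrow> g x"
      by (rule Montel[OF open_ball hol bd subset_refl]) (assumption, assumption, assumption, rule that)
    have "g z = G z" if "z \<in> ball 0 1" for z
    proof -
      have z: "norm z < 1" using that by simp
      have "(\<lambda>k. Q i k z) \<longlonglongrightarrow> G z" using Qlim[OF iX z] by (simp add: i_def)
      from LIMSEQ_subseq_LIMSEQ[OF this g(2)] have "(\<lambda>n. Q i (r n) z) \<longlonglongrightarrow> G z" by (simp add: o_def)
      then show ?thesis by (rule LIMSEQ_unique[OF gl[OF that]])
    qed
    then show ?thesis using g(1) by (rule holomorphic_transform[rotated])
  qed
  have "G w = 0" if w: "norm w < 1" for w
  proof (rule ccontr)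
    assume Gw: "G w \<noteq> 0"
    define R where "R = (1 + norm w) / 2"
    have R: "norm w < R" "R < 1" "0 < R" using w by (auto simp: R_def add_pos_nonneg)
    define q where "q = (\<lambda>n r. ennreal ((r ^ n) powr p))"
    have qm[measurable]: "q n \<in> borel_measurable borel" for n unfolding q_def by measurable
    \<comment> \<open>A mean over a circle beyond \<open>w\<close> is positive once
      \<open>G w\<close> is nonzero, by the Poisson bound; it then bounds the means from below on
      the whole annulus.\<close>
    define m where "m = enn2real (circle_mean p G R)"
    have mfin: "circle_mean p G R = ennreal m"
      using circle_mean_finite[OF Gholo _ R(2) p0] R by (simp add: m_def less_top)
    have m: "0 < m"
    proof (rule ccontr)
      assume "\<not> 0 < m"
      then have "circle_mean p G R = 0" by (simp add: mfin ennreal_neg)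
      then have "ennreal (norm (G w) powr p) \<le> 0" using powr_le_circle_mean[OF p Gholo R(1,2)] by simp
      then show False using Gw by simp
    qed
    define J where "J = (\<lambda>n. \<integral>\<^sup>+z. q n (norm z) * indicator {R..} (norm z) \<partial>\<nu>)"
    define \<tau> where "\<tau> = measure \<nu> {z \<in> ball 0 1. R \<le> norm z}"
    have e\<tau>: "emeasure \<nu> {z \<in> ball 0 1. R \<le> norm z} = ennreal \<tau>"
      unfolding \<tau>_def by (rule emeasure_eq_measure)
    then have \<tau>: "0 < \<tau>" using tail_pos[OF R(2)] by simp
    define V where "V = measure \<nu> (ball 0 1)"
    have eV: "emeasure \<nu> (ball 0 1) = ennreal V" unfolding V_def by (rule emeasure_eq_measure)
    have q_mono: "q n r \<le> q n r'" if "0 \<le> r" "r \<le> r'" for n r r'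
      unfolding q_def using that p0 by (intro ennreal_leI powr_mono2 power_mono) auto
    have J_ge: "q n R * ennreal \<tau> \<le> J n" for n
    proof -
      have "q n R * emeasure \<nu> {z \<in> ball 0 1. R \<le> norm z} = (\<integral>\<^sup>+z. q n R * indicator {z \<in> ball 0 1. R \<le> norm z} z \<partial>\<nu>)"
        by (rule nn_integral_cmult_indicator[symmetric]) (use sets_radial[of "{R..}"] in auto)
      also have "\<dots> \<le> J n"
        unfolding J_def using q_mono R by (intro nn_integral_mono) (auto simp: indicator_def)
      finally show ?thesis by (simp only: e\<tau>)
    qed
    \<comment> \<open>Within radius \<open>R\<close> the integrand is at most \<open>q n R\<close>,
      whereas the annulus contributes at least \<open>q n R * \<tau>\<close>. So the annulus carries
      the integral up to a factor that does not depend on \<open>n\<close>.\<close>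
    have I_le: "(\<integral>\<^sup>+z. q n (norm z) \<partial>\<nu>) \<le> ennreal (1 + V / \<tau>) * J n" for n
    proof -
      have "(\<integral>\<^sup>+z. q n (norm z) \<partial>\<nu>) \<le> (\<integral>\<^sup>+z. q n (norm z) * indicator {R..} (norm z) + q n R \<partial>\<nu>)"
        using q_mono by (intro nn_integral_mono) (auto simp: indicator_def)
      also have "\<dots> = J n + q n R * ennreal V"
        unfolding J_def by (subst nn_integral_add, measurable) (simp add: eV)
      also have "q n R * ennreal V = ennreal (V / \<tau>) * (q n R * ennreal \<tau>)"
      proof -
        have "ennreal V = ennreal (V / \<tau>) * ennreal \<tau>"
          using \<tau> by (simp add: V_def flip: ennreal_mult)
        then show ?thesis by (simp only: mult_ac)
      qed
      also have "J n + ennreal (V / \<tau>) * (q n R * ennreal \<tau>) \<le> J n + ennreal (V / \<tau>) * J n"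
        by (intro add_left_mono mult_left_mono J_ge) simp
      also have "\<dots> = ennreal (1 + V / \<tau>) * J n"
        using \<tau> by (simp add: V_def distrib_right)
      finally show ?thesis .
    qed
    have key: "real (Suc n) powr p * m \<le> (1 / t0) powr p * (1 + V / \<tau>)" for n
    proof -
      have d: "deriv (\<lambda>z :: complex. z ^ Suc n) z = of_nat (Suc n) * z ^ n" for z
      proof -
        have "((\<lambda>z :: complex. z ^ Suc n) has_field_derivative (1 + of_nat n) * (1 * z ^ n)) (at z)"
          by (rule DERIV_power_Suc[OF DERIV_ident])
        then show ?thesis by (intro DERIV_imp_deriv) simp
      qed
      have "ennreal (real (Suc n) powr p) * (ennreal m * J n)
          \<le> ennreal (real (Suc n) powr p) * (\<integral>\<^sup>+z. circle_mean p G (norm z) * q n (norm z) \<partial>\<nu>)"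
      proof (rule mult_left_mono)
        have "ennreal m * J n = (\<integral>\<^sup>+z. circle_mean p G R * (q n (norm z) * indicator {R..} (norm z)) \<partial>\<nu>)"
          unfolding J_def mfin by (rule nn_integral_cmult[symmetric]) measurable
        also have "\<dots> \<le> (\<integral>\<^sup>+z. circle_mean p G (norm z) * q n (norm z) \<partial>\<nu>)"
          using circle_mean_mono[OF p Gholo] R
          by (intro nn_integral_mono) (auto simp: indicator_def intro!: mult_right_mono)
        finally show "ennreal m * J n \<le> (\<integral>\<^sup>+z. circle_mean p G (norm z) * q n (norm z) \<partial>\<nu>)" .
      qed simp
      also have "(\<integral>\<^sup>+z. circle_mean p G (norm z) * q n (norm z) \<partial>\<nu>)
          = (\<integral>\<^sup>+z. ennreal (norm (G z) powr p) * q n (norm z) \<partial>\<nu>)"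
        by (rule nn_integral_powr_radial[OF Gholo p0 qm, symmetric])
      also have "ennreal (real (Suc n) powr p) * (\<integral>\<^sup>+z. ennreal (norm (G z) powr p) * q n (norm z) \<partial>\<nu>)
          = (\<integral>\<^sup>+z. ennreal (real (Suc n) powr p) * (ennreal (norm (G z) powr p) * q n (norm z)) \<partial>\<nu>)"
      proof (rule nn_integral_cmult[symmetric])
        note [measurable] = borel_measurable_holomorphic_powr[OF Gholo p0]
        show "(\<lambda>z. ennreal (norm (G z) powr p) * q n (norm z)) \<in> borel_measurable \<nu>" by measurable
      qed
      also have "\<dots> = (\<integral>\<^sup>+z. ennreal (norm (G z * deriv (\<lambda>z. z ^ Suc n) z) powr p) \<partial>\<nu>)"
        unfolding d q_def
        by (intro nn_integral_cong)
           (simp add: norm_mult norm_power powr_mult ennreal_mult mult_ac del: of_nat_Suc)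
      also have "\<dots> \<le> ennreal ((N (\<lambda>z. z ^ Suc n) / t0) powr p)"
        by (rule fatou[OF power_X])
      also have "\<dots> = ennreal ((1 / t0) powr p) * pnorm p (\<lambda>z. z ^ Suc n)"
        using t0 N_nonneg[OF power_X, of "Suc n"]
        by (simp add: pnorm_eq_N[OF power_X] powr_divide del: power_Suc flip: ennreal_mult)
      \<comment> \<open>Differentiation leaves the exponent \<open>n\<close> on the left; lowering
        \<open>Suc n\<close> to \<open>n\<close> on the right only enlarges the integrand in the
        disc and puts \<open>J n\<close> on both sides.\<close>
      also have "\<dots> \<le> ennreal ((1 / t0) powr p) * (\<integral>\<^sup>+z. q n (norm z) \<partial>\<nu>)"
        unfolding pnorm_def q_def
        using p0 by (intro mult_left_mono nn_integral_mono ennreal_leI powr_mono2)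
          (auto simp: norm_mult norm_power intro!: mult_left_le_one_le)
      also have "\<dots> \<le> ennreal ((1 / t0) powr p) * (ennreal (1 + V / \<tau>) * J n)"
        by (intro mult_left_mono I_le) simp
      finally have le: "ennreal (real (Suc n) powr p * m) * J n \<le> ennreal ((1 / t0) powr p * (1 + V / \<tau>)) * J n"
        using m \<tau> by (simp add: ennreal_mult V_def mult.assoc del: of_nat_Suc)
      \<comment> \<open>Cancelling \<open>J n\<close> in \<open>ennreal\<close> requires it to be
        finite and positive.\<close>
      have "J n \<le> (\<integral>\<^sup>+z. 1 \<partial>\<nu>)"
        unfolding J_def q_def using p0
        by (intro nn_integral_mono) (auto simp: indicator_def power_le_one intro!: powr_le1)
      also have "\<dots> < \<infinity>" by (simp add: eV)
      finally have Jfin: "J n < \<infinity>" .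
      have "0 < q n R * ennreal \<tau>" using R \<tau> p0 by (simp add: q_def ennreal_zero_less_mult_iff)
      then have "0 < J n" using J_ge by (rule less_le_trans)
      then obtain j where j: "0 < j" "J n = ennreal j"
        using Jfin by (cases "J n") (auto simp: less_top)
      have "ennreal (real (Suc n) powr p * m * j) \<le> ennreal ((1 / t0) powr p * (1 + V / \<tau>) * j)"
        using le j m \<tau> by (simp add: ennreal_mult V_def del: of_nat_Suc)
      then have "real (Suc n) powr p * m * j \<le> (1 / t0) powr p * (1 + V / \<tau>) * j"
        using j \<tau> by (subst (asm) ennreal_le_iff) (auto simp: V_def)
      then show ?thesis using j by simp
    qed
    define b where "b = (1 / t0) powr p * (1 + V / \<tau>) / m"
    obtain n :: nat where n: "b < real n" using reals_Archimedean2 by blast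
    \<comment> \<open>As \<open>p\<close> is at least 1, the left side of \<open>key\<close> grows
      at least linearly in \<open>n\<close> against a constant.\<close>
    have "real (Suc n) powr 1 \<le> real (Suc n) powr p" using p by (intro powr_mono) auto
    also have "\<dots> \<le> b" using key[of n] m by (simp add: b_def pos_le_divide_eq)
    finally show False using n by simp
  qed
  then show ?thesis by (intro trivial_if_generator_zero) (simp add: G_def)
qed

lemma uniformly_continuous_if_trivial:
  assumes "trivial_semigroup \<phi>"
  shows "uniformly_continuous X N \<Phi>"
  unfolding uniformly_continuous_def
proof (intro conjI allI impI bounded_composition)
  have N0: "N (\<lambda>z. \<Phi> t f z - f z) = 0" if f: "f \<in> X" and t: "0 \<le> t" for f t
  proof -
    have "pnorm p (\<lambda>z. \<Phi> t f z - f z) = pnorm p (\<lambda>z. 0)"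
      using assms t by (intro pnorm_cong) (auto simp: trivial_semigroup_def composition_apply)
    also have "\<dots> = 0" by (simp add: pnorm_def)
    finally show ?thesis using N_eq[OF X_holo[OF diff_X[OF f t]]] by simp
  qed
  have "operator_norm X N (\<lambda>f z. \<Phi> t f z - f z) = 0" if "0 < t" for t
    using op_diff_le[of t 0] N0[of _ t] that by (simp add: op_diff_def)
  then have "eventually (\<lambda>t. operator_norm X N (\<lambda>f z. \<Phi> t f z - f z) = 0) (at_right 0)"
    unfolding eventually_at_right_field by (intro exI[of _ 1]) auto
  then show "((\<lambda>t. operator_norm X N (\<lambda>f z. \<Phi> t f z - f z)) \<longlongrightarrow> 0) (at_right 0)"
    by (rule tendsto_eventually)
qed

end

section \<open>Weights as radial doubling measures\<close>

text \<open>Using the Borel profile instead of the weight gives a measure on Borel sets; the factor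
  \<open>1 / pi\<close> is that of the normalised area.\<close>

definition profile_measure :: "(real \<Rightarrow> real) \<Rightarrow> complex measure" where
  "profile_measure w = density (restrict_space lborel (ball 0 1)) (\<lambda>z. ennreal (w (norm z) / pi))"

lemma sets_profile_measure: "sets (profile_measure w) = sets (restrict_space borel (ball 0 1))"
  by (simp add: profile_measure_def sets_restrict_space)

lemma nn_integral_profile_measure:
  assumes w[measurable]: "w \<in> borel_measurable borel" and g: "g \<in> borel_measurable (restrict_space borel (ball 0 1))"
  shows "(\<integral>\<^sup>+z. g z \<partial>profile_measure w)
    = (\<integral>\<^sup>+z. ennreal (w (norm z) / pi) * (g z * indicator (ball 0 1) z) \<partial>lborel)"
    and "(\<lambda>z. g z * indicator (ball 0 1) z) \<in> borel_measurable borel"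
proof -
  have "sets (restrict_space lborel (ball 0 1) :: complex measure) = sets (restrict_space borel (ball 0 1))"
    by (simp add: sets_restrict_space)
  then have [measurable]: "g \<in> borel_measurable (restrict_space lborel (ball 0 1))"
    using g by (simp cong: measurable_cong_sets)
  have "(\<lambda>z::complex. ennreal (w (norm z) / pi)) \<in> borel_measurable borel" by measurable
  then have [measurable]: "(\<lambda>z. ennreal (w (norm z) / pi)) \<in> borel_measurable (restrict_space lborel (ball 0 1 :: complex set))"
    by (intro measurable_restrict_space1) simp
  have "(\<integral>\<^sup>+z. g z \<partial>profile_measure w) = (\<integral>\<^sup>+z. ennreal (w (norm z) / pi) * g z \<partial>restrict_space lborel (ball 0 1))"
    unfolding profile_measure_def by (rule nn_integral_density) measurable
  also have "\<dots> = (\<integral>\<^sup>+z. ennreal (w (norm z) / pi) * g z * indicator (ball 0 1) z \<partial>lborel)"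
    by (rule nn_integral_restrict_space) simp
  finally show "(\<integral>\<^sup>+z. g z \<partial>profile_measure w)
    = (\<integral>\<^sup>+z. ennreal (w (norm z) / pi) * (g z * indicator (ball 0 1) z) \<partial>lborel)"
    by (simp only: mult.assoc)
  show "(\<lambda>z. g z * indicator (ball 0 1) z) \<in> borel_measurable borel"
    using g by (subst (asm) borel_measurable_restrict_space_iff_ennreal) auto
qed

lemma emeasure_profile_measure:
  assumes w[measurable]: "w \<in> borel_measurable borel" and w0: "\<And>s. 0 \<le> w s" and S[measurable]: "S \<in> sets borel"
  shows "emeasure (profile_measure w) {z \<in> ball 0 1. norm z \<in> S}
    = (\<integral>\<^sup>+s. ennreal (2 * s * w s) * indicator {0..1} s * indicator S s \<partial>lborel)"
proof -
  have [measurable]: "ball 0 1 \<in> sets (borel :: complex measure)" by simp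
  have "{z \<in> space (borel :: complex measure). z \<in> ball 0 1 \<and> norm z \<in> S} \<in> sets borel" by measurable
  then have A[measurable]: "{z \<in> ball 0 1. norm z \<in> S} \<in> sets (restrict_space borel (ball 0 1 :: complex set))"
    by (subst sets_restrict_space_iff) auto
  have "emeasure (profile_measure w) {z \<in> ball 0 1. norm z \<in> S}
      = (\<integral>\<^sup>+z. indicator {z \<in> ball 0 1. norm z \<in> S} z \<partial>profile_measure w)"
    by (rule nn_integral_indicator[symmetric]) (subst sets_profile_measure, rule A)
  also have "\<dots> = (\<integral>\<^sup>+z. ennreal (w (norm z) / pi) * (indicator {z \<in> ball 0 1. norm z \<in> S} z * indicator (ball 0 1) z) \<partial>(lborel :: complex measure))"
    by (rule nn_integral_profile_measure(1)[OF w]) measurable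
  also have "\<dots> = (\<integral>\<^sup>+z. (ennreal (w (norm z) / pi) * indicator S (norm z)) * indicator (ball 0 1) z \<partial>(lborel :: complex measure))"
    by (intro nn_integral_cong) (auto simp: indicator_def)
  also have "\<dots> = (\<integral>\<^sup>+s. (ennreal (w s / pi) * indicator S s) * ennreal (2 * pi * s) * indicator {0..1} s \<partial>lborel)"
    by (rule nn_integral_disc_radial) measurable
  also have "\<dots> = (\<integral>\<^sup>+s. ennreal (2 * s * w s) * indicator {0..1} s * indicator S s \<partial>lborel)"
  proof (rule nn_integral_cong)
    fix s :: real
    have "ennreal (w s / pi) * ennreal (2 * pi * s) = ennreal (2 * s * w s)" if "0 \<le> s"
      using that w0[of s] by (simp add: ennreal_mult[symmetric] field_simps)
    then show "(ennreal (w s / pi) * indicator S s) * ennreal (2 * pi * s) * indicator {0..1} s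
        = ennreal (2 * s * w s) * indicator {0..1} s * indicator S s"
      by (auto simp: indicator_def)
  qed
  finally show ?thesis .
qed

text \<open>The tail of the measure has density \<open>2 * s * w s\<close> where the tail of the
  weight has \<open>w s\<close>: thus \<open>T\<close> is at most \<open>2 * W\<close> everywhere,
  and \<open>W\<close> is at most \<open>T\<close> from radius 1/2 on. The doubled radius
  \<open>(1 + r) / 2\<close> is never below 1/2, so the doubling constant passes over as
  \<open>2 * C\<close> for every \<open>r\<close>.\<close>

lemma upper_doubling_measure:
  assumes \<omega>: "\<omega> \<in> upper_doubling_weights" and pos: "\<And>z. z \<in> ball 0 1 \<Longrightarrow> 0 < weight_tail \<omega> z"
    and w[measurable]: "w \<in> borel_measurable borel" and w0: "\<And>s. 0 \<le> w s"
    and AEz: "AE z in lborel. z \<in> ball 0 1 \<longrightarrow> \<omega> z = w (norm z)"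
    and AEs: "AE s in lborel. 0 < s \<and> s < 1 \<longrightarrow> \<omega> (of_real s) = w s"
  obtains C where "radial_doubling_measure (profile_measure w) C"
proof -
  let ?\<nu> = "profile_measure w"
  obtain C where C: "1 \<le> C" and dbl: "\<And>r. 0 \<le> r \<Longrightarrow> r < 1 \<Longrightarrow>
      weight_tail \<omega> (of_real r) \<le> ennreal C * weight_tail \<omega> (of_real ((1 + r) / 2))"
    using \<omega> unfolding upper_doubling_weights_def by blast
  have rad: "radial_weight \<omega>" using \<omega> by (simp add: upper_doubling_weights_def)
  define T where "T = (\<lambda>r. emeasure ?\<nu> {z \<in> ball 0 1. r \<le> norm z})"
  define W where "W = (\<lambda>r. weight_tail \<omega> (complex_of_real r))"
  have T_eq: "T r = (\<integral>\<^sup>+s. ennreal (2 * s * w s) * indicator {0..1} s * indicator {r..} s \<partial>lborel)" for r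
    unfolding T_def using emeasure_profile_measure[OF w w0, of "{r..}"] by simp
  have W_eq: "W r = (\<integral>\<^sup>+s. ennreal (w s) * indicator {r..<1} s \<partial>lborel)" if r: "0 \<le> r" for r
  proof -
    have "W r = (\<integral>\<^sup>+s. ennreal (\<omega> (of_real s)) * indicator {r..<1} s \<partial>lborel)"
      using r by (simp add: W_def weight_tail_def nn_integral_completion)
    also have "\<dots> = (\<integral>\<^sup>+s. ennreal (w s) * indicator {r..<1} s \<partial>lborel)"
    proof (rule nn_integral_cong_AE)
      have "AE s in lborel. s \<noteq> (0::real)" by (rule AE_lborel_singleton)
      with AEs show "AE s in lborel. ennreal (\<omega> (of_real s)) * indicator {r..<1} s = ennreal (w s) * indicator {r..<1} s"
        by eventually_elim (use r in \<open>auto simp: indicator_def\<close>)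
    qed
    finally show ?thesis .
  qed
  have T_le: "T r \<le> 2 * W r" if r: "0 \<le> r" for r
  proof -
    have "T r \<le> (\<integral>\<^sup>+s. 2 * (ennreal (w s) * indicator {r..<1} s) \<partial>lborel)"
      unfolding T_eq
    proof (rule nn_integral_mono_AE)
      have "AE s in lborel. s \<noteq> (1::real)" by (rule AE_lborel_singleton)
      then show "AE s in lborel. ennreal (2 * s * w s) * indicator {0..1} s * indicator {r..} s \<le> 2 * (ennreal (w s) * indicator {r..<1} s)"
      proof eventually_elim
        case (elim s)
        have "ennreal (2 * s * w s) \<le> 2 * ennreal (w s)" if "0 \<le> s" "s \<le> 1"
        proof -
          have "2 * s * w s \<le> 2 * 1 * w s" using that w0[of s] by (intro mult_right_mono mult_left_mono) auto
          then have "ennreal (2 * s * w s) \<le> ennreal (2 * w s)" by (intro ennreal_leI) simp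
          then show ?thesis using w0[of s] by (simp add: ennreal_mult)
        qed
        then show ?case using elim by (auto simp: indicator_def)
      qed
    qed
    also have "\<dots> = 2 * W r" unfolding W_eq[OF r] by (rule nn_integral_cmult) measurable
    finally show ?thesis .
  qed
  have W_le: "W r \<le> T r" if r: "1 / 2 \<le> r" for r
    unfolding T_eq W_eq[OF order_trans[OF _ r], simplified]
  proof (rule nn_integral_mono)
    fix s
    have "ennreal (w s) \<le> ennreal (2 * s * w s)" if "r \<le> s"
    proof -
      have "1 * w s \<le> 2 * s * w s" using that r w0[of s] by (intro mult_right_mono) auto
      then show ?thesis by (intro ennreal_leI) simp
    qed
    then show "ennreal (w s) * indicator {r..<1} s \<le> ennreal (2 * s * w s) * indicator {0..1} s * indicator {r..} s"
      using r by (auto simp: indicator_def)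
  qed
  have T_mono: "T r \<le> T r'" if "r' \<le> r" for r r'
    unfolding T_eq using that by (intro nn_integral_mono) (auto simp: indicator_def)
  show ?thesis
  proof (rule that[of "2 * C"], rule radial_doubling_measure.intro)
    show "sets ?\<nu> = sets (restrict_space borel (ball 0 1))" by (rule sets_profile_measure)
    show "1 \<le> 2 * C" using C by simp
    show "finite_measure ?\<nu>"
    proof (rule finite_measureI)
      have "emeasure ?\<nu> (space ?\<nu>) = (\<integral>\<^sup>+z. 1 \<partial>?\<nu>)" by simp
      also have "\<dots> = (\<integral>\<^sup>+z. ennreal (w (norm z) / pi) * (1 * indicator (ball 0 1) z) \<partial>(lborel :: complex measure))"
        by (rule nn_integral_profile_measure(1)[OF w]) simp
      also have "\<dots> \<le> (\<integral>\<^sup>+z. ennreal (norm (indicator (ball 0 1) z *\<^sub>R \<omega> z)) \<partial>(lborel :: complex measure))"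
      proof (rule nn_integral_mono_AE)
        show "AE z in lborel. ennreal (w (norm z) / pi) * (1 * indicator (ball 0 1) z) \<le> ennreal (norm (indicator (ball 0 1) z *\<^sub>R \<omega> z))"
          using AEz
        proof eventually_elim
          case (elim z)
          have "w (norm z) / pi \<le> w (norm z) / 1"
            using w0[of "norm z"] pi_ge_two by (intro divide_left_mono) auto
          then show ?case using elim w0[of "norm z"] by (auto simp: indicator_def intro!: ennreal_leI)
        qed
      qed
      also have "\<dots> = (\<integral>\<^sup>+z. ennreal (norm (indicator (ball 0 1) z *\<^sub>R \<omega> z)) \<partial>lebesgue)"
        by (rule nn_integral_completion[symmetric])
      also have "\<dots> < \<infinity>"
        using rad unfolding radial_weight_def set_integrable_def integrable_iff_bounded by blast
      finally show "emeasure ?\<nu> (space ?\<nu>) \<noteq> \<infinity>" by simp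
    qed
    show "(\<integral>\<^sup>+z. g (c * z) \<partial>?\<nu>) = (\<integral>\<^sup>+z. g z \<partial>?\<nu>)" if g: "g \<in> borel_measurable ?\<nu>" and c: "norm c = 1" for g c
    proof -
      have g': "g \<in> borel_measurable (restrict_space borel (ball 0 1))"
        using g by (simp cong: measurable_cong_sets add: sets_profile_measure)
      have "(\<lambda>z. c * z) \<in> restrict_space borel (ball 0 1) \<rightarrow>\<^sub>M restrict_space borel (ball 0 1)"
        by (rule measurable_restrict_space2)
           (auto simp: norm_mult c space_restrict_space intro!: measurable_restrict_space1)
      from measurable_compose[OF this g']
      have gc: "(\<lambda>z. g (c * z)) \<in> borel_measurable (restrict_space borel (ball 0 1))" .
      note [measurable] = nn_integral_profile_measure(2)[OF w g']
      have "(\<integral>\<^sup>+z. g (c * z) \<partial>?\<nu>) = (\<integral>\<^sup>+z. ennreal (w (norm (c * z)) / pi) * (g (c * z) * indicator (ball 0 1) (c * z)) \<partial>lborel)"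
        using nn_integral_profile_measure(1)[OF w gc] by (simp add: norm_mult c indicator_def)
      also have "\<dots> = (\<integral>\<^sup>+z. ennreal (w (norm z) / pi) * (g z * indicator (ball 0 1) z) \<partial>lborel)"
        by (rule nn_integral_rotate[OF _ c, where g="\<lambda>z. ennreal (w (norm z) / pi) * (g z * indicator (ball 0 1) z)"]) measurable
      finally show ?thesis by (simp only: nn_integral_profile_measure(1)[OF w g'])
    qed
    show "emeasure ?\<nu> {z \<in> ball 0 1. norm z = r} = 0" for r
    proof -
      have "emeasure ?\<nu> {z \<in> ball 0 1. norm z = r} = (\<integral>\<^sup>+s. ennreal (2 * s * w s) * indicator {0..1} s * indicator {r} s \<partial>lborel)"
        using emeasure_profile_measure[OF w w0, of "{r}"] by simp
      also have "\<dots> = (\<integral>\<^sup>+s. 0 \<partial>(lborel :: real measure))"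
      proof (rule nn_integral_cong_AE)
        have "AE s in lborel. s \<noteq> r" by (rule AE_lborel_singleton)
        then show "AE s in lborel. ennreal (2 * s * w s) * indicator {0..1} s * indicator {r} s = 0"
          by eventually_elim simp
      qed
      finally show ?thesis by simp
    qed
    show "0 < emeasure ?\<nu> {z \<in> ball 0 1. r \<le> norm z}" if r: "r < 1" for r
    proof -
      \<comment> \<open>\<open>W_le\<close> starts at radius 1/2; monotonicity of \<open>T\<close>
        covers smaller and negative \<open>r\<close>.\<close>
      have "0 < W (max r (1 / 2))" unfolding W_def using r by (intro pos) auto
      also have "\<dots> \<le> T (max r (1 / 2))" by (rule W_le) simp
      also have "\<dots> \<le> T r" by (rule T_mono) simp
      finally show ?thesis by (simp only: T_def)
    qed
    show "emeasure ?\<nu> {z \<in> ball 0 1. r \<le> norm z} \<le> ennreal (2 * C) * emeasure ?\<nu> {z \<in> ball 0 1. (1 + r) / 2 \<le> norm z}"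
      if r: "0 \<le> r" "r < 1" for r
    proof -
      have "T r \<le> 2 * W r" by (rule T_le[OF r(1)])
      also have "\<dots> \<le> 2 * (ennreal C * W ((1 + r) / 2))"
        unfolding W_def by (intro mult_left_mono dbl r) simp
      also have "\<dots> \<le> 2 * (ennreal C * T ((1 + r) / 2))"
        using r by (intro mult_left_mono W_le) auto
      also have "\<dots> = ennreal (2 * C) * T ((1 + r) / 2)"
        using C by (simp add: ennreal_mult mult.assoc)
      finally show ?thesis by (simp only: T_def)
    qed
  qed
qed

text \<open>The weight and its profile give integrands that agree almost everywhere. The norm
  identity needs no finiteness: if \<open>P\<close> is infinite, the Bochner integral and
  \<open>enn2real\<close> both return 0.\<close>

lemma bergman_pnorm:
  assumes rad: "radial_weight \<omega>" and w[measurable]: "w \<in> borel_measurable borel" and w0: "\<And>s. 0 \<le> w s"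
    and AEz: "AE z in lborel. z \<in> ball 0 1 \<longrightarrow> \<omega> z = w (norm z)"
    and p: "0 < p" and f: "f holomorphic_on ball 0 1"
    and P: "P = (\<integral>\<^sup>+z. ennreal (norm (f z) powr p) \<partial>profile_measure w)"
  shows "set_integrable lebesgue (ball 0 1) (\<lambda>z. norm (f z) powr p * \<omega> z) \<longleftrightarrow> P < \<infinity>"
    and "bergman_norm p \<omega> f = enn2real P powr (1 / p)"
proof -
  define F where "F = (\<lambda>z. indicator (ball 0 1) z *\<^sub>R (norm (f z) powr p * \<omega> z))"
  have cont: "continuous_on (ball 0 1) (\<lambda>z. norm (f z) powr p)"
    using p by (intro continuous_on_powr' continuous_on_norm continuous_on_const holomorphic_on_imp_continuous_on f) auto
  have "(\<lambda>z. indicator (ball 0 1) z *\<^sub>R (norm (f z) powr p)) \<in> borel_measurable borel"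
    by (rule borel_measurable_continuous_on_indicator[OF _ cont]) simp
  then have m1: "(\<lambda>z. indicator (ball 0 1) z *\<^sub>R (norm (f z) powr p)) \<in> borel_measurable lebesgue"
    by (intro measurable_completion) simp
  have m2: "(\<lambda>z. indicator (ball 0 1) z *\<^sub>R \<omega> z) \<in> borel_measurable lebesgue"
    using rad unfolding radial_weight_def set_integrable_def by (intro borel_measurable_integrable) simp
  have F_eq: "(indicator (ball 0 1) z *\<^sub>R (norm (f z) powr p)) * (indicator (ball 0 1) z *\<^sub>R \<omega> z) = F z" for z
    by (cases "z \<in> ball 0 1") (simp_all add: F_def)
  have Fm: "F \<in> borel_measurable lebesgue"
    using borel_measurable_times[OF m1 m2] by (simp only: F_eq)
  have F0: "0 \<le> F z" for z
  proof (cases "z \<in> ball 0 1")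
    case True
    then have "0 \<le> \<omega> z" using rad unfolding radial_weight_def by blast
    then show ?thesis by (simp add: F_def)
  qed (simp add: F_def)
  have m: "(\<lambda>z. ennreal (norm (f z) powr p)) \<in> borel_measurable (restrict_space borel (ball 0 1))"
    using borel_measurable_continuous_on_restrict[OF cont] by measurable
  have "(\<integral>\<^sup>+z. ennreal (F z) \<partial>lebesgue) = (\<integral>\<^sup>+z. ennreal (F z) \<partial>lborel)"
    by (rule nn_integral_completion)
  also have "\<dots> = (\<integral>\<^sup>+z. ennreal pi * (ennreal (w (norm z) / pi) * (ennreal (norm (f z) powr p) * indicator (ball 0 1) z)) \<partial>lborel)"
  proof (rule nn_integral_cong_AE)
    show "AE z in lborel. ennreal (F z) = ennreal pi * (ennreal (w (norm z) / pi) * (ennreal (norm (f z) powr p) * indicator (ball 0 1) z))"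
      using AEz
    proof eventually_elim
      case (elim z)
      have "ennreal pi * (ennreal (w (norm z) / pi) * ennreal (norm (f z) powr p))
          = ennreal (pi * (w (norm z) / pi * norm (f z) powr p))"
      proof -
        have nn: "0 \<le> w (norm z) / pi" "0 \<le> norm (f z) powr p" using w0[of "norm z"] by auto
        show ?thesis
          by (simp only: ennreal_mult[OF pi_ge_zero mult_nonneg_nonneg[OF nn]] ennreal_mult[OF nn])
      qed
      then show ?case using elim by (auto simp: F_def indicator_def mult.commute)
    qed
  qed
  also have "\<dots> = ennreal pi * P"
    unfolding P nn_integral_profile_measure(1)[OF w m]
    using nn_integral_profile_measure(2)[OF w m]
    by (intro nn_integral_cmult) simp
  finally have FP: "(\<integral>\<^sup>+z. ennreal (F z) \<partial>lebesgue) = ennreal pi * P" .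
  have "set_integrable lebesgue (ball 0 1) (\<lambda>z. norm (f z) powr p * \<omega> z) \<longleftrightarrow> integrable lebesgue F"
    by (simp add: set_integrable_def F_def)
  also have "\<dots> \<longleftrightarrow> ennreal pi * P < \<infinity>"
    using Fm F0 FP by (simp add: integrable_iff_bounded)
  also have "\<dots> \<longleftrightarrow> P < \<infinity>"
    by (auto simp: ennreal_mult_less_top)
  finally show "set_integrable lebesgue (ball 0 1) (\<lambda>z. norm (f z) powr p * \<omega> z) \<longleftrightarrow> P < \<infinity>" .
  have "(LINT z:ball 0 1|lebesgue. norm (f z) powr p * \<omega> z) = enn2real (ennreal pi * P)"
    unfolding set_lebesgue_integral_def F_def[symmetric] FP[symmetric]
    using F0 by (intro integral_eq_nn_integral Fm) auto
  also have "\<dots> = pi * enn2real P" by (simp add: enn2real_mult)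
  finally show "bergman_norm p \<omega> f = enn2real P powr (1 / p)" by (simp add: bergman_norm_def)
qed

theorem proposition11:
  fixes p :: real and \<omega> :: "complex \<Rightarrow> real"
    and \<phi> :: "real \<Rightarrow> complex \<Rightarrow> complex" and G :: "complex \<Rightarrow> complex"
  assumes "1 \<le> p"
    and "\<omega> \<in> upper_doubling_weights"
    and "\<And>z. z \<in> ball 0 1 \<Longrightarrow> weight_tail \<omega> z > 0"
    and "self_map_semigroup \<phi>"
    and "\<And>z. z \<in> ball 0 1 \<Longrightarrow> G z = infinitesimal_generator \<phi> z"
  shows "strongly_continuous (bergman_space p \<omega>) (bergman_norm p \<omega>) (composition_semigroup \<phi>)
    \<and> generator_domain (bergman_space p \<omega>) (bergman_norm p \<omega>) (composition_semigroup \<phi>)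
        = {f \<in> bergman_space p \<omega>. (\<lambda>z. G z * deriv f z) \<in> bergman_space p \<omega>}
    \<and> (\<forall>f \<in> generator_domain (bergman_space p \<omega>) (bergman_norm p \<omega>) (composition_semigroup \<phi>).
        \<forall>z \<in> ball 0 1. generator (bergman_space p \<omega>) (bergman_norm p \<omega>)
          (composition_semigroup \<phi>) f z = G z * deriv f z)
    \<and> (uniformly_continuous (bergman_space p \<omega>) (bergman_norm p \<omega>) (composition_semigroup \<phi>)
        \<longleftrightarrow> trivial_semigroup \<phi>)"
proof -
  have rad: "radial_weight \<omega>" using assms(2) by (simp add: upper_doubling_weights_def)
  obtain w where w: "w \<in> borel_measurable borel" "\<And>s. 0 \<le> w s"
    and AEz: "AE z in lborel. z \<in> ball 0 1 \<longrightarrow> \<omega> z = w (norm z)"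
    and AEs: "AE s in lborel. 0 < s \<and> s < 1 \<longrightarrow> \<omega> (of_real s) = w s"
    by (rule radial_weight_profile[OF rad]) (rule that)
  obtain C where C: "radial_doubling_measure (profile_measure w) C"
    by (rule upper_doubling_measure[OF assms(2,3) w AEz AEs]) (assumption, rule that)
  interpret R: radial_doubling_measure "profile_measure w" C by (rule C)
  have p0: "0 < p" using assms(1) by simp
  note norm_facts = bergman_pnorm[OF rad w AEz p0 _ R.pnorm_def]
  interpret bergman_flow "profile_measure w" C \<phi> p "bergman_space p \<omega>" "bergman_norm p \<omega>"
  proof
    show "self_map_semigroup \<phi>" by (rule assms(4))
    show "1 \<le> p" by (rule assms(1))
    show "bergman_space p \<omega> = {f. f holomorphic_on ball 0 1 \<and> R.pnorm p f < \<infinity>}"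
      unfolding bergman_space_def using norm_facts(1) by blast
    show "bergman_norm p \<omega> f = enn2real (R.pnorm p f) powr (1 / p)" if "f holomorphic_on ball 0 1" for f
      by (rule norm_facts(2)[OF that])
  qed
  let ?X = "bergman_space p \<omega>" and ?N = "bergman_norm p \<omega>" and ?C = "composition_semigroup \<phi>"
  have G: "G z = infinitesimal_generator \<phi> z" if "norm z < 1" for z using assms(5) that by simp
  have val: "g z = G z * deriv f z" if "f \<in> ?X" "has_generator_value ?X ?N ?C f g" "norm z < 1" for f g z
    using generator_value_eq[OF that] G[OF that(3)] by simp
  have "f \<in> generator_domain ?X ?N ?C \<longleftrightarrow> f \<in> ?X \<and> (\<lambda>z. G z * deriv f z) \<in> ?X" for f
  proof
    assume "f \<in> generator_domain ?X ?N ?C"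
    then obtain g where f: "f \<in> ?X" and g: "has_generator_value ?X ?N ?C f g"
      by (auto simp: generator_domain_def)
    have gX: "g \<in> ?X" using g by (simp add: has_generator_value_def)
    have "(\<lambda>z. G z * deriv f z) \<in> ?X"
      by (rule X_cong[OF gX]) (rule val[OF f g])
    then show "f \<in> ?X \<and> (\<lambda>z. G z * deriv f z) \<in> ?X" using f by blast
  next
    assume f: "f \<in> ?X \<and> (\<lambda>z. G z * deriv f z) \<in> ?X"
    \<comment> \<open>\<open>G\<close> is tied to the generator only on the disc, so membership has
      to be transported by congruence.\<close>
    have "(\<lambda>z. infinitesimal_generator \<phi> z * deriv f z) \<in> ?X"
      by (rule X_cong[OF conjunct2[OF f]]) (simp add: G)
    from has_generator_valueI[OF conjunct1[OF f] this]
    show "f \<in> generator_domain ?X ?N ?C" using f unfolding generator_domain_def by blast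
  qed
  then have dom: "generator_domain ?X ?N ?C = {f \<in> ?X. (\<lambda>z. G z * deriv f z) \<in> ?X}" by blast
  \<comment> \<open>Whatever the choice operator selects, \<open>val\<close> determines it on the
    disc.\<close>
  have gen: "generator ?X ?N ?C f z = G z * deriv f z"
    if f: "f \<in> generator_domain ?X ?N ?C" and z: "z \<in> ball 0 1" for f z
  proof -
    have fX: "f \<in> ?X" and ex: "\<exists>g. has_generator_value ?X ?N ?C f g"
      using f by (auto simp: generator_domain_def)
    have "has_generator_value ?X ?N ?C f (generator ?X ?N ?C f)"
      unfolding generator_def by (rule someI_ex[OF ex])
    then show ?thesis using val[OF fX] z by simp
  qed
  show ?thesis
    using strongly_continuous_composition dom gen trivial_if_uniformly_continuous uniformly_continuous_if_trivial
    by blast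
qed

end
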